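(* Let $k$ be a commutative ring and $A$ a $k$-algebra. The weak right center $\mathcal{W}_r({}_A\mathcal{M}_A)$ of the monoidal category of $A$-bimodules and the category $\mathcal{YD}^{A^e}$ of right Yetter-Drinfeld $A^e$-modules are isomorphic.
   Context: Conventions: $\otimes=\otimes_k$; algebras are associative and unital; $A$-bimodules are $k$-central, i.e. modules over $A^e=A\otimes A^{\rm op}$. The category ${}_A\mathcal{M}_A$ of $A$-bimodules is monoidal with tensor product $\otimes_A$ and unit object $A$ (treated as if strict). For a monoidal category $(\mathcal{C},\otimes,I)$, the weak right center $\mathcal{W}_r(\mathcal{C})$ has as objects the pairs $(V,c_{-,V})$ with $V\in\mathcal{C}$ and $c_{-,V}:-\otimes V\to V\otimes -$ a natural transformation such that $c_{I,V}$ is the canonical isomorphism $I\otimes V\cong V\otimes I$ and $c_{X\otimes Y,V}=(c_{X,V}\otimes Y)\circ(X\otimes c_{Y,V})$ for all $X,Y\in\mathcal{C}$; a morphism $(V,c_{-,V})\to(V',c_{-,V'})$ is a morphism $f:V\to V'$ in $\mathcal{C}$ with $(f\otimes X)\circ c_{X,V}=c_{X,V'}\circ(X\otimes f)$ for all $X$. An object of $\mathcal{YD}^{A^e}$ is a pair $(V,\rho)$ with $V$ an $A$-bimodule and $\rho:V\to V\otimes A$ a $k$-linear map, written $\rho(v)=v_{[0]}\otimes v_{[1]}$ (summation understood), such that for all $v\in V$, $a\in A$: $v_{[0]}v_{[1]}=v$; $\rho(v_{[0]})\otimes v_{[1]}=v_{[0]}\otimes 1\otimes v_{[1]}$ in $V\otimes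 A\otimes A$; $\rho(va)=v_{[0]}\otimes v_{[1]}a$; $\rho(av)=v_{[0]}\otimes av_{[1]}$; $av_{[0]}\otimes v_{[1]}=v_{[0]}a\otimes v_{[1]}$. Morphisms are $A$-bimodule maps $f$ with $\rho'\circ f=(f\otimes A)\circ\rho$. *)

theory Defs
  imports "HOL-Algebra.Module" "HOL-Algebra.Generated_Groups" "HOL-Algebra.Free_Abelian_Groups"
begin

section \<open>Categories, functors, monoidal data\<close>

text \<open>Morphisms are indexed by source and target, so that \<open>Mor C X Y\<close> need not be disjoint from
  \<open>Mor C X' Y'\<close>. \<open>Cmp C X Y Z g f\<close> is \<open>g \<circ> f\<close> for \<open>f : X \<rightarrow> Y\<close> and \<open>g : Y \<rightarrow> Z\<close>.\<close>

record ('o, 'm) cat =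
  Obj :: "'o set"
  Mor :: "'o \<Rightarrow> 'o \<Rightarrow> 'm set"
  Idn :: "'o \<Rightarrow> 'm"
  Cmp :: "'o \<Rightarrow> 'o \<Rightarrow> 'o \<Rightarrow> 'm \<Rightarrow> 'm \<Rightarrow> 'm"

definition category :: "('o, 'm, 'z) cat_scheme \<Rightarrow> bool" where
  "category C \<longleftrightarrow>
    (\<forall>X\<in>Obj C. Idn C X \<in> Mor C X X) \<and>
    (\<forall>X\<in>Obj C. \<forall>Y\<in>Obj C. \<forall>Z\<in>Obj C. \<forall>f\<in>Mor C X Y. \<forall>g\<in>Mor C Y Z.
       Cmp C X Y Z g f \<in> Mor C X Z) \<and>
    (\<forall>X\<in>Obj C. \<forall>Y\<in>Obj C. \<forall>f\<in>Mor C X Y.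
       Cmp C X X Y f (Idn C X) = f \<and> Cmp C X Y Y (Idn C Y) f = f) \<and>
    (\<forall>W\<in>Obj C. \<forall>X\<in>Obj C. \<forall>Y\<in>Obj C. \<forall>Z\<in>Obj C.
       \<forall>f\<in>Mor C W X. \<forall>g\<in>Mor C X Y. \<forall>h\<in>Mor C Y Z.
         Cmp C W X Z (Cmp C X Y Z h g) f = Cmp C W Y Z h (Cmp C W X Y g f))"

definition cat_functor ::
  "('o, 'm, 'y) cat_scheme \<Rightarrow> ('p, 'n, 'z) cat_scheme \<Rightarrow>
   ('o \<Rightarrow> 'p) \<Rightarrow> ('o \<Rightarrow> 'o \<Rightarrow> 'm \<Rightarrow> 'n) \<Rightarrow> bool" where
  "cat_functor C D F0 F1 \<longleftrightarrow>
    (\<forall>X\<in>Obj C. F0 X \<in> Obj D) \<and>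
    (\<forall>X\<in>Obj C. \<forall>Y\<in>Obj C. \<forall>f\<in>Mor C X Y. F1 X Y f \<in> Mor D (F0 X) (F0 Y)) \<and>
    (\<forall>X\<in>Obj C. F1 X X (Idn C X) = Idn D (F0 X)) \<and>
    (\<forall>X\<in>Obj C. \<forall>Y\<in>Obj C. \<forall>Z\<in>Obj C. \<forall>f\<in>Mor C X Y. \<forall>g\<in>Mor C Y Z.
       F1 X Z (Cmp C X Y Z g f) = Cmp D (F0 X) (F0 Y) (F0 Z) (F1 Y Z g) (F1 X Y f))"

definition isomorphic_categories ::
  "('o, 'm, 'y) cat_scheme \<Rightarrow> ('p, 'n, 'z) cat_scheme \<Rightarrow> bool" where
  "isomorphic_categories C D \<longleftrightarrow> category C \<and> category D \<and>
    (\<exists>F0 F1 G0 G1. cat_functor C D F0 F1 \<and> cat_functor D C G0 G1 \<and>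
      (\<forall>X\<in>Obj C. G0 (F0 X) = X) \<and>
      (\<forall>X\<in>Obj C. \<forall>Y\<in>Obj C. \<forall>f\<in>Mor C X Y. G1 (F0 X) (F0 Y) (F1 X Y f) = f) \<and>
      (\<forall>Y\<in>Obj D. F0 (G0 Y) = Y) \<and>
      (\<forall>X\<in>Obj D. \<forall>Y\<in>Obj D. \<forall>g\<in>Mor D X Y. F1 (G0 X) (G0 Y) (G1 X Y g) = g))"

text \<open>\<open>TMor C X X' Y Y' f g\<close> is \<open>f \<otimes> g : X \<otimes> Y \<rightarrow> X' \<otimes> Y'\<close>;
  \<open>Assoc C X Y Z : (X \<otimes> Y) \<otimes> Z \<rightarrow> X \<otimes> (Y \<otimes> Z)\<close>,
  \<open>Lunit C X : I \<otimes> X \<rightarrow> X\<close>, \<open>Runit C X : X \<otimes> I \<rightarrow> X\<close>.\<close>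

record ('o, 'm) moncat = "('o, 'm) cat" +
  TObj :: "'o \<Rightarrow> 'o \<Rightarrow> 'o"
  TMor :: "'o \<Rightarrow> 'o \<Rightarrow> 'o \<Rightarrow> 'o \<Rightarrow> 'm \<Rightarrow> 'm \<Rightarrow> 'm"
  Unit :: "'o"
  Assoc :: "'o \<Rightarrow> 'o \<Rightarrow> 'o \<Rightarrow> 'm"
  Lunit :: "'o \<Rightarrow> 'm"
  Runit :: "'o \<Rightarrow> 'm"

definition inv_mor :: "('o, 'm, 'z) cat_scheme \<Rightarrow> 'o \<Rightarrow> 'o \<Rightarrow> 'm \<Rightarrow> 'm" where
  "inv_mor C X Y f =
    (THE g. g \<in> Mor C Y X \<and> Cmp C X Y X g f = Idn C X \<and> Cmp C Y X Y f g = Idn C Y)"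

section \<open>The weak right center\<close>

text \<open>\<open>c X\<close> plays the role of \<open>c\<^bsub>X,V\<^esub> : X \<otimes> V \<rightarrow> V \<otimes> X\<close>. The hexagon is written with its
  associators: \<open>c\<^bsub>X \<otimes> Y,V\<^esub>\<close> is the composite
  \<open>(X \<otimes> Y) \<otimes> V \<rightarrow> X \<otimes> (Y \<otimes> V) \<rightarrow> X \<otimes> (V \<otimes> Y) \<rightarrow> (X \<otimes> V) \<otimes> Y \<rightarrow> (V \<otimes> X) \<otimes> Y \<rightarrow> V \<otimes> (X \<otimes> Y)\<close>.
  Families are extensional, so that distinct pairs are distinct objects.\<close>

definition half_braiding :: "('o, 'm, 'z) moncat_scheme \<Rightarrow> 'o \<Rightarrow> ('o \<Rightarrow> 'm) \<Rightarrow> bool" where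
  "half_braiding C V c \<longleftrightarrow>
    c \<in> (\<Pi>\<^sub>E X\<in>Obj C. Mor C (TObj C X V) (TObj C V X)) \<and>
    (\<forall>X\<in>Obj C. \<forall>Y\<in>Obj C. \<forall>f\<in>Mor C X Y.
       Cmp C (TObj C X V) (TObj C Y V) (TObj C V Y) (c Y) (TMor C X Y V V f (Idn C V)) =
       Cmp C (TObj C X V) (TObj C V X) (TObj C V Y) (TMor C V V X Y (Idn C V) f) (c X)) \<and>
    (let I = Unit C in
       c I = Cmp C (TObj C I V) V (TObj C V I)
               (inv_mor C (TObj C V I) V (Runit C V)) (Lunit C V)) \<and>
    (\<forall>X\<in>Obj C. \<forall>Y\<in>Obj C.
       (let P0 = TObj C (TObj C X Y) V;
            P1 = TObj C X (TObj C Y V);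
            P2 = TObj C X (TObj C V Y);
            P3 = TObj C (TObj C X V) Y;
            P4 = TObj C (TObj C V X) Y;
            P5 = TObj C V (TObj C X Y);
            XcY = TMor C X X (TObj C Y V) (TObj C V Y) (Idn C X) (c Y);
            cXY = TMor C (TObj C X V) (TObj C V X) Y Y (c X) (Idn C Y)
        in c (TObj C X Y) =
           Cmp C P0 P4 P5 (Assoc C V X Y)
             (Cmp C P0 P3 P4 cXY
               (Cmp C P0 P2 P3 (inv_mor C P3 P2 (Assoc C X V Y))
                 (Cmp C P0 P1 P2 XcY (Assoc C X Y V))))))"

definition weak_right_center :: "('o, 'm, 'z) moncat_scheme \<Rightarrow> ('o \<times> ('o \<Rightarrow> 'm), 'm) cat" where
  "weak_right_center C =
    \<lparr>Obj = {(V, c). V \<in> Obj C \<and> half_braiding C V c},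
     Mor = (\<lambda>(V, c) (V', c').
       {f \<in> Mor C V V'. \<forall>X\<in>Obj C.
          Cmp C (TObj C X V) (TObj C V X) (TObj C V' X) (TMor C V V' X X f (Idn C X)) (c X) =
          Cmp C (TObj C X V) (TObj C X V') (TObj C V' X) (c' X) (TMor C X X V V' (Idn C X) f)}),
     Idn = (\<lambda>(V, c). Idn C V),
     Cmp = (\<lambda>(U, _) (V, _) (W, _). Cmp C U V W)\<rparr>"

section \<open>Algebras and bimodules\<close>

text \<open>\<open>HOL-Algebra.Module.algebra\<close> covers only commutative algebras.\<close>

locale k_algebra = module k A + A?: ring A for k (structure) and A (structure) +
  assumes smult_mult_left:
      "\<lbrakk>s \<in> carrier k; a \<in> carrier A; b \<in> carrier A\<rbrakk> \<Longrightarrow>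
       (s \<odot>\<^bsub>A\<^esub> a) \<otimes>\<^bsub>A\<^esub> b = s \<odot>\<^bsub>A\<^esub> (a \<otimes>\<^bsub>A\<^esub> b)"
    and smult_mult_right:
      "\<lbrakk>s \<in> carrier k; a \<in> carrier A; b \<in> carrier A\<rbrakk> \<Longrightarrow>
       a \<otimes>\<^bsub>A\<^esub> (s \<odot>\<^bsub>A\<^esub> b) = s \<odot>\<^bsub>A\<^esub> (a \<otimes>\<^bsub>A\<^esub> b)"

text \<open>The \<open>monoid\<close> part is the underlying additive group, in the multiplicative notation of
  \<open>comm_group\<close>.\<close>

record ('l, 'r, 'v) bimod = "'v monoid" +
  lact :: "'l \<Rightarrow> 'v \<Rightarrow> 'v"
  ract :: "'v \<Rightarrow> 'r \<Rightarrow> 'v"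

text \<open>The first group of conditions fixes the operations outside the carriers, so that equality of
  records is equality of bimodules. The \<open>k\<close>-module structure of a bimodule is
  \<open>s v = (s 1) v\<close>; the last condition is \<open>k\<close>-centrality.\<close>

definition bimodule ::
  "('k, 'y) ring_scheme \<Rightarrow> ('k, 'a, 'z) module_scheme \<Rightarrow> ('a, 'a, 'v) bimod \<Rightarrow> bool" where
  "bimodule k A V \<longleftrightarrow>
    (\<forall>x y. x \<notin> carrier V \<or> y \<notin> carrier V \<longrightarrow> x \<otimes>\<^bsub>V\<^esub> y = undefined) \<and>
    (\<forall>a x. a \<notin> carrier A \<or> x \<notin> carrier V \<longrightarrow>
       lact V a x = undefined \<and> ract V x a = undefined) \<and>
    comm_group V \<and>
    (\<forall>a\<in>carrier A. \<forall>x\<in>carrier V. lact V a x \<in> carrier V \<and> ract V x a \<in> carrier V) \<and>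
    (\<forall>a\<in>carrier A. \<forall>x\<in>carrier V. \<forall>y\<in>carrier V.
       lact V a (x \<otimes>\<^bsub>V\<^esub> y) = lact V a x \<otimes>\<^bsub>V\<^esub> lact V a y \<and>
       ract V (x \<otimes>\<^bsub>V\<^esub> y) a = ract V x a \<otimes>\<^bsub>V\<^esub> ract V y a) \<and>
    (\<forall>a\<in>carrier A. \<forall>b\<in>carrier A. \<forall>x\<in>carrier V.
       lact V (a \<oplus>\<^bsub>A\<^esub> b) x = lact V a x \<otimes>\<^bsub>V\<^esub> lact V b x \<and>
       ract V x (a \<oplus>\<^bsub>A\<^esub> b) = ract V x a \<otimes>\<^bsub>V\<^esub> ract V x b \<and>
       lact V (a \<otimes>\<^bsub>A\<^esub> b) x = lact V a (lact V b x) \<and>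
       ract V x (a \<otimes>\<^bsub>A\<^esub> b) = ract V (ract V x a) b \<and>
       ract V (lact V a x) b = lact V a (ract V x b)) \<and>
    (\<forall>x\<in>carrier V. lact V \<one>\<^bsub>A\<^esub> x = x \<and> ract V x \<one>\<^bsub>A\<^esub> = x) \<and>
    (\<forall>s\<in>carrier k. \<forall>x\<in>carrier V. lact V (s \<odot>\<^bsub>A\<^esub> \<one>\<^bsub>A\<^esub>) x = ract V x (s \<odot>\<^bsub>A\<^esub> \<one>\<^bsub>A\<^esub>))"

definition bimod_maps ::
  "('k, 'a, 'z) module_scheme \<Rightarrow> ('a, 'a, 'v) bimod \<Rightarrow> ('a, 'a, 'w) bimod \<Rightarrow> ('v \<Rightarrow> 'w) set" where
  "bimod_maps A V W =
    {f \<in> hom V W \<inter> extensional (carrier V).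
       \<forall>a\<in>carrier A. \<forall>x\<in>carrier V.
         f (lact V a x) = lact W a (f x) \<and> f (ract V x a) = ract W (f x) a}"

definition regular_bimod :: "('k, 'a, 'z) module_scheme \<Rightarrow> ('a, 'a, 'a) bimod" where
  "regular_bimod A =
    \<lparr>carrier = carrier A, mult = add A, one = \<zero>\<^bsub>A\<^esub>, lact = mult A, ract = mult A\<rparr>"

section \<open>Tensor products\<close>

text \<open>\<open>hom_ext G H I p q\<close> is the group homomorphism \<open>G \<rightarrow> H\<close> with \<open>p i \<mapsto> q i\<close> for \<open>i \<in> I\<close>. It is only
  used where the \<open>p i\<close> generate \<open>G\<close> and such a homomorphism exists.\<close>

definition hom_ext ::
  "('g, 'y) monoid_scheme \<Rightarrow> ('h, 'z) monoid_scheme \<Rightarrow> 'i set \<Rightarrow> ('i \<Rightarrow> 'g) \<Rightarrow> ('i \<Rightarrow> 'h) \<Rightarrow>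
   'g \<Rightarrow> 'h" where
  "hom_ext G H I p q =
    (THE h. h \<in> hom G H \<inter> extensional (carrier G) \<and> (\<forall>i\<in>I. h (p i) = q i))"

text \<open>\<open>V \<otimes>\<^sub>M W\<close> for a right action of \<open>M\<close> on \<open>V\<close> and a left action of \<open>M\<close> on \<open>W\<close>: the free abelian group
  on \<open>V \<times> W\<close> modulo biadditivity and \<open>(v m, w) = (v, m w)\<close>. It keeps the outer actions.\<close>

definition tensor_rels ::
  "'m set \<Rightarrow> ('l, 'm, 'v) bimod \<Rightarrow> ('m, 'n, 'w) bimod \<Rightarrow> ('v \<times> 'w \<Rightarrow>\<^sub>0 int) set" where
  "tensor_rels M V W =
    {frag_of (x \<otimes>\<^bsub>V\<^esub> x', y) - (frag_of (x, y) + frag_of (x', y)) | x x' y.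
       x \<in> carrier V \<and> x' \<in> carrier V \<and> y \<in> carrier W} \<union>
    {frag_of (x, y \<otimes>\<^bsub>W\<^esub> y') - (frag_of (x, y) + frag_of (x, y')) | x y y'.
       x \<in> carrier V \<and> y \<in> carrier W \<and> y' \<in> carrier W} \<union>
    {frag_of (ract V x m, y) - frag_of (x, lact W m y) | x m y.
       x \<in> carrier V \<and> m \<in> M \<and> y \<in> carrier W}"

definition tensor_null ::
  "'m set \<Rightarrow> ('l, 'm, 'v) bimod \<Rightarrow> ('m, 'n, 'w) bimod \<Rightarrow> ('v \<times> 'w \<Rightarrow>\<^sub>0 int) set" where
  "tensor_null M V W =
    generate (free_Abelian_group (carrier V \<times> carrier W)) (tensor_rels M V W)"

definition pure ::
  "'m set \<Rightarrow> ('l, 'm, 'v) bimod \<Rightarrow> ('m, 'n, 'w) bimod \<Rightarrow> 'v \<Rightarrow> 'w \<Rightarrow> ('v \<times> 'w \<Rightarrow>\<^sub>0 int) set" where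
  "pure M V W x y =
    tensor_null M V W #>\<^bsub>free_Abelian_group (carrier V \<times> carrier W)\<^esub> frag_of (x, y)"

definition tensor ::
  "'m set \<Rightarrow> ('l, 'm, 'v) bimod \<Rightarrow> ('m, 'n, 'w) bimod \<Rightarrow>
   ('l, 'n, ('v \<times> 'w \<Rightarrow>\<^sub>0 int) set) bimod" where
  "tensor M V W =
    (let T = free_Abelian_group (carrier V \<times> carrier W) Mod tensor_null M V W;
         ext = hom_ext T T (carrier V \<times> carrier W) (\<lambda>(x, y). pure M V W x y)
     in \<lparr>carrier = carrier T, mult = mult T, one = one T,
         lact = (\<lambda>l. ext (\<lambda>(x, y). pure M V W (lact V l x) y)),
         ract = (\<lambda>t n. ext (\<lambda>(x, y). pure M V W x (ract W y n)) t)\<rparr>)"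

section \<open>The monoidal category of bimodules\<close>

text \<open>The category consists of all bimodules whose elements lie in a fixed type \<open>'u\<close>, which is the
  universe. If \<open>'u\<close> is infinite and at least as large as \<open>A\<close>, then \<open>A\<close> and the tensor products have
  copies in \<open>'u\<close>, and \<open>transport\<close> moves them there along an injection. A coset is encoded
  through a chosen representative, as \<open>'u \<times> 'u \<Rightarrow>\<^sub>0 int\<close> (unlike its power set) injects into \<open>'u\<close>.\<close>

definition transport ::
  "('k, 'a, 'z) module_scheme \<Rightarrow> ('v \<Rightarrow> 'u) \<Rightarrow> ('a, 'a, 'v) bimod \<Rightarrow> ('a, 'a, 'u) bimod" where
  "transport A e V =
    (let U = e ` carrier V; d = inv_into (carrier V) e
     in \<lparr>carrier = U,
         mult = (\<lambda>x y. if x \<in> U \<and> y \<in> U then e (d x \<otimes>\<^bsub>V\<^esub> d y) else undefined),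
         one = e \<one>\<^bsub>V\<^esub>,
         lact = (\<lambda>a x. if a \<in> carrier A \<and> x \<in> U then e (lact V a (d x)) else undefined),
         ract = (\<lambda>x a. if a \<in> carrier A \<and> x \<in> U then e (ract V (d x) a) else undefined)\<rparr>)"

definition emb :: "('k, 'a, 'z) module_scheme \<Rightarrow> 'a \<Rightarrow> 'u" where
  "emb A = (SOME i. inj_on i (carrier A))"

definition enc :: "('u \<times> 'u \<Rightarrow>\<^sub>0 int) set \<Rightarrow> 'u" where
  "enc t = (SOME e. inj e) (SOME z. z \<in> t)"

definition unit_u :: "('k, 'a, 'z) module_scheme \<Rightarrow> ('a, 'a, 'u) bimod" where
  "unit_u A = transport A (emb A) (regular_bimod A)"

definition tensor_u ::
  "('k, 'a, 'z) module_scheme \<Rightarrow> ('a, 'a, 'u) bimod \<Rightarrow> ('a, 'a, 'u) bimod \<Rightarrow> ('a, 'a, 'u) bimod" where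
  "tensor_u A X Y = transport A enc (tensor (carrier A) X Y)"

definition pure_u ::
  "('k, 'a, 'z) module_scheme \<Rightarrow> ('a, 'a, 'u) bimod \<Rightarrow> ('a, 'a, 'u) bimod \<Rightarrow> 'u \<Rightarrow> 'u \<Rightarrow> 'u" where
  "pure_u A X Y x y = enc (pure (carrier A) X Y x y)"

definition bimod_moncat ::
  "('k, 'y) ring_scheme \<Rightarrow> ('k, 'a, 'z) module_scheme \<Rightarrow>
   (('a, 'a, 'u) bimod, 'u \<Rightarrow> 'u) moncat" where
  "bimod_moncat k A =
    \<lparr>Obj = {V. bimodule k A V},
     Mor = bimod_maps A,
     Idn = (\<lambda>V. \<lambda>x\<in>carrier V. x),
     Cmp = (\<lambda>U V W g f. compose (carrier U) g f),
     TObj = tensor_u A,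
     TMor = (\<lambda>X X' Y Y' f g.
       hom_ext (tensor_u A X Y) (tensor_u A X' Y') (carrier X \<times> carrier Y)
         (\<lambda>(x, y). pure_u A X Y x y) (\<lambda>(x, y). pure_u A X' Y' (f x) (g y))),
     Unit = unit_u A,
     Assoc = (\<lambda>X Y Z.
       hom_ext (tensor_u A (tensor_u A X Y) Z) (tensor_u A X (tensor_u A Y Z))
         (carrier X \<times> carrier Y \<times> carrier Z)
         (\<lambda>(x, y, z). pure_u A (tensor_u A X Y) Z (pure_u A X Y x y) z)
         (\<lambda>(x, y, z). pure_u A X (tensor_u A Y Z) x (pure_u A Y Z y z))),
     Lunit = (\<lambda>X.
       hom_ext (tensor_u A (unit_u A) X) X (carrier A \<times> carrier X)
         (\<lambda>(a, x). pure_u A (unit_u A) X (emb A a) x) (\<lambda>(a, x). lact X a x)),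
     Runit = (\<lambda>X.
       hom_ext (tensor_u A X (unit_u A)) X (carrier X \<times> carrier A)
         (\<lambda>(x, a). pure_u A X (unit_u A) x (emb A a)) (\<lambda>(x, a). ract X x a))\<rparr>"

section \<open>Yetter-Drinfeld modules\<close>

text \<open>The tensor product over \<open>k\<close> is \<open>tensor\<close> with one-sided actions restricted along \<open>s \<mapsto> s 1\<close>.\<close>

definition res_right ::
  "('k, 'a, 'z) module_scheme \<Rightarrow> ('l, 'a, 'v) bimod \<Rightarrow> ('l, 'k, 'v) bimod" where
  "res_right A V =
    \<lparr>carrier = carrier V, mult = mult V, one = one V,
     lact = lact V, ract = (\<lambda>x s. ract V x (s \<odot>\<^bsub>A\<^esub> \<one>\<^bsub>A\<^esub>))\<rparr>"

definition res_left ::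
  "('k, 'a, 'z) module_scheme \<Rightarrow> ('a, 'r, 'v) bimod \<Rightarrow> ('k, 'r, 'v) bimod" where
  "res_left A V =
    \<lparr>carrier = carrier V, mult = mult V, one = one V,
     lact = (\<lambda>s x. lact V (s \<odot>\<^bsub>A\<^esub> \<one>\<^bsub>A\<^esub>) x), ract = ract V\<rparr>"

text \<open>\<open>tenA k A V\<close> is \<open>V \<otimes>\<^sub>k A\<close> with \<open>a (v \<otimes> b) c = a v \<otimes> b c\<close>, and \<open>mapA k A V W f g\<close> is
  \<open>f \<otimes> g : V \<otimes>\<^sub>k A \<rightarrow> W \<otimes>\<^sub>k A\<close>.\<close>

definition tenA ::
  "('k, 'y) ring_scheme \<Rightarrow> ('k, 'a, 'z) module_scheme \<Rightarrow> ('a, 'a, 'v) bimod \<Rightarrow>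
   ('a, 'a, ('v \<times> 'a \<Rightarrow>\<^sub>0 int) set) bimod" where
  "tenA k A V = tensor (carrier k) (res_right A V) (res_left A (regular_bimod A))"

definition pureA ::
  "('k, 'y) ring_scheme \<Rightarrow> ('k, 'a, 'z) module_scheme \<Rightarrow> ('a, 'a, 'v) bimod \<Rightarrow>
   'v \<Rightarrow> 'a \<Rightarrow> ('v \<times> 'a \<Rightarrow>\<^sub>0 int) set" where
  "pureA k A V = pure (carrier k) (res_right A V) (res_left A (regular_bimod A))"

definition mapA ::
  "('k, 'y) ring_scheme \<Rightarrow> ('k, 'a, 'z) module_scheme \<Rightarrow>
   ('a, 'a, 'v) bimod \<Rightarrow> ('a, 'a, 'w) bimod \<Rightarrow> ('v \<Rightarrow> 'w) \<Rightarrow> ('a \<Rightarrow> 'a) \<Rightarrow>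
   ('v \<times> 'a \<Rightarrow>\<^sub>0 int) set \<Rightarrow> ('w \<times> 'a \<Rightarrow>\<^sub>0 int) set" where
  "mapA k A V W f g =
    hom_ext (tenA k A V) (tenA k A W) (carrier V \<times> carrier A)
      (\<lambda>(v, b). pureA k A V v b) (\<lambda>(v, b). pureA k A W (f v) (g b))"

text \<open>After \<open>\<rho>\<close> is \<open>k\<close>-linear, the conditions are, in order:
  \<open>v\<^sub>0 v\<^sub>1 = v\<close>;
  \<open>\<rho>(v\<^sub>0) \<otimes> v\<^sub>1 = v\<^sub>0 \<otimes> 1 \<otimes> v\<^sub>1\<close>, where \<open>V \<otimes> A \<otimes> A\<close> is read as \<open>(V \<otimes> A) \<otimes> A\<close>;
  \<open>\<rho>(v a) = v\<^sub>0 \<otimes> v\<^sub>1 a\<close>;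
  \<open>\<rho>(a v) = v\<^sub>0 \<otimes> a v\<^sub>1\<close>;
  \<open>a v\<^sub>0 \<otimes> v\<^sub>1 = v\<^sub>0 a \<otimes> v\<^sub>1\<close>.\<close>

definition yd_coaction ::
  "('k, 'y) ring_scheme \<Rightarrow> ('k, 'a, 'z) module_scheme \<Rightarrow> ('a, 'a, 'v) bimod \<Rightarrow>
   ('v \<Rightarrow> ('v \<times> 'a \<Rightarrow>\<^sub>0 int) set) \<Rightarrow> bool" where
  "yd_coaction k A V \<rho> \<longleftrightarrow>
    \<rho> \<in> hom V (tenA k A V) \<inter> extensional (carrier V) \<and>
    (\<forall>s\<in>carrier k. \<forall>v\<in>carrier V.
       \<rho> (lact V (s \<odot>\<^bsub>A\<^esub> \<one>\<^bsub>A\<^esub>) v) = lact (tenA k A V) (s \<odot>\<^bsub>A\<^esub> \<one>\<^bsub>A\<^esub>) (\<rho> v)) \<and>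
    (\<forall>v\<in>carrier V.
       hom_ext (tenA k A V) V (carrier V \<times> carrier A)
         (\<lambda>(x, b). pureA k A V x b) (\<lambda>(x, b). ract V x b) (\<rho> v) = v) \<and>
    (\<forall>v\<in>carrier V.
       mapA k A V (tenA k A V) \<rho> (\<lambda>b. b) (\<rho> v) =
       mapA k A V (tenA k A V) (\<lambda>x. pureA k A V x \<one>\<^bsub>A\<^esub>) (\<lambda>b. b) (\<rho> v)) \<and>
    (\<forall>v\<in>carrier V. \<forall>a\<in>carrier A.
       \<rho> (ract V v a) = mapA k A V V (\<lambda>x. x) (\<lambda>b. b \<otimes>\<^bsub>A\<^esub> a) (\<rho> v)) \<and>
    (\<forall>v\<in>carrier V. \<forall>a\<in>carrier A.
       \<rho> (lact V a v) = mapA k A V V (\<lambda>x. x) (\<lambda>b. a \<otimes>\<^bsub>A\<^esub> b) (\<rho> v)) \<and>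
    (\<forall>v\<in>carrier V. \<forall>a\<in>carrier A.
       mapA k A V V (\<lambda>x. lact V a x) (\<lambda>b. b) (\<rho> v) =
       mapA k A V V (\<lambda>x. ract V x a) (\<lambda>b. b) (\<rho> v))"

definition yd_cat ::
  "('k, 'y) ring_scheme \<Rightarrow> ('k, 'a, 'z) module_scheme \<Rightarrow>
   (('a, 'a, 'u) bimod \<times> ('u \<Rightarrow> ('u \<times> 'a \<Rightarrow>\<^sub>0 int) set), 'u \<Rightarrow> 'u) cat" where
  "yd_cat k A =
    \<lparr>Obj = {(V, \<rho>). bimodule k A V \<and> yd_coaction k A V \<rho>},
     Mor = (\<lambda>(V, \<rho>) (V', \<rho>').
       {f \<in> bimod_maps A V V'. \<forall>v\<in>carrier V. \<rho>' (f v) = mapA k A V V' f (\<lambda>b. b) (\<rho> v)}),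
     Idn = (\<lambda>(V, _). \<lambda>x\<in>carrier V. x),
     Cmp = (\<lambda>(U, _) (V, _) (W, _) g f. compose (carrier U) g f)\<rparr>"

end

theory Submission
  imports Defs
begin

text \<open>Let \<open>E = A \<otimes>\<^sub>k A\<close> and \<open>u = 1 \<otimes> 1\<close>. Bimodule maps out of \<open>E\<close> are determined by the image of \<open>u\<close>, which
  may be any element, so by naturality a half braiding \<open>c\<close> on \<open>V\<close> is determined by the elements
  \<open>c\<^bsub>E\<^esub>(u \<otimes> v)\<close> of \<open>V \<otimes>\<^sub>A E \<cong> V \<otimes>\<^sub>k A\<close>. They are the values \<open>\<rho>(v)\<close> of a map \<open>\<rho>\<close>, and
  \<open>c\<^bsub>X\<^esub>(x \<otimes> v) = v\<^sub>0 \<otimes> x v\<^sub>1\<close>. Under this correspondence bilinearity and balancedness of \<open>c\<close> are the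
  compatibilities of \<open>\<rho>\<close> with the actions, the unit condition is \<open>v\<^sub>0 v\<^sub>1 = v\<close>, and the hexagon, which
  only needs to be checked at \<open>X = Y = E\<close> and \<open>x = y = u\<close>, is coassociativity. A bimodule map is a
  morphism for the half braidings if and only if it is one for the coactions.\<close>

section \<open>Balanced maps and tensor products\<close>

text \<open>The same tensor product occurs in several types, as cosets of formal sums and as an
  encoded copy inside \<open>'u\<close>, and over two bases, \<open>A\<close> and \<open>k\<close>.
  Hence the arguments refer to an arbitrary copy with its universal property, and an equation
  between additive maps is always checked on pure tensors. Naturality can be exploited at
  \<open>E\<close> only if \<open>E\<close> is an object, so a copy of \<open>E\<close> has to be
  built inside \<open>'u\<close>; the infinite universe and the injection of \<open>A\<close> serve
  this and the monoidal structure. The formula for \<open>c\<close> in terms of \<rho> exhibits each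
  axiom on one side as the image of an axiom on the other under an additive map out of
  \<open>V \<otimes>\<^sub>k A\<close> or
  \<open>(V \<otimes>\<^sub>k A) \<otimes>\<^sub>k A\<close>. Passing back requires that map to be
  injective, which may fail for general \<open>X\<close> and \<open>x\<close>; at the generator of
  \<open>E\<close> it has an explicit left inverse. Both passages go through a relation between
  \<open>c\<close> and \<rho>, so that the axioms are compared once for both constructions.\<close>

definition balanced ::
  "'m set \<Rightarrow> ('l, 'm, 'v) bimod \<Rightarrow> ('m, 'n, 'w) bimod \<Rightarrow> ('h, 'z) monoid_scheme \<Rightarrow>
   ('v \<Rightarrow> 'w \<Rightarrow> 'h) \<Rightarrow> bool" where
  "balanced M V W H f \<longleftrightarrow>
    (\<forall>x\<in>carrier V. \<forall>y\<in>carrier W. f x y \<in> carrier H) \<and>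
    (\<forall>x\<in>carrier V. \<forall>x'\<in>carrier V. \<forall>y\<in>carrier W. f (x \<otimes>\<^bsub>V\<^esub> x') y = f x y \<otimes>\<^bsub>H\<^esub> f x' y) \<and>
    (\<forall>x\<in>carrier V. \<forall>y\<in>carrier W. \<forall>y'\<in>carrier W. f x (y \<otimes>\<^bsub>W\<^esub> y') = f x y \<otimes>\<^bsub>H\<^esub> f x y') \<and>
    (\<forall>x\<in>carrier V. \<forall>m\<in>M. \<forall>y\<in>carrier W. f (ract V x m) y = f x (lact W m y))"

lemma balancedI:
  assumes "\<And>x y. \<lbrakk>x \<in> carrier V; y \<in> carrier W\<rbrakk> \<Longrightarrow> f x y \<in> carrier H"
    and "\<And>x x' y. \<lbrakk>x \<in> carrier V; x' \<in> carrier V; y \<in> carrier W\<rbrakk> \<Longrightarrow>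
      f (x \<otimes>\<^bsub>V\<^esub> x') y = f x y \<otimes>\<^bsub>H\<^esub> f x' y"
    and "\<And>x y y'. \<lbrakk>x \<in> carrier V; y \<in> carrier W; y' \<in> carrier W\<rbrakk> \<Longrightarrow>
      f x (y \<otimes>\<^bsub>W\<^esub> y') = f x y \<otimes>\<^bsub>H\<^esub> f x y'"
    and "\<And>x m y. \<lbrakk>x \<in> carrier V; m \<in> M; y \<in> carrier W\<rbrakk> \<Longrightarrow> f (ract V x m) y = f x (lact W m y)"
  shows "balanced M V W H f"
  using assms unfolding balanced_def by blast

lemma balancedD:
  assumes "balanced M V W H f"
  shows "\<lbrakk>x \<in> carrier V; y \<in> carrier W\<rbrakk> \<Longrightarrow> f x y \<in> carrier H"
    and "\<lbrakk>x \<in> carrier V; x' \<in> carrier V; y \<in> carrier W\<rbrakk> \<Longrightarrow>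
      f (x \<otimes>\<^bsub>V\<^esub> x') y = f x y \<otimes>\<^bsub>H\<^esub> f x' y"
    and "\<lbrakk>x \<in> carrier V; y \<in> carrier W; y' \<in> carrier W\<rbrakk> \<Longrightarrow>
      f x (y \<otimes>\<^bsub>W\<^esub> y') = f x y \<otimes>\<^bsub>H\<^esub> f x y'"
    and "\<lbrakk>x \<in> carrier V; m \<in> M; y \<in> carrier W\<rbrakk> \<Longrightarrow> f (ract V x m) y = f x (lact W m y)"
  using assms unfolding balanced_def by blast+

lemma hom_eq_on_free_Abelian_group:
  assumes "group H" and g: "g \<in> hom (free_Abelian_group S) H" and h: "h \<in> hom (free_Abelian_group S) H"
    and eq: "\<And>s. s \<in> S \<Longrightarrow> g (frag_of s) = h (frag_of s)" and c: "Poly_Mapping.keys c \<subseteq> S"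
  shows "g c = h c"
proof -
  interpret g: group_hom "free_Abelian_group S" H g
    using assms by (simp add: group_hom_def group_hom_axioms_def)
  interpret h: group_hom "free_Abelian_group S" H h
    using assms by (simp add: group_hom_def group_hom_axioms_def)
  show ?thesis
  proof (rule free_Abelian_group_induct [OF c])
    show "g 0 = h 0"
      using g.hom_one h.hom_one by simp
    show "g (x - y) = h (x - y)"
      if "Poly_Mapping.keys x \<subseteq> S" "Poly_Mapping.keys y \<subseteq> S" "g x = h x" "g y = h y" for x y
      using that g.hom_mult [of x "- y"] h.hom_mult [of x "- y"] g.hom_inv [of y] h.hom_inv [of y]
      by simp
  qed (use eq in simp)
qed

text \<open>The defining relations of the tensor product are differences \<open>a - b\<close>; this
  reduces their membership in the kernel of \<open>h\<close> to \<open>h a = h b\<close>.\<close>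

lemma hom_free_Abelian_group_diff_eq_one:
  assumes "group H" and h: "h \<in> hom (free_Abelian_group S) H"
    and "Poly_Mapping.keys a \<subseteq> S" "Poly_Mapping.keys b \<subseteq> S" "h a = h b"
  shows "h (a - b) = \<one>\<^bsub>H\<^esub>"
proof -
  interpret h: group_hom "free_Abelian_group S" H h
    using assms by (simp add: group_hom_def group_hom_axioms_def)
  show ?thesis
    using assms h.hom_mult [of a "- b"] h.hom_inv [of b] h.hom_closed [of b] by simp
qed

section \<open>The concrete tensor product: universal property and coset representatives\<close>

locale tensorable =
  fixes M :: "'m set" and V :: "('l, 'm, 'v) bimod" and W :: "('m, 'n, 'w) bimod"
  assumes V_group: "comm_group V" and W_group: "comm_group W"
    and ract_closed: "\<And>m x. \<lbrakk>m \<in> M; x \<in> carrier V\<rbrakk> \<Longrightarrow> ract V x m \<in> carrier V"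
    and lact_closed: "\<And>m y. \<lbrakk>m \<in> M; y \<in> carrier W\<rbrakk> \<Longrightarrow> lact W m y \<in> carrier W"
begin

abbreviation F where "F \<equiv> free_Abelian_group (carrier V \<times> carrier W)"
abbreviation N where "N \<equiv> tensor_null M V W"

sublocale V: comm_group V by (rule V_group)
sublocale W: comm_group W by (rule W_group)

lemma keys_diff_subset:
  assumes "Poly_Mapping.keys a \<subseteq> S" "Poly_Mapping.keys b \<subseteq> S"
  shows "Poly_Mapping.keys (a - b) \<subseteq> S"
  using assms keys_diff [of a b] by blast

lemma keys_add_subset:
  assumes "Poly_Mapping.keys a \<subseteq> S" "Poly_Mapping.keys b \<subseteq> S"
  shows "Poly_Mapping.keys (a + b) \<subseteq> S"
  using assms Poly_Mapping.keys_add [of a b] by blast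

lemma rels_subset: "tensor_rels M V W \<subseteq> carrier F"
proof
  fix r assume "r \<in> tensor_rels M V W"
  then have "Poly_Mapping.keys r \<subseteq> carrier V \<times> carrier W"
    unfolding tensor_rels_def
    by (elim UnE CollectE exE conjE; hypsubst; intro keys_diff_subset keys_add_subset;
        simp add: ract_closed lact_closed)
  then show "r \<in> carrier F" by simp
qed

lemma null_normal: "N \<lhd> F"
proof -
  interpret F: comm_group F by (rule abelian_free_Abelian_group)
  show ?thesis
    unfolding tensor_null_def
    using F.generate_is_subgroup rels_subset F.subgroup_imp_normal by blast
qed

lemma quot_hom: "(\<lambda>c. N #>\<^bsub>F\<^esub> c) \<in> hom F (F Mod N)"
  using normal.r_coset_hom_Mod [OF null_normal] .

lemma quot_group: "comm_group (F Mod N)"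
  using comm_group.abelian_FactGroup [OF abelian_free_Abelian_group] null_normal normal_imp_subgroup
  by blast

lemma tensor_simps [simp]:
  "carrier (tensor M V W) = carrier (F Mod N)"
  "mult (tensor M V W) = mult (F Mod N)"
  "one (tensor M V W) = one (F Mod N)"
  by (simp_all add: tensor_def Let_def)

lemma group_tensor: "comm_group (tensor M V W)"
proof -
  interpret Q: comm_group "F Mod N" by (rule quot_group)
  show ?thesis
    by (rule comm_groupI) (use Q.m_assoc Q.m_comm Q.l_inv_ex in \<open>auto simp del: mult_FactGroup one_FactGroup\<close>)
qed

lemma hom_tensor: "hom (tensor M V W) H = hom (F Mod N) H"
  by (simp add: hom_def)

lemma carrier_quot: "t \<in> carrier (F Mod N) \<longleftrightarrow> (\<exists>c. Poly_Mapping.keys c \<subseteq> carrier V \<times> carrier W \<and> t = N #>\<^bsub>F\<^esub> c)"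
  unfolding carrier_free_Abelian_group_iff [symmetric] by (simp add: FactGroup_def RCOSETS_def Bex_def)

lemma hom_tensor_eqI:
  assumes "group H" "g \<in> hom (tensor M V W) H" "h \<in> hom (tensor M V W) H"
    and "\<And>x y. \<lbrakk>x \<in> carrier V; y \<in> carrier W\<rbrakk> \<Longrightarrow> g (pure M V W x y) = h (pure M V W x y)"
    and t: "t \<in> carrier (tensor M V W)"
  shows "g t = h t"
proof -
  obtain c where c: "Poly_Mapping.keys c \<subseteq> carrier V \<times> carrier W" "t = N #>\<^bsub>F\<^esub> c"
    using t unfolding tensor_simps carrier_quot by (elim exE conjE)
  have "(\<lambda>c. g (N #>\<^bsub>F\<^esub> c)) \<in> hom F H" "(\<lambda>c. h (N #>\<^bsub>F\<^esub> c)) \<in> hom F H"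
    using assms hom_compose [OF quot_hom] by (auto simp: hom_tensor o_def)
  from hom_eq_on_free_Abelian_group [OF \<open>group H\<close> this _ c(1)] show ?thesis
    using assms(4) by (auto simp: c pure_def)
qed

text \<open>The additive extension of \<open>f\<close> to the free group kills the three families of
  relations by the three equations in \<open>balanced\<close>, so its kernel contains
  \<open>N\<close> and it factors through the quotient.\<close>

lemma tensor_universal:
  assumes H: "comm_group H" and f: "balanced M V W H f"
  shows "\<exists>h\<in>hom (tensor M V W) H. \<forall>x\<in>carrier V. \<forall>y\<in>carrier W. h (pure M V W x y) = f x y"
proof -
  interpret H: comm_group H by (rule H)
  obtain h where h: "h \<in> hom F H"
    and hf: "\<And>z. z \<in> carrier V \<times> carrier W \<Longrightarrow> h (frag_of z) = case_prod f z"
    using H.free_Abelian_group_universal [of "case_prod f" "carrier V \<times> carrier W"] balancedD(1) [OF f]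
    by (metis (no_types, lifting) image_subset_iff mem_Sigma_iff old.prod.exhaust split_conv)
  interpret h: group_hom F H h
    using h by (simp add: group_hom_def group_hom_axioms_def H.is_group)
  have hadd: "h (a + b) = h a \<otimes>\<^bsub>H\<^esub> h b"
    if "Poly_Mapping.keys a \<subseteq> carrier V \<times> carrier W" "Poly_Mapping.keys b \<subseteq> carrier V \<times> carrier W" for a b
    using h.hom_mult [of a b] that by simp
  have "tensor_rels M V W \<subseteq> kernel F H h"
  proof
    fix r assume r: "r \<in> tensor_rels M V W"
    then have "r \<in> carrier F" using rels_subset by blast
    moreover have "h r = \<one>\<^bsub>H\<^esub>"
      using r unfolding tensor_rels_def
      by (elim UnE CollectE exE conjE; hypsubst; intro hom_free_Abelian_group_diff_eq_one [OF H.is_group h])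
         (simp_all add: hf hadd balancedD [OF f] keys_add_subset ract_closed lact_closed)
    ultimately show "r \<in> kernel F H h" by (simp add: kernel_def)
  qed
  then have "N \<subseteq> kernel F H h"
    unfolding tensor_null_def
    using group.generate_subgroup_incl [OF group_free_Abelian_group _ h.subgroup_kernel] by blast
  then obtain g where "g \<in> hom (F Mod N) H" "\<And>x. x \<in> carrier F \<Longrightarrow> g (N #>\<^bsub>F\<^esub> x) = h x"
    using h.FactGroup_universal_kernel [OF null_normal] by blast
  then show ?thesis
    by (intro bexI [of _ g]) (auto simp: pure_def hf hom_tensor)
qed

lemma quot_eqI:
  assumes "r \<in> tensor_rels M V W" "r = a - b"
    and "Poly_Mapping.keys a \<subseteq> carrier V \<times> carrier W" "Poly_Mapping.keys b \<subseteq> carrier V \<times> carrier W"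
  shows "N #>\<^bsub>F\<^esub> a = N #>\<^bsub>F\<^esub> b"
proof -
  have "a - b \<in> N"
    using generate.incl [OF assms(1)] unfolding tensor_null_def assms(2) .
  then have "a \<in> N #>\<^bsub>F\<^esub> b"
    unfolding r_coset_def by (auto intro!: bexI [of _ "a - b"])
  then show ?thesis
    using group.repr_independence [OF group_free_Abelian_group _ _ normal_imp_subgroup [OF null_normal]] assms
    by simp
qed

lemma pure_balanced: "balanced M V W (tensor M V W) (pure M V W)"
proof (rule balancedI)
  have mult: "pure M V W x y \<otimes>\<^bsub>tensor M V W\<^esub> pure M V W x' y' = N #>\<^bsub>F\<^esub> (frag_of (x, y) + frag_of (x', y'))"
    if "x \<in> carrier V" "y \<in> carrier W" "x' \<in> carrier V" "y' \<in> carrier W" for x y x' y'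
    using hom_mult [OF quot_hom, of "frag_of (x, y)" "frag_of (x', y')"] that
    by (simp add: pure_def)
  show "pure M V W (x \<otimes>\<^bsub>V\<^esub> x') y = pure M V W x y \<otimes>\<^bsub>tensor M V W\<^esub> pure M V W x' y"
    if "x \<in> carrier V" "x' \<in> carrier V" "y \<in> carrier W" for x x' y
    unfolding mult [OF that(1,3,2,3)] unfolding pure_def
    by (rule quot_eqI [OF _ refl])
       (use that in \<open>simp_all add: tensor_rels_def keys_add_subset, blast\<close>)
  show "pure M V W x (y \<otimes>\<^bsub>W\<^esub> y') = pure M V W x y \<otimes>\<^bsub>tensor M V W\<^esub> pure M V W x y'"
    if "x \<in> carrier V" "y \<in> carrier W" "y' \<in> carrier W" for x y y'
    unfolding mult [OF that(1,2,1,3)] unfolding pure_def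
    by (rule quot_eqI [OF _ refl])
       (use that in \<open>simp_all add: tensor_rels_def keys_add_subset, blast\<close>)
  show "pure M V W (ract V x m) y = pure M V W x (lact W m y)"
    if "x \<in> carrier V" "m \<in> M" "y \<in> carrier W" for x m y
    unfolding pure_def
    by (rule quot_eqI [OF _ refl])
       (use that in \<open>simp_all add: tensor_rels_def ract_closed lact_closed, blast\<close>)
  show "pure M V W x y \<in> carrier (tensor M V W)" if "x \<in> carrier V" "y \<in> carrier W" for x y
    using that by (auto simp: pure_def carrier_quot intro!: exI [of _ "frag_of (x, y)"])
qed

lemma tensor_coset_rep:
  assumes "t \<in> carrier (tensor M V W)"
  shows "(SOME z. z \<in> t) \<in> t" and "Poly_Mapping.keys (SOME z. z \<in> t) \<subseteq> carrier V \<times> carrier W"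
proof -
  obtain c where c: "c \<in> carrier F" "t = N #>\<^bsub>F\<^esub> c"
    using assms unfolding tensor_simps carrier_quot carrier_free_Abelian_group_iff by (elim exE conjE)
  have "c \<in> t"
    using c normal_imp_subgroup [OF null_normal] group.rcos_self [OF group_free_Abelian_group] by blast
  then show *: "(SOME z. z \<in> t) \<in> t"
    by (rule someI)
  have "t \<subseteq> carrier F"
    unfolding c by (rule monoid.r_coset_subset_G [OF group.is_monoid [OF group_free_Abelian_group] _ c(1)])
      (use normal_imp_subgroup [OF null_normal] subgroup.subset in blast)
  then show "Poly_Mapping.keys (SOME z. z \<in> t) \<subseteq> carrier V \<times> carrier W"
    using subsetD [OF \<open>t \<subseteq> carrier F\<close> *] by simp
qed

lemma tensor_coset_eq:
  assumes "t \<in> carrier (tensor M V W)" "t' \<in> carrier (tensor M V W)" "z \<in> t" "z \<in> t'"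
  shows "t = t'"
proof -
  obtain c c' where c: "c \<in> carrier F" "t = N #>\<^bsub>F\<^esub> c" "c' \<in> carrier F" "t' = N #>\<^bsub>F\<^esub> c'"
    using assms unfolding tensor_simps carrier_quot carrier_free_Abelian_group_iff by (elim exE conjE)
  then show ?thesis
    using assms group.repr_independence [OF group_free_Abelian_group _ _ normal_imp_subgroup [OF null_normal]]
    by (metis (no_types, lifting))
qed

text \<open>Distinct cosets are disjoint, so a chosen representative determines its coset, and an
  injection on formal sums supported in \<open>carrier V \<times> carrier W\<close> encodes the
  whole tensor product.\<close>

lemma rep_inj:
  assumes "inj_on e {z. Poly_Mapping.keys z \<subseteq> carrier V \<times> carrier W}"
  shows "inj_on (\<lambda>t. e (SOME z. z \<in> t)) (carrier (tensor M V W))"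
proof (rule inj_onI)
  fix t t' assume t: "t \<in> carrier (tensor M V W)" "t' \<in> carrier (tensor M V W)"
    and eq: "e (SOME z. z \<in> t) = e (SOME z. z \<in> t')"
  have "(SOME z. z \<in> t) = (SOME z. z \<in> t')"
    using inj_onD [OF assms eq] tensor_coset_rep t by blast
  then show "t = t'"
    using tensor_coset_eq [OF t] tensor_coset_rep(1) [OF t(1)] tensor_coset_rep(1) [OF t(2)] by simp
qed

end

text \<open>An injection of \<open>S\<close> into \<open>'u\<close> carries formal sums over
  \<open>S\<close> injectively to formal sums over \<open>'u\<close>, and the free abelian group on
  an infinite set has the cardinality of that set.\<close>

lemma inj_frag:
  fixes S :: "'s set"
  assumes "infinite (UNIV :: 'u set)" and "S \<lesssim> (UNIV :: 'u set)"
  shows "\<exists>e :: ('s \<Rightarrow>\<^sub>0 int) \<Rightarrow> 'u. inj_on e {z. Poly_Mapping.keys z \<subseteq> S}"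
proof -
  obtain j :: "'s \<Rightarrow> 'u" where j: "inj_on j S"
    using assms(2) unfolding lepoll_def by blast
  have "carrier (free_Abelian_group (UNIV :: 'u set)) \<lesssim> (UNIV :: 'u set)"
    using eqpoll_free_Abelian_group_infinite [OF assms(1)] eqpoll_imp_lepoll by blast
  then obtain i :: "('u \<Rightarrow>\<^sub>0 int) \<Rightarrow> 'u" where i: "inj i"
    unfolding lepoll_def by (auto simp: free_Abelian_group_def)
  have inv: "frag_extend (frag_of \<circ> inv_into S j) (frag_extend (frag_of \<circ> j) z) = z"
    if z: "Poly_Mapping.keys z \<subseteq> S" for z
  proof -
    have "frag_extend (frag_of \<circ> inv_into S j) (frag_extend (frag_of \<circ> j) z)
        = frag_extend ((frag_of \<circ> inv_into S j) \<circ> j) z"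
      by (rule frag_extend_compose)
    also have "\<dots> = frag_extend frag_of z"
      by (rule frag_extend_eq) (use z j in \<open>auto simp: inv_into_f_f\<close>)
    finally show ?thesis
      using frag_expansion by metis
  qed
  then have "inj_on (frag_extend (frag_of \<circ> j)) {z. Poly_Mapping.keys z \<subseteq> S}"
    by (metis (mono_tags, lifting) inj_onI mem_Collect_eq)
  then have "inj_on (i \<circ> frag_extend (frag_of \<circ> j)) {z. Poly_Mapping.keys z \<subseteq> S}"
    using i by (meson comp_inj_on inj_on_subset subset_UNIV)
  then show ?thesis by blast
qed

text \<open>This makes the definite description in \<open>hom_ext\<close> usable. Existence comes
  from any \<open>h\<close> with the right values, restricted to the carrier to make it extensional;
  uniqueness enters as an assumption because each family of generators has its own argument (pure
  tensors, iterated pure tensors, unit constraints).\<close>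

lemma hom_ext_spec:
  assumes "h \<in> hom G H" "\<And>i. i \<in> I \<Longrightarrow> h (p i) = q i"
    and "\<And>g h t. \<lbrakk>g \<in> hom G H; h \<in> hom G H; \<And>i. i \<in> I \<Longrightarrow> g (p i) = h (p i); t \<in> carrier G\<rbrakk>
      \<Longrightarrow> g t = h t"
    and "p ` I \<subseteq> carrier G" and "monoid G"
  shows "hom_ext G H I p q \<in> hom G H \<inter> extensional (carrier G) \<and>
    (\<forall>i\<in>I. hom_ext G H I p q (p i) = q i)"
  unfolding hom_ext_def
proof (rule theI [where a = "restrict h (carrier G)"])
  interpret monoid G by fact
  show "restrict h (carrier G) \<in> hom G H \<inter> extensional (carrier G) \<and>
      (\<forall>i\<in>I. restrict h (carrier G) (p i) = q i)"
    using assms(1,2,4) by (auto simp: hom_def image_subset_iff)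
  fix g
  assume g: "g \<in> hom G H \<inter> extensional (carrier G) \<and> (\<forall>i\<in>I. g (p i) = q i)"
  show "g = restrict h (carrier G)"
    by (rule extensionalityI [of _ "carrier G"]) (use g assms in auto)
qed

lemma hom_compose':
  assumes "f \<in> hom G H" "g \<in> hom H K"
  shows "(\<lambda>x. g (f x)) \<in> hom G K"
  using hom_compose [OF assms] by (simp add: o_def)


lemma hom_mult_fun:
  assumes "comm_group H" "f \<in> hom G H" "g \<in> hom G H"
  shows "(\<lambda>x. f x \<otimes>\<^bsub>H\<^esub> g x) \<in> hom G H"
  using comm_group.hom_group_mult [OF assms] .

section \<open>Bimodules\<close>

lemma regular_bimod_simps [simp]:
  "carrier (regular_bimod A) = carrier A"
  "mult (regular_bimod A) = add A"
  "one (regular_bimod A) = \<zero>\<^bsub>A\<^esub>"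
  "lact (regular_bimod A) = mult A"
  "ract (regular_bimod A) = mult A"
  by (simp_all add: regular_bimod_def)

context k_algebra
begin

text \<open>The conditions of \<open>bimodule\<close> that do not concern values outside the carriers; unlike
  \<open>bimodule\<close> itself they hold for \<open>tenA\<close> and the regular bimodule.\<close>

definition bimod_laws :: "('c, 'c, 'v) bimod \<Rightarrow> bool" where
  "bimod_laws V \<longleftrightarrow>
    comm_group V \<and>
    (\<forall>a\<in>carrier A. \<forall>x\<in>carrier V. lact V a x \<in> carrier V \<and> ract V x a \<in> carrier V) \<and>
    (\<forall>a\<in>carrier A. \<forall>x\<in>carrier V. \<forall>y\<in>carrier V.
       lact V a (x \<otimes>\<^bsub>V\<^esub> y) = lact V a x \<otimes>\<^bsub>V\<^esub> lact V a y \<and>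
       ract V (x \<otimes>\<^bsub>V\<^esub> y) a = ract V x a \<otimes>\<^bsub>V\<^esub> ract V y a) \<and>
    (\<forall>a\<in>carrier A. \<forall>b\<in>carrier A. \<forall>x\<in>carrier V.
       lact V (a \<oplus>\<^bsub>A\<^esub> b) x = lact V a x \<otimes>\<^bsub>V\<^esub> lact V b x \<and>
       ract V x (a \<oplus>\<^bsub>A\<^esub> b) = ract V x a \<otimes>\<^bsub>V\<^esub> ract V x b \<and>
       lact V (a \<otimes>\<^bsub>A\<^esub> b) x = lact V a (lact V b x) \<and>
       ract V x (a \<otimes>\<^bsub>A\<^esub> b) = ract V (ract V x a) b \<and>
       ract V (lact V a x) b = lact V a (ract V x b)) \<and>
    (\<forall>x\<in>carrier V. lact V \<one>\<^bsub>A\<^esub> x = x \<and> ract V x \<one>\<^bsub>A\<^esub> = x) \<and>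
    (\<forall>s\<in>carrier k. \<forall>x\<in>carrier V. lact V (s \<odot>\<^bsub>A\<^esub> \<one>\<^bsub>A\<^esub>) x = ract V x (s \<odot>\<^bsub>A\<^esub> \<one>\<^bsub>A\<^esub>))"

lemma bimodule_iff:
  "bimodule k A V \<longleftrightarrow> bimod_laws V \<and>
    (\<forall>x y. x \<notin> carrier V \<or> y \<notin> carrier V \<longrightarrow> x \<otimes>\<^bsub>V\<^esub> y = undefined) \<and>
    (\<forall>a x. a \<notin> carrier A \<or> x \<notin> carrier V \<longrightarrow>
       lact V a x = undefined \<and> ract V x a = undefined)"
  unfolding bimodule_def bimod_laws_def by blast

text \<open>The image of \<open>k\<close> in \<open>A\<close>. With it the product over
  \<open>k\<close> becomes a product balanced over a subset of \<open>A\<close>, like the product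
  over \<open>A\<close> itself, and no separate \<open>k\<close>-action has to be carried
  along.\<close>

definition kone :: "'c set" where "kone = (\<lambda>s. s \<odot>\<^bsub>A\<^esub> \<one>\<^bsub>A\<^esub>) ` carrier k"

lemma kone_subset: "kone \<subseteq> carrier A"
  unfolding kone_def by auto

lemma kone_closed: "c \<in> kone \<Longrightarrow> c \<in> carrier A"
  using kone_subset by blast

lemma smult_one_kone: "s \<in> carrier k \<Longrightarrow> s \<odot>\<^bsub>A\<^esub> \<one>\<^bsub>A\<^esub> \<in> kone"
  unfolding kone_def by blast

lemma bimod_laws_group: "bimod_laws V \<Longrightarrow> comm_group V"
  by (simp add: bimod_laws_def)

lemma bimod_laws_is_group: "bimod_laws V \<Longrightarrow> group V"
  using bimod_laws_group comm_group.axioms(2) by blast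

lemma bimod_laws_simps [simp]:
  assumes "bimod_laws V" "a \<in> carrier A" "x \<in> carrier V"
  shows "lact V a x \<in> carrier V" "ract V x a \<in> carrier V"
    and "y \<in> carrier V \<Longrightarrow> lact V a (x \<otimes>\<^bsub>V\<^esub> y) = lact V a x \<otimes>\<^bsub>V\<^esub> lact V a y"
    and "y \<in> carrier V \<Longrightarrow> ract V (x \<otimes>\<^bsub>V\<^esub> y) a = ract V x a \<otimes>\<^bsub>V\<^esub> ract V y a"
    and "b \<in> carrier A \<Longrightarrow> lact V (a \<oplus>\<^bsub>A\<^esub> b) x = lact V a x \<otimes>\<^bsub>V\<^esub> lact V b x"
    and "b \<in> carrier A \<Longrightarrow> ract V x (a \<oplus>\<^bsub>A\<^esub> b) = ract V x a \<otimes>\<^bsub>V\<^esub> ract V x b"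
    and "b \<in> carrier A \<Longrightarrow> lact V (a \<otimes>\<^bsub>A\<^esub> b) x = lact V a (lact V b x)"
    and "b \<in> carrier A \<Longrightarrow> ract V x (a \<otimes>\<^bsub>A\<^esub> b) = ract V (ract V x a) b"
    and "b \<in> carrier A \<Longrightarrow> ract V (lact V a x) b = lact V a (ract V x b)"
  using assms unfolding bimod_laws_def by blast+

lemma bimod_laws_one [simp]:
  assumes "bimod_laws V" "x \<in> carrier V"
  shows "lact V \<one>\<^bsub>A\<^esub> x = x" "ract V x \<one>\<^bsub>A\<^esub> = x"
  using assms unfolding bimod_laws_def by blast+

lemma bimod_laws_central:
  assumes "bimod_laws V" "c \<in> kone" "x \<in> carrier V"
  shows "lact V c x = ract V x c"
  using assms unfolding bimod_laws_def kone_def by blast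

lemma bimod_laws_mult_closed [simp]:
  assumes "bimod_laws V" "x \<in> carrier V" "y \<in> carrier V"
  shows "x \<otimes>\<^bsub>V\<^esub> y \<in> carrier V"
proof -
  interpret comm_group V using assms by (simp add: bimod_laws_group)
  show ?thesis using assms by simp
qed

lemma lact_hom: "bimod_laws V \<Longrightarrow> a \<in> carrier A \<Longrightarrow> lact V a \<in> hom V V"
  by (rule homI) simp_all

lemma ract_hom: "bimod_laws V \<Longrightarrow> a \<in> carrier A \<Longrightarrow> (\<lambda>x. ract V x a) \<in> hom V V"
  by (rule homI) simp_all

lemma kone_central: "c \<in> kone \<Longrightarrow> a \<in> carrier A \<Longrightarrow> c \<otimes>\<^bsub>A\<^esub> a = a \<otimes>\<^bsub>A\<^esub> c"
  unfolding kone_def by (auto simp: smult_mult_left smult_mult_right)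

lemma bimod_laws_regular: "bimod_laws (regular_bimod A)"
proof -
  have "comm_group (add_monoid A)" by (rule a_comm_group)
  then have "comm_group (regular_bimod A)"
    by (auto simp: comm_group_def comm_monoid_def comm_monoid_axioms_def monoid_def group_def
        group_axioms_def Units_def)
  then show ?thesis
    unfolding bimod_laws_def
    by (auto simp: l_distr r_distr m_assoc kone_central smult_one_kone)
qed

lemma bimod_mapsD:
  assumes "f \<in> bimod_maps A V W"
  shows "f \<in> hom V W" "f \<in> extensional (carrier V)"
    and "x \<in> carrier V \<Longrightarrow> f x \<in> carrier W"
    and "\<lbrakk>x \<in> carrier V; y \<in> carrier V\<rbrakk> \<Longrightarrow> f (x \<otimes>\<^bsub>V\<^esub> y) = f x \<otimes>\<^bsub>W\<^esub> f y"
    and "\<lbrakk>a \<in> carrier A; x \<in> carrier V\<rbrakk> \<Longrightarrow> f (lact V a x) = lact W a (f x)"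
    and "\<lbrakk>a \<in> carrier A; x \<in> carrier V\<rbrakk> \<Longrightarrow> f (ract V x a) = ract W (f x) a"
  using assms unfolding bimod_maps_def hom_def by auto

lemma bimod_maps_eqI:
  assumes "f \<in> bimod_maps A V W" "g \<in> bimod_maps A V W'" "\<And>x. x \<in> carrier V \<Longrightarrow> f x = g x"
  shows "f = g"
  using assms by (meson bimod_mapsD(2) extensionalityI)

lemma bimod_maps_id: "bimod_laws V \<Longrightarrow> (\<lambda>x\<in>carrier V. x) \<in> bimod_maps A V V"
  unfolding bimod_maps_def by (auto simp: hom_def)

lemma bimod_maps_compose:
  assumes "bimod_laws U" "f \<in> bimod_maps A U V" "g \<in> bimod_maps A V W"
  shows "compose (carrier U) g f \<in> bimod_maps A U W"
  using assms(1) bimod_mapsD [OF assms(2)] bimod_mapsD [OF assms(3)]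
  unfolding bimod_maps_def by (auto simp: hom_def compose_eq)

subsection \<open>Transport of structure\<close>

lemma transport_simps:
  assumes e: "inj_on e (carrier V)"
  shows "carrier (transport A e V) = e ` carrier V"
    and "one (transport A e V) = e \<one>\<^bsub>V\<^esub>"
    and "\<lbrakk>x \<in> carrier V; y \<in> carrier V\<rbrakk> \<Longrightarrow> e x \<otimes>\<^bsub>transport A e V\<^esub> e y = e (x \<otimes>\<^bsub>V\<^esub> y)"
    and "\<lbrakk>a \<in> carrier A; x \<in> carrier V\<rbrakk> \<Longrightarrow> lact (transport A e V) a (e x) = e (lact V a x)"
    and "\<lbrakk>a \<in> carrier A; x \<in> carrier V\<rbrakk> \<Longrightarrow> ract (transport A e V) (e x) a = e (ract V x a)"
  by (simp_all add: transport_def Let_def inv_into_f_f [OF e])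

lemma transport_iso:
  assumes "inj_on e (carrier V)"
  shows "e \<in> iso V (transport A e V)"
  using assms by (auto simp: iso_def hom_def transport_simps bij_betw_def)

lemma transport_group:
  assumes e: "inj_on e (carrier V)" and V: "comm_group V"
  shows "comm_group (transport A e V)"
proof -
  interpret V: comm_group V by fact
  show ?thesis
  proof (rule comm_groupI)
    show "\<exists>y\<in>carrier (transport A e V). y \<otimes>\<^bsub>transport A e V\<^esub> x = \<one>\<^bsub>transport A e V\<^esub>"
      if "x \<in> carrier (transport A e V)" for x
    proof -
      obtain v where v: "v \<in> carrier V" "x = e v" using \<open>x \<in> _\<close> by (auto simp: transport_simps [OF e])
      then obtain w where "w \<in> carrier V" "w \<otimes>\<^bsub>V\<^esub> v = \<one>\<^bsub>V\<^esub>" using V.l_inv_ex by blast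
      then show ?thesis
        using v by (intro bexI [of _ "e w"]) (simp_all add: transport_simps [OF e])
    qed
  qed (auto simp: transport_simps [OF e] V.m_ac)
qed

text \<open>\<open>transport\<close> puts \<open>undefined\<close> outside the carriers, so a record
  that merely satisfies the laws, such as \<open>tensor\<close> or \<open>regular_bimod\<close>,
  becomes an object of the category.\<close>

lemma transport_bimodule:
  assumes e: "inj_on e (carrier V)" and V: "bimod_laws V"
  shows "bimodule k A (transport A e V)"
proof -
  have "bimod_laws (transport A e V)"
    using transport_group [OF e bimod_laws_group [OF V]] V bimod_laws_central [OF V smult_one_kone]
    unfolding bimod_laws_def [of "transport A e V"]
    by (auto simp: transport_simps [OF e])
  then show ?thesis
    unfolding bimodule_iff by (auto simp: transport_def Let_def)
qed

subsection \<open>Tensor products of bimodules\<close>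

text \<open>\<open>T\<close> with \<open>p x y\<close> in the role of \<open>x \<otimes> y\<close> is a copy of the tensor product of \<open>V\<close> and \<open>W\<close> balanced over
  \<open>B\<close>. For \<open>B = carrier A\<close> this is the product over \<open>A\<close>, and for \<open>B = kone\<close> the product over \<open>k\<close>.
  The universal property ranges over groups of any type, so it cannot be part of the definition,
  which instead refers to the concrete \<open>tensor\<close>.\<close>

definition is_tensor ::
  "'c set \<Rightarrow> ('c, 'c, 'v) bimod \<Rightarrow> ('c, 'c, 'w) bimod \<Rightarrow> ('c, 'c, 't) bimod \<Rightarrow>
   ('v \<Rightarrow> 'w \<Rightarrow> 't) \<Rightarrow> bool" where
  "is_tensor B V W T p \<longleftrightarrow>
    bimod_laws V \<and> bimod_laws W \<and> kone \<subseteq> B \<and> B \<subseteq> carrier A \<and>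
    comm_group T \<and> balanced B V W T p \<and>
    (\<exists>e\<in>iso (tensor B V W) T. \<forall>x\<in>carrier V. \<forall>y\<in>carrier W. e (pure B V W x y) = p x y) \<and>
    (\<forall>a\<in>carrier A. lact T a \<in> hom T T \<and> (\<lambda>t. ract T t a) \<in> hom T T \<and>
      (\<forall>x\<in>carrier V. \<forall>y\<in>carrier W.
        lact T a (p x y) = p (lact V a x) y \<and> ract T (p x y) a = p x (ract W y a)))"

lemma tensorable:
  "\<lbrakk>bimod_laws V; bimod_laws W; B \<subseteq> carrier A\<rbrakk> \<Longrightarrow> tensorable B V W"
  by (rule tensorable.intro) (auto simp: bimod_laws_group)

lemma is_tensorD:
  assumes "is_tensor B V W T p"
  shows "bimod_laws V" "bimod_laws W" "kone \<subseteq> B" "B \<subseteq> carrier A" "comm_group T"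
    "balanced B V W T p"
  using assms unfolding is_tensor_def by blast+

lemma is_tensor_pure:
  assumes "is_tensor B V W T p"
  shows "\<lbrakk>x \<in> carrier V; y \<in> carrier W\<rbrakk> \<Longrightarrow> p x y \<in> carrier T"
    and "\<lbrakk>x \<in> carrier V; x' \<in> carrier V; y \<in> carrier W\<rbrakk> \<Longrightarrow>
      p (x \<otimes>\<^bsub>V\<^esub> x') y = p x y \<otimes>\<^bsub>T\<^esub> p x' y"
    and "\<lbrakk>x \<in> carrier V; y \<in> carrier W; y' \<in> carrier W\<rbrakk> \<Longrightarrow>
      p x (y \<otimes>\<^bsub>W\<^esub> y') = p x y \<otimes>\<^bsub>T\<^esub> p x y'"
    and "\<lbrakk>a \<in> carrier A; x \<in> carrier V; y \<in> carrier W\<rbrakk> \<Longrightarrow> lact T a (p x y) = p (lact V a x) y"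
    and "\<lbrakk>a \<in> carrier A; x \<in> carrier V; y \<in> carrier W\<rbrakk> \<Longrightarrow> ract T (p x y) a = p x (ract W y a)"
  using assms balancedD [OF is_tensorD(6) [OF assms]] unfolding is_tensor_def by blast+

lemma is_tensor_balance:
  assumes "is_tensor B V W T p"
  shows "\<lbrakk>x \<in> carrier V; b \<in> B; y \<in> carrier W\<rbrakk> \<Longrightarrow> p (ract V x b) y = p x (lact W b y)"
  using balancedD(4) [OF is_tensorD(6) [OF assms]] .

lemma is_tensor_eqI:
  assumes T: "is_tensor B V W T p" and H: "group H"
    and g: "g \<in> hom T H" and h: "h \<in> hom T H"
    and eq: "\<And>x y. \<lbrakk>x \<in> carrier V; y \<in> carrier W\<rbrakk> \<Longrightarrow> g (p x y) = h (p x y)"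
    and t: "t \<in> carrier T"
  shows "g t = h t"
proof -
  interpret tensorable B V W
    using is_tensorD [OF T] by (simp add: tensorable)
  obtain e where e: "e \<in> iso (tensor B V W) T"
      "\<And>x y. \<lbrakk>x \<in> carrier V; y \<in> carrier W\<rbrakk> \<Longrightarrow> e (pure B V W x y) = p x y"
    using T unfolding is_tensor_def by blast
  have eh: "e \<in> hom (tensor B V W) T" and surj: "e ` carrier (tensor B V W) = carrier T"
    using e(1) by (auto simp: iso_def bij_betw_def)
  obtain s where s: "s \<in> carrier (tensor B V W)" "t = e s"
    using t surj by blast
  show ?thesis
    unfolding s(2)
    by (rule hom_tensor_eqI [OF H hom_compose' [OF eh g] hom_compose' [OF eh h] _ s(1)])
       (simp add: e(2) eq)
qed

text \<open>Spelled in the form in which \<open>hom_ext\<close> occurs in \<open>TMor\<close>, in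
  \<open>mapA\<close> and in the condition \<open>v\<^sub>0 v\<^sub>1 = v\<close>, so that all of
  these are instances.\<close>

abbreviation lift ::
  "('c, 'c, 't) bimod \<Rightarrow> ('h, 'z2) monoid_scheme \<Rightarrow> ('c, 'c, 'v) bimod \<Rightarrow> ('c, 'c, 'w) bimod \<Rightarrow>
   ('v \<Rightarrow> 'w \<Rightarrow> 't) \<Rightarrow> ('v \<Rightarrow> 'w \<Rightarrow> 'h) \<Rightarrow> 't \<Rightarrow> 'h" where
  "lift T H V W p f \<equiv>
    hom_ext T H (carrier V \<times> carrier W) (\<lambda>(x, y). p x y) (\<lambda>(x, y). f x y)"

lemma lift_spec:
  assumes T: "is_tensor B V W T p" and H: "comm_group H" and f: "balanced B V W H f"
  shows "lift T H V W p f \<in> hom T H \<inter> extensional (carrier T) \<and>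
    (\<forall>i\<in>carrier V \<times> carrier W. lift T H V W p f (case_prod p i) = case_prod f i)"
proof -
  interpret tensorable B V W
    using is_tensorD [OF T] by (simp add: tensorable)
  have gH: "group H" and gT: "group T" using H is_tensorD(5) [OF T] comm_group.axioms(2) by auto
  obtain e where e: "e \<in> iso (tensor B V W) T"
      "\<And>x y. \<lbrakk>x \<in> carrier V; y \<in> carrier W\<rbrakk> \<Longrightarrow> e (pure B V W x y) = p x y"
    using T unfolding is_tensor_def by blast
  obtain h where h: "h \<in> hom (tensor B V W) H"
      "\<And>x y. \<lbrakk>x \<in> carrier V; y \<in> carrier W\<rbrakk> \<Longrightarrow> h (pure B V W x y) = f x y"
    using tensor_universal [OF H f] by blast
  have pc: "pure B V W x y \<in> carrier (tensor B V W)" if "x \<in> carrier V" "y \<in> carrier W" for x y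
    using balancedD(1) [OF pure_balanced] that by blast
  have inj: "inj_on e (carrier (tensor B V W))"
    using e(1) by (auto simp: iso_def bij_betw_def)
  have inv: "inv_into (carrier (tensor B V W)) e \<in> hom T (tensor B V W)"
    using group.iso_set_sym [OF _ e(1)] comm_group.axioms(2) [OF group_tensor] by (auto simp: iso_def)
  show ?thesis
  proof (rule hom_ext_spec [OF hom_compose' [OF inv h(1)]])
    show "h (inv_into (carrier (tensor B V W)) e (case i of (x, y) \<Rightarrow> p x y)) = (case i of (x, y) \<Rightarrow> f x y)"
      if "i \<in> carrier V \<times> carrier W" for i
      using that by (auto simp: e(2) [symmetric] inv_into_f_f [OF inj] pc h(2) simp del: tensor_simps)
    show "g t = h t"
      if "g \<in> hom T H" "h \<in> hom T H" "t \<in> carrier T"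
        "\<And>i. i \<in> carrier V \<times> carrier W \<Longrightarrow>
          g (case i of (x, y) \<Rightarrow> p x y) = h (case i of (x, y) \<Rightarrow> p x y)" for g h t
      by (rule is_tensor_eqI [OF T gH that(1,2) _ that(3)]) (use that(4) in auto)
  qed (use is_tensor_pure [OF T] gT group.is_monoid in auto)
qed

lemma lift_hom:
  assumes "is_tensor B V W T p" "comm_group H" "balanced B V W H f"
  shows "lift T H V W p f \<in> hom T H"
  using lift_spec [OF assms] by blast

lemma lift_pure:
  assumes "is_tensor B V W T p" "comm_group H" "balanced B V W H f"
    and "x \<in> carrier V" "y \<in> carrier W"
  shows "lift T H V W p f (p x y) = f x y"
  using lift_spec [OF assms(1-3)] assms(4,5) by auto

lemma lift_bimod_maps:
  assumes T: "is_tensor B V W T p" and TL: "bimod_laws T" and H: "bimod_laws H" and f: "balanced B V W H f"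
    and l: "\<And>a x y. \<lbrakk>a \<in> carrier A; x \<in> carrier V; y \<in> carrier W\<rbrakk> \<Longrightarrow>
      f (lact V a x) y = lact H a (f x y)"
    and r: "\<And>a x y. \<lbrakk>a \<in> carrier A; x \<in> carrier V; y \<in> carrier W\<rbrakk> \<Longrightarrow>
      f x (ract W y a) = ract H (f x y) a"
  shows "lift T H V W p f \<in> bimod_maps A T H"
proof -
  note s = lift_spec [OF T bimod_laws_group [OF H] f]
  note p = lift_pure [OF T bimod_laws_group [OF H] f]
  let ?h = "lift T H V W p f"
  have h: "?h \<in> hom T H" using s by blast
  note VW = is_tensorD(1,2) [OF T]
  have "?h (lact T a t) = lact H a (?h t)" if "a \<in> carrier A" "t \<in> carrier T" for a t
    by (rule is_tensor_eqI [OF T bimod_laws_is_group [OF H] hom_compose' [OF lact_hom [OF TL] h]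
          hom_compose' [OF h lact_hom [OF H]]])
       (use that VW in \<open>simp_all add: p l is_tensor_pure [OF T]\<close>)
  moreover have "?h (ract T t a) = ract H (?h t) a" if "a \<in> carrier A" "t \<in> carrier T" for a t
    by (rule is_tensor_eqI [OF T bimod_laws_is_group [OF H] hom_compose' [OF ract_hom [OF TL] h]
          hom_compose' [OF h ract_hom [OF H]]])
       (use that VW in \<open>simp_all add: p r is_tensor_pure [OF T]\<close>)
  ultimately show ?thesis
    using s unfolding bimod_maps_def by blast
qed

text \<open>Each law is an equation between additive endomorphisms of \<open>T\<close>, hence may be
  checked on \<open>p x y\<close>, where each outer action touches one factor. Only
  \<open>k\<close>-centrality involves the balancing: for \<open>c \<in> kone\<close>, \<open>c x
  \<otimes> y = x c \<otimes> y = x \<otimes> c y = x \<otimes> y c\<close>.\<close>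

lemma is_tensor_bimod_laws:
  assumes T: "is_tensor B V W T p"
  shows "bimod_laws T"
proof -
  note VW [simp] = is_tensorD(1,2) [OF T]
  note cg = is_tensorD(5) [OF T]
  interpret T: comm_group T by (rule cg)
  have L: "lact T a \<in> hom T T" and R: "(\<lambda>t. ract T t a) \<in> hom T T" if "a \<in> carrier A" for a
    using T that unfolding is_tensor_def by blast+
  note eqI = is_tensor_eqI [OF T T.is_group]
  note [simp] = is_tensor_pure [OF T]
  have "lact T (a \<oplus>\<^bsub>A\<^esub> b) t = lact T a t \<otimes>\<^bsub>T\<^esub> lact T b t"
    "ract T t (a \<oplus>\<^bsub>A\<^esub> b) = ract T t a \<otimes>\<^bsub>T\<^esub> ract T t b"
    "lact T (a \<otimes>\<^bsub>A\<^esub> b) t = lact T a (lact T b t)"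
    "ract T t (a \<otimes>\<^bsub>A\<^esub> b) = ract T (ract T t a) b"
    "ract T (lact T a t) b = lact T a (ract T t b)"
    if [simp]: "a \<in> carrier A" "b \<in> carrier A" and t: "t \<in> carrier T" for a b t
        apply (rule eqI [OF L hom_mult_fun [OF cg L L] _ t]; simp)
       apply (rule eqI [OF R hom_mult_fun [OF cg R R] _ t]; simp)
      apply (rule eqI [OF L hom_compose' [OF L L] _ t]; simp)
     apply (rule eqI [OF R hom_compose' [OF R R] _ t]; simp)
    apply (rule eqI [OF hom_compose' [OF L R] hom_compose' [OF R L] _ t]; simp)
    done
  moreover have "lact T \<one>\<^bsub>A\<^esub> t = t" "ract T t \<one>\<^bsub>A\<^esub> = t" if t: "t \<in> carrier T" for t
    by (rule eqI [OF L, of _ "\<lambda>t. t" t]; simp add: t hom_def) (rule eqI [OF R, of _ "\<lambda>t. t" t]; simp add: t hom_def)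
  moreover have "lact T c t = ract T t c" if c: "c \<in> kone" and t: "t \<in> carrier T" for c t
  proof (rule eqI [OF L R _ t])
    show "lact T c (p x y) = ract T (p x y) c" if [simp]: "x \<in> carrier V" "y \<in> carrier W" for x y
      using is_tensor_balance [OF T, of x c y] is_tensorD(3) [OF T] c
      by (auto simp: bimod_laws_central [OF VW(1)] bimod_laws_central [OF VW(2)] kone_closed)
  qed (use c kone_closed in auto)
  moreover have "lact T a t \<in> carrier T" "ract T t a \<in> carrier T"
    if "a \<in> carrier A" "t \<in> carrier T" for a t
    using L R that unfolding hom_def by blast+
  moreover have "lact T a (t \<otimes>\<^bsub>T\<^esub> t') = lact T a t \<otimes>\<^bsub>T\<^esub> lact T a t'"
      "ract T (t \<otimes>\<^bsub>T\<^esub> t') a = ract T t a \<otimes>\<^bsub>T\<^esub> ract T t' a"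
    if "a \<in> carrier A" "t \<in> carrier T" "t' \<in> carrier T" for a t t'
    using L R that unfolding hom_def by blast+
  ultimately show ?thesis
    unfolding bimod_laws_def using cg smult_one_kone by simp
qed

lemma tensor_is_tensor:
  fixes V :: "('c, 'c, 'v) bimod" and W :: "('c, 'c, 'w) bimod"
  assumes V: "bimod_laws V" and W: "bimod_laws W" and B: "kone \<subseteq> B" "B \<subseteq> carrier A"
  shows "is_tensor B V W (tensor B V W) (pure B V W)"
proof -
  interpret tensorable B V W
    using V W B by (simp add: tensorable)
  let ?T = "tensor B V W" and ?p = "pure B V W"
  note pb = balancedD [OF pure_balanced]
  have gT: "group ?T"
    using group_tensor comm_group.axioms(2) by auto
  \<comment> \<open>The actions of \<open>tensor\<close> are defined by \<open>hom_ext\<close> on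
    the bare quotient group. Since \<open>hom_ext\<close> sees only carriers and multiplications,
    its specification carries over from the bimodule record to that group.\<close>
  have spec: "hom_ext (F Mod N) (F Mod N) (carrier V \<times> carrier W) (\<lambda>(x, y). ?p x y) (\<lambda>(x, y). f x y) \<in> hom ?T ?T \<and>
      (\<forall>x\<in>carrier V. \<forall>y\<in>carrier W. hom_ext (F Mod N) (F Mod N) (carrier V \<times> carrier W) (\<lambda>(x, y). ?p x y)
        (\<lambda>(x, y). f x y) (?p x y) = f x y)"
    if f: "balanced B V W ?T f" for f
  proof -
    obtain h where h: "h \<in> hom ?T ?T" "\<And>x y. \<lbrakk>x \<in> carrier V; y \<in> carrier W\<rbrakk> \<Longrightarrow> h (?p x y) = f x y"
      using tensor_universal [OF group_tensor f] by blast
    have "hom_ext ?T ?T (carrier V \<times> carrier W) (\<lambda>(x, y). ?p x y) (\<lambda>(x, y). f x y) \<in> hom ?T ?T \<inter> extensional (carrier ?T) \<and>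
      (\<forall>i\<in>carrier V \<times> carrier W. hom_ext ?T ?T (carrier V \<times> carrier W) (\<lambda>(x, y). ?p x y)
        (\<lambda>(x, y). f x y) (case i of (x, y) \<Rightarrow> ?p x y) = (case i of (x, y) \<Rightarrow> f x y))"
    proof (rule hom_ext_spec [OF h(1)])
      show "g t = h t" if "g \<in> hom ?T ?T" "h \<in> hom ?T ?T" "t \<in> carrier ?T"
        "\<And>i. i \<in> carrier V \<times> carrier W \<Longrightarrow>
          g (case i of (x, y) \<Rightarrow> ?p x y) = h (case i of (x, y) \<Rightarrow> ?p x y)" for g h t
        by (rule hom_tensor_eqI [OF gT that(1,2) _ that(3)]) (use that(4) in auto)
    qed (use h(2) pb(1) gT group.is_monoid in \<open>auto simp del: tensor_simps\<close>)
    moreover have "lift ?T ?T V W ?p f =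
        hom_ext (F Mod N) (F Mod N) (carrier V \<times> carrier W) (\<lambda>(x, y). ?p x y) (\<lambda>(x, y). f x y)"
      unfolding hom_ext_def by (simp add: hom_def)
    ultimately show ?thesis by (simp del: tensor_simps)
  qed
  have lact: "lact ?T a \<in> hom ?T ?T \<and> (\<forall>x\<in>carrier V. \<forall>y\<in>carrier W. lact ?T a (?p x y) = ?p (lact V a x) y)"
    if [simp]: "a \<in> carrier A" for a
  proof -
    have "balanced B V W ?T (\<lambda>x y. ?p (lact V a x) y)"
      by (rule balancedI)
        (use V W B in \<open>auto simp: pb(1,2,3) pb(4) [symmetric] subset_iff simp del: tensor_simps\<close>)
    from spec [OF this] show ?thesis
      by (simp add: tensor_def Let_def)
  qed
  have ract: "(\<lambda>t. ract ?T t a) \<in> hom ?T ?T \<and> (\<forall>x\<in>carrier V. \<forall>y\<in>carrier W. ract ?T (?p x y) a = ?p x (ract W y a))"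
    if [simp]: "a \<in> carrier A" for a
  proof -
    have "balanced B V W ?T (\<lambda>x y. ?p x (ract W y a))"
      by (rule balancedI)
        (use V W B in \<open>auto simp: pb(1,2,3) pb(4) subset_iff simp del: tensor_simps\<close>)
    from spec [OF this] show ?thesis
      by (simp add: tensor_def Let_def)
  qed
  have "id \<in> iso ?T ?T" by (simp add: iso_def hom_def)
  then have "\<exists>e\<in>iso ?T ?T. \<forall>x\<in>carrier V. \<forall>y\<in>carrier W. e (?p x y) = ?p x y"
    by (metis id_apply)
  then show ?thesis
    unfolding is_tensor_def using V W B lact ract group_tensor pure_balanced
    by (simp del: tensor_simps)
qed

lemma transport_is_tensor:
  assumes T: "is_tensor B V W T p" and e: "inj_on e (carrier T)"
  shows "is_tensor B V W (transport A e T) (\<lambda>x y. e (p x y))"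
proof -
  note TL [simp] = is_tensor_bimod_laws [OF T]
  note VW [simp] = is_tensorD(1,2) [OF T]
  have "bimod_laws (transport A e T)"
    using transport_bimodule [OF e TL] bimodule_iff by blast
  moreover have "balanced B V W (transport A e T) (\<lambda>x y. e (p x y))"
    by (rule balancedI)
      (simp_all add: transport_simps [OF e] is_tensor_balance [OF T] is_tensor_pure [OF T])
  moreover obtain i where i: "i \<in> iso (tensor B V W) T"
      "\<And>x y. \<lbrakk>x \<in> carrier V; y \<in> carrier W\<rbrakk> \<Longrightarrow> i (pure B V W x y) = p x y"
    using T unfolding is_tensor_def by blast
  have "e \<circ> i \<in> iso (tensor B V W) (transport A e T)"
    using iso_set_trans [OF i(1) transport_iso [OF e]] by (simp add: o_def compose_def)
  then have "\<exists>f\<in>iso (tensor B V W) (transport A e T).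
      \<forall>x\<in>carrier V. \<forall>y\<in>carrier W. f (pure B V W x y) = e (p x y)"
    by (rule bexI [rotated]) (simp add: i(2))
  ultimately show ?thesis
    using is_tensorD [OF T]
    unfolding is_tensor_def [of _ _ _ "transport A e T"]
    by (simp add: transport_simps [OF e] bimod_laws_group lact_hom ract_hom is_tensor_pure [OF T])
qed

subsection \<open>The tensor product with the regular bimodule over the base ring\<close>

text \<open>Restriction of scalars changes only the inner actions, and \<open>s\<close> acts as
  \<open>s 1\<close>; letting \<open>s\<close> run over \<open>carrier k\<close> therefore gives the
  same relations as letting \<open>c\<close> run over \<open>kone\<close>.\<close>

lemma tenA_eq: "tenA k A V = tensor kone V (regular_bimod A)"
  and pureA_eq: "pureA k A V = pure kone V (regular_bimod A)"
proof -
  have rels: "tensor_rels (carrier k) (res_right A V) (res_left A (regular_bimod A))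
      = tensor_rels kone V (regular_bimod A)"
    unfolding tensor_rels_def kone_def by (simp add: res_right_def res_left_def) blast
  have null: "tensor_null (carrier k) (res_right A V) (res_left A (regular_bimod A))
      = tensor_null kone V (regular_bimod A)"
    unfolding tensor_null_def rels by (simp add: res_right_def res_left_def)
  show p: "pureA k A V = pure kone V (regular_bimod A)"
    unfolding pureA_def pure_def null by (simp add: res_right_def res_left_def)
  have "pure (carrier k) (res_right A V) (res_left A (regular_bimod A)) = pure kone V (regular_bimod A)"
    using p unfolding pureA_def .
  then show "tenA k A V = tensor kone V (regular_bimod A)"
    unfolding tenA_def tensor_def null by (simp add: res_right_def res_left_def)
qed

lemma tenA_is_tensor:
  assumes "bimod_laws V"
  shows "is_tensor kone V (regular_bimod A) (tenA k A V) (pureA k A V)"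
  unfolding tenA_eq pureA_eq
  using assms by (intro tensor_is_tensor) (auto simp: bimod_laws_regular kone_closed)

lemma tenA_bimod_laws: "bimod_laws V \<Longrightarrow> bimod_laws (tenA k A V)"
  using tenA_is_tensor is_tensor_bimod_laws by blast


lemmas tenA_pure [simp] = is_tensor_pure [OF tenA_is_tensor, simplified]
lemmas tenA_balance = is_tensor_balance [OF tenA_is_tensor, simplified]
lemmas tenA_eqI = is_tensor_eqI [OF tenA_is_tensor, simplified]
lemmas [simp] = tenA_bimod_laws bimod_laws_regular

lemma mapA_eq:
  "mapA k A V W f g = lift (tenA k A V) (tenA k A W) V (regular_bimod A) (pureA k A V)
    (\<lambda>v b. pureA k A W (f v) (g b))"
  by (simp add: mapA_def)

text \<open>The linearity that \<open>f \<otimes> g\<close> over \<open>k\<close> demands of its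
  factors. Bimodule maps would be too narrow: \<open>mapA\<close> is applied to multiplications by
  an element of \<open>A\<close> as well.\<close>

definition kone_linear :: "('c, 'c, 'v) bimod \<Rightarrow> ('c, 'c, 'w) bimod \<Rightarrow> ('v \<Rightarrow> 'w) \<Rightarrow> bool" where
  "kone_linear V W f \<longleftrightarrow> f \<in> hom V W \<and> (\<forall>c\<in>kone. \<forall>v\<in>carrier V. f (ract V v c) = ract W (f v) c)"

lemma kone_linear_id: "kone_linear V V (\<lambda>x. x)"
  by (simp add: kone_linear_def hom_def)

lemma kone_linear_bimod_maps: "f \<in> bimod_maps A V W \<Longrightarrow> kone_linear V W f"
  by (simp add: kone_linear_def bimod_mapsD kone_closed)

lemma kone_linear_lact: "bimod_laws V \<Longrightarrow> a \<in> carrier A \<Longrightarrow> kone_linear V V (lact V a)"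
  by (simp add: kone_linear_def lact_hom kone_closed)

text \<open>Scalars are central in \<open>A\<close>, so
  \<open>(x a) c = x (a c) = x (c a) = (x c) a\<close>.\<close>

lemma kone_linear_ract: "bimod_laws V \<Longrightarrow> a \<in> carrier A \<Longrightarrow> kone_linear V V (\<lambda>x. ract V x a)"
  by (simp add: kone_linear_def ract_hom kone_closed kone_central [of _ a, symmetric]
      flip: bimod_laws_simps(8))

lemma kone_linear_mult_left: "a \<in> carrier A \<Longrightarrow> kone_linear (regular_bimod A) (regular_bimod A) (\<lambda>b. a \<otimes>\<^bsub>A\<^esub> b)"
  using kone_linear_lact [of "regular_bimod A" a] by (simp add: bimod_laws_regular)

lemma kone_linear_mult_right: "a \<in> carrier A \<Longrightarrow> kone_linear (regular_bimod A) (regular_bimod A) (\<lambda>b. b \<otimes>\<^bsub>A\<^esub> a)"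
  using kone_linear_ract [of "regular_bimod A" a] by (simp add: bimod_laws_regular)

context
  fixes V :: "('c, 'c, 'v) bimod" and W :: "('c, 'c, 'w) bimod" and f g
  assumes V [simp]: "bimod_laws V" and W [simp]: "bimod_laws W"
    and f: "kone_linear V W f" and g: "kone_linear (regular_bimod A) (regular_bimod A) g"
begin

lemma mapA_balanced:
  "balanced kone V (regular_bimod A) (tenA k A W) (\<lambda>v b. pureA k A W (f v) (g b))"
proof -
  have [simp]: "v \<in> carrier V \<Longrightarrow> f v \<in> carrier W" "b \<in> carrier A \<Longrightarrow> g b \<in> carrier A" for v b
    using f g by (auto simp: kone_linear_def hom_def)
  \<comment> \<open>Linearity of \<open>g\<close> is given for scalars acting from the right;
    centrality of \<open>kone\<close> in \<open>A\<close> moves them to the left.\<close>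
  have "g (c \<otimes>\<^bsub>A\<^esub> b) = c \<otimes>\<^bsub>A\<^esub> g b" if "c \<in> kone" "b \<in> carrier A" for c b
  proof -
    have "g b \<in> carrier A" "g (b \<otimes>\<^bsub>A\<^esub> c) = g b \<otimes>\<^bsub>A\<^esub> c"
      using g that by (auto simp: kone_linear_def hom_def)
    then show ?thesis
      using kone_central [OF that(1), of b] kone_central [OF that(1), of "g b"] that by simp
  qed
  moreover have "f (v \<otimes>\<^bsub>V\<^esub> v') = f v \<otimes>\<^bsub>W\<^esub> f v'" if "v \<in> carrier V" "v' \<in> carrier V" for v v'
    using f that by (simp add: kone_linear_def hom_def)
  moreover have "g (b \<oplus>\<^bsub>A\<^esub> b') = g b \<oplus>\<^bsub>A\<^esub> g b'" if "b \<in> carrier A" "b' \<in> carrier A" for b b'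
    using g that by (simp add: kone_linear_def hom_def)
  moreover have "f (ract V v c) = ract W (f v) c" if "c \<in> kone" "v \<in> carrier V" for c v
    using f that by (simp add: kone_linear_def)
  ultimately show ?thesis
    by (intro balancedI) (simp_all add: tenA_balance)
qed

lemma mapA_hom: "mapA k A V W f g \<in> hom (tenA k A V) (tenA k A W)"
  unfolding mapA_eq by (rule lift_hom [OF tenA_is_tensor _ mapA_balanced]) (simp_all add: bimod_laws_group)

lemma mapA_pure:
  "\<lbrakk>v \<in> carrier V; b \<in> carrier A\<rbrakk> \<Longrightarrow> mapA k A V W f g (pureA k A V v b) = pureA k A W (f v) (g b)"
  unfolding mapA_eq
  by (rule lift_pure [OF tenA_is_tensor _ mapA_balanced]) (simp_all add: bimod_laws_group)

end

lemma tenA_eq_mapI: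
  assumes V: "bimod_laws V" and H: "bimod_laws H" and "g \<in> hom (tenA k A V) H" "h \<in> hom (tenA k A V) H"
    and "\<And>x y. \<lbrakk>x \<in> carrier V; y \<in> carrier A\<rbrakk> \<Longrightarrow> g (pureA k A V x y) = h (pureA k A V x y)"
    and "t \<in> carrier (tenA k A V)"
  shows "g t = h t"
  by (rule tenA_eqI [OF V]) (use assms bimod_laws_is_group in auto)

lemma mapA_lact:
  assumes V [simp]: "bimod_laws V" and [simp]: "a \<in> carrier A" and t: "t \<in> carrier (tenA k A V)"
  shows "mapA k A V V (\<lambda>x. lact V a x) (\<lambda>b. b) t = lact (tenA k A V) a t"
  by (rule tenA_eq_mapI [OF V tenA_bimod_laws [OF V] _ _ _ t])
    (simp_all add: mapA_hom mapA_pure kone_linear_id kone_linear_lact lact_hom)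

lemma mapA_ract:
  assumes V [simp]: "bimod_laws V" and [simp]: "a \<in> carrier A" and t: "t \<in> carrier (tenA k A V)"
  shows "mapA k A V V (\<lambda>x. x) (\<lambda>b. b \<otimes>\<^bsub>A\<^esub> a) t = ract (tenA k A V) t a"
  by (rule tenA_eq_mapI [OF V tenA_bimod_laws [OF V] _ _ _ t])
    (simp_all add: mapA_hom mapA_pure kone_linear_id kone_linear_mult_right ract_hom)

text \<open>The two inner actions of \<open>A\<close> on \<open>V \<otimes>\<^sub>k A\<close>,
  namely \<open>v \<otimes> b \<mapsto> v \<otimes> a b\<close> and
  \<open>v \<otimes> b \<mapsto> v a \<otimes> b\<close>. They are not part of the bimodule
  structure of \<open>tenA\<close>, which consists of the outer actions.\<close>

abbreviation mid_left where "mid_left V a \<equiv> mapA k A V V (\<lambda>x. x) (\<lambda>b. a \<otimes>\<^bsub>A\<^esub> b)"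
abbreviation mid_right where "mid_right V a \<equiv> mapA k A V V (\<lambda>x. ract V x a) (\<lambda>b. b)"

text \<open>A scalar crosses the tensor sign and is central on \<open>V\<close>:
  \<open>v \<otimes> c b = v c \<otimes> b = c v \<otimes> b\<close>. This is why
  \<open>k\<close>-linearity of \<rho> follows from its rule for \<open>a v\<close>.\<close>

lemma mid_left_smult:
  assumes V [simp]: "bimod_laws V" and c: "c \<in> kone" and t: "t \<in> carrier (tenA k A V)"
  shows "mid_left V c t = lact (tenA k A V) c t"
proof (rule tenA_eq_mapI [OF V tenA_bimod_laws [OF V] _ _ _ t])
  have [simp]: "c \<in> carrier A" using c by (rule kone_closed)
  show "mid_left V c (pureA k A V x y) = lact (tenA k A V) c (pureA k A V x y)"
    if "x \<in> carrier V" "y \<in> carrier A" for x y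
    using that c
    using tenA_balance [OF V that(1) c that(2)]
    by (simp add: mapA_pure kone_linear_id kone_linear_mult_left bimod_laws_central [OF V])
qed (simp_all add: mapA_hom kone_linear_id kone_linear_mult_left lact_hom kone_closed c)

definition counit :: "('c, 'c, 'v) bimod \<Rightarrow> ('v \<times> 'c \<Rightarrow>\<^sub>0 int) set \<Rightarrow> 'v" where
  "counit V = lift (tenA k A V) V V (regular_bimod A) (pureA k A V) (ract V)"

lemma counit_balanced: "bimod_laws V \<Longrightarrow> balanced kone V (regular_bimod A) V (ract V)"
  by (rule balancedI) (simp_all add: kone_closed)

lemma counit_hom: "bimod_laws V \<Longrightarrow> counit V \<in> hom (tenA k A V) V"
  unfolding counit_def by (rule lift_hom [OF tenA_is_tensor _ counit_balanced]) (simp_all add: bimod_laws_group)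

lemma counit_pure:
  "\<lbrakk>bimod_laws V; v \<in> carrier V; b \<in> carrier A\<rbrakk> \<Longrightarrow> counit V (pureA k A V v b) = ract V v b"
  unfolding counit_def
  by (rule lift_pure [OF tenA_is_tensor _ counit_balanced]) (simp_all add: bimod_laws_group)

text \<open>The \<open>k\<close>-linearity required in \<open>yd_coaction\<close> is omitted: it is the rule for \<open>\<rho> (a v)\<close> at \<open>a = s 1\<close>.\<close>

lemma yd_coaction_iff:
  assumes V [simp]: "bimod_laws V"
  shows "yd_coaction k A V \<rho> \<longleftrightarrow>
    \<rho> \<in> hom V (tenA k A V) \<and> \<rho> \<in> extensional (carrier V) \<and>
    (\<forall>v\<in>carrier V. counit V (\<rho> v) = v) \<and>
    (\<forall>v\<in>carrier V.
       mapA k A V (tenA k A V) \<rho> (\<lambda>b. b) (\<rho> v) =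
       mapA k A V (tenA k A V) (\<lambda>x. pureA k A V x \<one>\<^bsub>A\<^esub>) (\<lambda>b. b) (\<rho> v)) \<and>
    (\<forall>v\<in>carrier V. \<forall>a\<in>carrier A. \<rho> (ract V v a) = ract (tenA k A V) (\<rho> v) a) \<and>
    (\<forall>v\<in>carrier V. \<forall>a\<in>carrier A. \<rho> (lact V a v) = mid_left V a (\<rho> v)) \<and>
    (\<forall>v\<in>carrier V. \<forall>a\<in>carrier A. lact (tenA k A V) a (\<rho> v) = mid_right V a (\<rho> v))"
proof (cases "\<rho> \<in> hom V (tenA k A V)")
  case True
  then have [simp]: "\<rho> v \<in> carrier (tenA k A V)" if "v \<in> carrier V" for v
    using True that by (auto simp: hom_def)
  show ?thesis
    using True
    by (auto simp: yd_coaction_def counit_def mapA_lact mapA_ract mid_left_smult smult_one_kone kone_closed)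
qed (simp add: yd_coaction_def)

end

section \<open>Bimodules inside the universe \<open>'u\<close>, and the free bimodule on one
  generator there\<close>

locale bimod_universe = k_algebra k A
  for k :: "('k, 'y) ring_scheme" (structure) and A :: "('k, 'a, 'z) module_scheme" (structure) +
  fixes \<iota> :: "'a \<Rightarrow> 'u"
  assumes infinite_universe: "infinite (UNIV :: 'u set)" and inj_iota: "inj_on \<iota> (carrier A)"
begin

lemma square_lepoll: "(UNIV :: ('u \<times> 'u) set) \<lesssim> (UNIV :: 'u set)"
  using card_of_Times_same_infinite [OF infinite_universe]
  by (metis UNIV_Times_UNIV eqpoll_iff_card_of_ordIso eqpoll_imp_lepoll)

text \<open>The choice made in \<open>enc\<close> is a genuine injection, since formal sums over
  \<open>'u \<times> 'u\<close> are no more numerous than the infinite type \<open>'u\<close>;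
  \<open>rep_inj\<close> extends this to cosets.\<close>

lemma inj_enc:
  fixes X Y :: "('a, 'a, 'u) bimod"
  assumes "bimod_laws X" "bimod_laws Y"
  shows "inj_on enc (carrier (tensor (carrier A) X Y))"
proof -
  interpret tensorable "carrier A" X Y using assms by (simp add: tensorable)
  have "\<exists>e :: ('u \<times> 'u \<Rightarrow>\<^sub>0 int) \<Rightarrow> 'u. inj e"
    using inj_frag [OF infinite_universe square_lepoll] by simp
  then have "inj (SOME e :: ('u \<times> 'u \<Rightarrow>\<^sub>0 int) \<Rightarrow> 'u. inj e)"
    by (rule someI_ex)
  then have "inj_on (SOME e :: ('u \<times> 'u \<Rightarrow>\<^sub>0 int) \<Rightarrow> 'u. inj e) {z. Poly_Mapping.keys z \<subseteq> carrier X \<times> carrier Y}"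
    using inj_on_subset by blast
  from rep_inj [OF this] show ?thesis
    by (simp add: enc_def [abs_def] del: tensor_simps)
qed

lemma tensor_u_is_tensor:
  fixes X Y :: "('a, 'a, 'u) bimod"
  assumes "bimod_laws X" "bimod_laws Y"
  shows "is_tensor (carrier A) X Y (tensor_u A X Y) (pure_u A X Y)"
  unfolding tensor_u_def pure_u_def [abs_def]
  by (rule transport_is_tensor [OF tensor_is_tensor inj_enc]) (use assms kone_subset in auto)

lemma tensor_u_bimodule:
  fixes X Y :: "('a, 'a, 'u) bimod"
  assumes "bimod_laws X" "bimod_laws Y"
  shows "bimodule k A (tensor_u A X Y)"
  unfolding tensor_u_def
  by (rule transport_bimodule [OF inj_enc is_tensor_bimod_laws [OF tensor_is_tensor]])
    (use assms kone_subset in auto)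

lemma bimodule_laws: "bimodule k A X \<Longrightarrow> bimod_laws X"
  by (simp add: bimodule_iff)

lemma tensor_u_laws [simp]:
  fixes X Y :: "('a, 'a, 'u) bimod"
  shows "bimod_laws X \<Longrightarrow> bimod_laws Y \<Longrightarrow> bimod_laws (tensor_u A X Y)"
  using tensor_u_bimodule bimodule_laws by blast

lemma emb_inj: "inj_on (emb A :: 'a \<Rightarrow> 'u) (carrier A)"
  unfolding emb_def by (rule someI_ex [of "\<lambda>i. inj_on i (carrier A)"]) (use inj_iota in blast)

lemma unit_u_bimodule: "bimodule k A (unit_u A :: ('a, 'a, 'u) bimod)"
  unfolding unit_u_def by (rule transport_bimodule) (simp_all add: emb_inj)


text \<open>The elements of \<open>E\<close> are cosets of formal sums over
  \<open>'a \<times> 'a\<close> rather than \<open>'u \<times> 'u\<close>, so \<open>enc\<close>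
  does not apply and \<open>E\<close> receives an encoding of its own.\<close>

definition free_emb :: "('a \<times> 'a \<Rightarrow>\<^sub>0 int) set \<Rightarrow> 'u" where
  "free_emb = (SOME e. inj_on e (carrier (tenA k A (regular_bimod A))))"

definition free_bimod :: "('a, 'a, 'u) bimod" where
  "free_bimod = transport A free_emb (tenA k A (regular_bimod A))"

definition free_pure :: "'a \<Rightarrow> 'a \<Rightarrow> 'u" where
  "free_pure a b = free_emb (pureA k A (regular_bimod A) a b)"

abbreviation free_gen :: 'u where "free_gen \<equiv> free_pure \<one>\<^bsub>A\<^esub> \<one>\<^bsub>A\<^esub>"

lemma free_emb_inj: "inj_on free_emb (carrier (tenA k A (regular_bimod A)))"
proof -
  interpret tensorable kone "regular_bimod A" "regular_bimod A"
    by (rule tensorable) (simp_all add: kone_subset)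
  have "carrier A \<lesssim> (UNIV :: 'u set)"
    using inj_iota unfolding lepoll_def by blast
  then have "carrier A \<times> carrier A \<lesssim> (UNIV :: ('u \<times> 'u) set)"
    using times_lepoll_mono [of "carrier A" "UNIV :: 'u set" "carrier A" "UNIV :: 'u set"] by simp
  then have "carrier A \<times> carrier A \<lesssim> (UNIV :: 'u set)"
    using square_lepoll lepoll_trans by blast
  then obtain e :: "('a \<times> 'a \<Rightarrow>\<^sub>0 int) \<Rightarrow> 'u"
    where "inj_on e {z. Poly_Mapping.keys z \<subseteq> carrier A \<times> carrier A}"
    using inj_frag [OF infinite_universe] by blast
  then have "inj_on (\<lambda>t. e (SOME z. z \<in> t)) (carrier (tenA k A (regular_bimod A)))"
    using rep_inj [of e] by (simp add: tenA_eq del: tensor_simps)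
  then show ?thesis
    unfolding free_emb_def by (rule someI [of "\<lambda>e. inj_on e (carrier (tenA k A (regular_bimod A)))"])
qed

lemma free_is_tensor: "is_tensor kone (regular_bimod A) (regular_bimod A) free_bimod free_pure"
  unfolding free_bimod_def free_pure_def [abs_def]
  by (rule transport_is_tensor [OF tenA_is_tensor free_emb_inj]) simp

lemma free_bimodule: "bimodule k A free_bimod"
  unfolding free_bimod_def by (rule transport_bimodule [OF free_emb_inj]) simp


lemmas [simp] = bimodule_laws [OF free_bimodule] bimodule_laws [OF unit_u_bimodule]

lemmas tensor_u_pure [simp] = is_tensor_pure [OF tensor_u_is_tensor]
lemmas tensor_u_balance = is_tensor_balance [OF tensor_u_is_tensor]

lemmas free_pure_simps [simp] = is_tensor_pure [OF free_is_tensor, simplified]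

lemma tensor_u_eqI:
  fixes X Y :: "('a, 'a, 'u) bimod"
  assumes "bimod_laws X" "bimod_laws Y" "bimod_laws H"
    and "g \<in> hom (tensor_u A X Y) H" "h \<in> hom (tensor_u A X Y) H"
    and "\<And>x y. \<lbrakk>x \<in> carrier X; y \<in> carrier Y\<rbrakk> \<Longrightarrow> g (pure_u A X Y x y) = h (pure_u A X Y x y)"
    and "t \<in> carrier (tensor_u A X Y)"
  shows "g t = h t"
  by (rule is_tensor_eqI [OF tensor_u_is_tensor]) (use assms bimod_laws_is_group in auto)

lemma free_eqI:
  assumes "bimod_laws H" "g \<in> hom free_bimod H" "h \<in> hom free_bimod H"
    and "\<And>a b. \<lbrakk>a \<in> carrier A; b \<in> carrier A\<rbrakk> \<Longrightarrow> g (free_pure a b) = h (free_pure a b)"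
    and "t \<in> carrier free_bimod"
  shows "g t = h t"
  by (rule is_tensor_eqI [OF free_is_tensor]) (use assms bimod_laws_is_group in auto)

lemma hom_closed: "f \<in> hom V W \<Longrightarrow> x \<in> carrier V \<Longrightarrow> f x \<in> carrier W"
  by (auto simp: hom_def)

subsection \<open>The isomorphism between \<open>V \<otimes>\<^sub>A (A \<otimes>\<^sub>k A)\<close> and \<open>V \<otimes>\<^sub>k A\<close>\<close>

text \<open>The image of \<open>w \<otimes> e\<close> under
  \<open>W \<otimes>\<^sub>A E \<cong> W \<otimes>\<^sub>k A\<close>, given by
  \<open>w \<otimes> (a \<otimes> b) \<mapsto> w a \<otimes> b\<close>. The elements of
  \<open>W\<close> may have any type, so that \<open>W\<close> can also be
  \<open>V \<otimes>\<^sub>k A\<close>, which is not an object of the category.\<close>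

definition push :: "('a, 'a, 'w) bimod \<Rightarrow> 'w \<Rightarrow> 'u \<Rightarrow> ('w \<times> 'a \<Rightarrow>\<^sub>0 int) set" where
  "push W w = lift free_bimod (tenA k A W) (regular_bimod A) (regular_bimod A) free_pure
    (\<lambda>a b. pureA k A W (ract W w a) b)"

context
  fixes W :: "('a, 'a, 'w) bimod"
  assumes W [simp]: "bimod_laws W"
begin

lemma push_aux:
  assumes [simp]: "w \<in> carrier W"
  shows "balanced kone (regular_bimod A) (regular_bimod A) (tenA k A W) (\<lambda>a b. pureA k A W (ract W w a) b)"
  by (rule balancedI) (simp_all add: tenA_balance kone_closed)

lemma push_hom: "w \<in> carrier W \<Longrightarrow> push W w \<in> hom free_bimod (tenA k A W)"
  unfolding push_def by (rule lift_hom [OF free_is_tensor _ push_aux]) (simp_all add: bimod_laws_group)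

lemma push_pure:
  "\<lbrakk>w \<in> carrier W; a \<in> carrier A; b \<in> carrier A\<rbrakk> \<Longrightarrow>
    push W w (free_pure a b) = pureA k A W (ract W w a) b"
  unfolding push_def
  by (rule lift_pure [OF free_is_tensor _ push_aux]) (simp_all add: bimod_laws_group)

lemmas push_closed = hom_closed [OF push_hom]

lemma push_balanced: "balanced (carrier A) W free_bimod (tenA k A W) (push W)"
proof (rule balancedI)
  show "push W (w \<otimes>\<^bsub>W\<^esub> w') e = push W w e \<otimes>\<^bsub>tenA k A W\<^esub> push W w' e"
    if [simp]: "w \<in> carrier W" "w' \<in> carrier W" and e: "e \<in> carrier free_bimod" for w w' e
    by (rule free_eqI [OF _ push_hom hom_mult_fun [OF _ push_hom push_hom] _ e])
      (simp_all add: push_pure bimod_laws_group)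
  show "push W (ract W w a) e = push W w (lact free_bimod a e)"
    if [simp]: "w \<in> carrier W" "a \<in> carrier A" and e: "e \<in> carrier free_bimod" for w a e
    by (rule free_eqI [OF _ push_hom hom_compose' [OF lact_hom push_hom] _ e])
      (simp_all add: push_pure)
qed (simp_all add: push_closed hom_mult [OF push_hom])

lemma push_lact:
  assumes [simp]: "w \<in> carrier W" "a \<in> carrier A" and e: "e \<in> carrier free_bimod"
  shows "push W (lact W a w) e = lact (tenA k A W) a (push W w e)"
  by (rule free_eqI [OF _ push_hom hom_compose' [OF push_hom lact_hom] _ e])
    (simp_all add: push_pure)

lemma push_ract:
  assumes [simp]: "w \<in> carrier W" "a \<in> carrier A" and e: "e \<in> carrier free_bimod"
  shows "push W w (ract free_bimod e a) = ract (tenA k A W) (push W w e) a"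
  by (rule free_eqI [OF _ hom_compose' [OF ract_hom push_hom] hom_compose' [OF push_hom ract_hom] _ e])
    (simp_all add: push_pure)

end

definition theta :: "('a, 'a, 'u) bimod \<Rightarrow> 'u \<Rightarrow> ('u \<times> 'a \<Rightarrow>\<^sub>0 int) set" where
  "theta V = lift (tensor_u A V free_bimod) (tenA k A V) V free_bimod (pure_u A V free_bimod) (push V)"

lemma theta_bimod_maps:
  "bimod_laws V \<Longrightarrow> theta V \<in> bimod_maps A (tensor_u A V free_bimod) (tenA k A V)"
  unfolding theta_def
  by (rule lift_bimod_maps [OF tensor_u_is_tensor _ _ push_balanced])
    (simp_all add: push_lact push_ract)

lemma theta_pure:
  "\<lbrakk>bimod_laws V; v \<in> carrier V; e \<in> carrier free_bimod\<rbrakk> \<Longrightarrow>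
    theta V (pure_u A V free_bimod v e) = push V v e"
  unfolding theta_def
  by (rule lift_pure [OF tensor_u_is_tensor _ push_balanced]) (simp_all add: bimod_laws_group)

text \<open>The half braiding corresponding to \<open>\<rho>\<close> maps \<open>x \<otimes> v\<close> to \<open>act V X x (\<rho> v)\<close>.\<close>

definition act :: "('a, 'a, 'u) bimod \<Rightarrow> ('a, 'a, 'u) bimod \<Rightarrow> 'u \<Rightarrow> ('u \<times> 'a \<Rightarrow>\<^sub>0 int) set \<Rightarrow> 'u" where
  "act V X x = lift (tenA k A V) (tensor_u A V X) V (regular_bimod A) (pureA k A V)
    (\<lambda>v b. pure_u A V X v (ract X x b))"

context
  fixes V X :: "('a, 'a, 'u) bimod"
  assumes V [simp]: "bimod_laws V" and X [simp]: "bimod_laws X"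
begin

text \<open>For a scalar \<open>c\<close>,
  \<open>v c \<otimes> x b = v \<otimes> c x b = v \<otimes> x c b\<close>: balancing over
  \<open>A\<close> followed by \<open>k\<close>-centrality of \<open>X\<close>.\<close>

lemma act_balanced:
  assumes [simp]: "x \<in> carrier X"
  shows "balanced kone V (regular_bimod A) (tensor_u A V X) (\<lambda>v b. pure_u A V X v (ract X x b))"
proof (rule balancedI)
  show "pure_u A V X (ract V v c) (ract X x b) = pure_u A V X v (ract X x (lact (regular_bimod A) c b))"
    if [simp]: "v \<in> carrier V" "b \<in> carrier (regular_bimod A)" and c: "c \<in> kone" for v c b
  proof -
    have [simp]: "c \<in> carrier A" "b \<in> carrier A" using c that by (simp_all add: kone_closed)
    show ?thesis
      using bimod_laws_central [OF X c, of x]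
      by (simp add: tensor_u_balance flip: bimod_laws_simps(9))
  qed
qed simp_all

lemma act_hom: "x \<in> carrier X \<Longrightarrow> act V X x \<in> hom (tenA k A V) (tensor_u A V X)"
  unfolding act_def by (rule lift_hom [OF tenA_is_tensor _ act_balanced]) (simp_all add: bimod_laws_group)

lemma act_pure:
  "\<lbrakk>x \<in> carrier X; v \<in> carrier V; b \<in> carrier A\<rbrakk> \<Longrightarrow>
    act V X x (pureA k A V v b) = pure_u A V X v (ract X x b)"
  unfolding act_def
  by (rule lift_pure [OF tenA_is_tensor _ act_balanced]) (simp_all add: bimod_laws_group)

lemmas act_closed = hom_closed [OF act_hom]

lemma act_add:
  assumes [simp]: "x \<in> carrier X" "x' \<in> carrier X" and t: "t \<in> carrier (tenA k A V)"
  shows "act V X (x \<otimes>\<^bsub>X\<^esub> x') t = act V X x t \<otimes>\<^bsub>tensor_u A V X\<^esub> act V X x' t"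
  by (rule tenA_eq_mapI [OF V _ act_hom hom_mult_fun [OF _ act_hom act_hom] _ t])
    (simp_all add: act_pure bimod_laws_group)

text \<open>Both sides send \<open>v \<otimes> b\<close> to \<open>v \<otimes> x a b\<close>. This
  links balancedness of the braiding, \<open>x a \<otimes> v = x \<otimes> a v\<close>, to the rule
  for \<open>\<rho> (a v)\<close>.\<close>

lemma act_of_ract:
  assumes [simp]: "x \<in> carrier X" "a \<in> carrier A" and t: "t \<in> carrier (tenA k A V)"
  shows "act V X (ract X x a) t = act V X x (mid_left V a t)"
  by (rule tenA_eq_mapI [OF V _ act_hom hom_compose' [OF mapA_hom act_hom] _ t])
    (simp_all add: act_pure mapA_pure kone_linear_id kone_linear_mult_left)

text \<open>Balancing over \<open>A\<close> gives
  \<open>v \<otimes> a x b = v a \<otimes> x b\<close>. This links left linearity of the braiding to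
  the rule \<open>a v\<^sub>0 \<otimes> v\<^sub>1 = v\<^sub>0 a \<otimes> v\<^sub>1\<close>.\<close>

lemma act_of_lact:
  assumes [simp]: "x \<in> carrier X" "a \<in> carrier A" and t: "t \<in> carrier (tenA k A V)"
  shows "act V X (lact X a x) t = act V X x (mid_right V a t)"
  by (rule tenA_eq_mapI [OF V _ act_hom hom_compose' [OF mapA_hom act_hom] _ t])
    (simp_all add: act_pure mapA_pure kone_linear_id kone_linear_ract tensor_u_balance)

lemma act_lact:
  assumes [simp]: "x \<in> carrier X" "a \<in> carrier A" and t: "t \<in> carrier (tenA k A V)"
  shows "act V X x (lact (tenA k A V) a t) = lact (tensor_u A V X) a (act V X x t)"
  by (rule tenA_eq_mapI [OF V _ hom_compose' [OF lact_hom act_hom] hom_compose' [OF act_hom lact_hom] _ t])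
    (simp_all add: act_pure)

lemma act_ract:
  assumes [simp]: "x \<in> carrier X" "a \<in> carrier A" and t: "t \<in> carrier (tenA k A V)"
  shows "act V X x (ract (tenA k A V) t a) = ract (tensor_u A V X) (act V X x t) a"
  by (rule tenA_eq_mapI [OF V _ hom_compose' [OF ract_hom act_hom] hom_compose' [OF act_hom ract_hom] _ t])
    (simp_all add: act_pure)

end

text \<open>On pure tensors, \<open>v \<otimes> b \<mapsto> v \<otimes> (1 \<otimes> b) \<mapsto> v
  1 \<otimes> b\<close>. Hence \<open>act V free_bimod free_gen\<close> is injective, and equations
  in \<open>V \<otimes>\<^sub>k A\<close> can be tested in
  \<open>V \<otimes>\<^sub>A E\<close>.\<close>

lemma theta_act:
  assumes V [simp]: "bimod_laws V" and t: "t \<in> carrier (tenA k A V)"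
  shows "theta V (act V free_bimod free_gen t) = t"
  by (rule tenA_eq_mapI [OF V _ hom_compose' [OF act_hom bimod_mapsD(1) [OF theta_bimod_maps]] _ _ t])
    (simp_all add: act_pure theta_pure push_pure hom_def)

subsection \<open>The monoidal category of bimodules\<close>

abbreviation \<C> :: "(('a, 'a, 'u) bimod, 'u \<Rightarrow> 'u) moncat" where "\<C> \<equiv> bimod_moncat k A"

lemma moncat_simps [simp]:
  "Obj \<C> = {V. bimodule k A V}"
  "Mor \<C> = bimod_maps A"
  "Idn \<C> V = (\<lambda>x\<in>carrier V. x)"
  "Cmp \<C> U V W g f = compose (carrier U) g f"
  "TObj \<C> = tensor_u A"
  "Unit \<C> = unit_u A"
  by (simp_all add: bimod_moncat_def)

lemma tensor_u_maps_eq_iff: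
  fixes X Y :: "('a, 'a, 'u) bimod"
  assumes "bimod_laws X" "bimod_laws Y" "bimod_laws H"
    and "f \<in> bimod_maps A (tensor_u A X Y) H" "g \<in> bimod_maps A (tensor_u A X Y) H"
  shows "f = g \<longleftrightarrow> (\<forall>x\<in>carrier X. \<forall>y\<in>carrier Y. f (pure_u A X Y x y) = g (pure_u A X Y x y))"
  using tensor_u_eqI [OF assms(1-3) bimod_mapsD(1) [OF assms(4)] bimod_mapsD(1) [OF assms(5)]]
    bimod_maps_eqI [OF assms(4,5)] by blast

lemma TMor_eq:
  "TMor \<C> X X' Y Y' f g = lift (tensor_u A X Y) (tensor_u A X' Y') X Y (pure_u A X Y)
    (\<lambda>x y. pure_u A X' Y' (f x) (g y))"
  by (simp add: bimod_moncat_def)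

context
  fixes X X' Y Y' :: "('a, 'a, 'u) bimod" and f g
  assumes laws [simp]: "bimod_laws X" "bimod_laws X'" "bimod_laws Y" "bimod_laws Y'"
    and f: "f \<in> bimod_maps A X X'" and g: "g \<in> bimod_maps A Y Y'"
begin

lemma TMor_balanced:
  "balanced (carrier A) X Y (tensor_u A X' Y') (\<lambda>x y. pure_u A X' Y' (f x) (g y))"
  by (rule balancedI) (simp_all add: bimod_mapsD [OF f] bimod_mapsD [OF g] tensor_u_balance)

lemma TMor_maps: "TMor \<C> X X' Y Y' f g \<in> bimod_maps A (tensor_u A X Y) (tensor_u A X' Y')"
  unfolding TMor_eq
  by (rule lift_bimod_maps [OF tensor_u_is_tensor _ _ TMor_balanced])
    (simp_all add: bimod_mapsD [OF f] bimod_mapsD [OF g])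

lemma TMor_pure:
  "\<lbrakk>x \<in> carrier X; y \<in> carrier Y\<rbrakk> \<Longrightarrow>
    TMor \<C> X X' Y Y' f g (pure_u A X Y x y) = pure_u A X' Y' (f x) (g y)"
  unfolding TMor_eq
  by (rule lift_pure [OF tensor_u_is_tensor _ TMor_balanced]) (simp_all add: bimod_laws_group)

end

lemma inv_mor_eq:
  fixes X Y :: "('a, 'a, 'u) bimod"
  assumes f: "f \<in> bimod_maps A X Y" and g: "g \<in> bimod_maps A Y X"
    and gf: "\<And>x. x \<in> carrier X \<Longrightarrow> g (f x) = x" and fg: "\<And>y. y \<in> carrier Y \<Longrightarrow> f (g y) = y"
  shows "inv_mor \<C> X Y f = g"
  unfolding inv_mor_def
proof (rule the_equality)
  show "g \<in> Mor \<C> Y X \<and> Cmp \<C> X Y X g f = Idn \<C> X \<and> Cmp \<C> Y X Y f g = Idn \<C> Y"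
    using g gf fg by (auto simp: compose_def restrict_def)
  fix h assume h: "h \<in> Mor \<C> Y X \<and> Cmp \<C> X Y X h f = Idn \<C> X \<and> Cmp \<C> Y X Y f h = Idn \<C> Y"
  then have hf: "h (f x) = x" if "x \<in> carrier X" for x
  proof -
    have "compose (carrier X) h f = (\<lambda>x\<in>carrier X. x)" using h by simp
    from fun_cong [OF this, of x] show ?thesis using that by (simp add: compose_def)
  qed
  have hm: "h \<in> bimod_maps A Y X" using h by simp
  show "h = g"
    by (rule bimod_maps_eqI [OF hm g]) (metis fg hf bimod_mapsD(3) [OF g])
qed

section \<open>Associators on iterated pure tensors\<close>

lemma assoc_left_eqI:
  fixes X Y Z :: "('a, 'a, 'u) bimod"
  assumes [simp]: "bimod_laws X" "bimod_laws Y" "bimod_laws Z" and H [simp]: "bimod_laws H"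
    and g: "g \<in> hom (tensor_u A (tensor_u A X Y) Z) H" and h: "h \<in> hom (tensor_u A (tensor_u A X Y) Z) H"
    and eq: "\<And>x y z. \<lbrakk>x \<in> carrier X; y \<in> carrier Y; z \<in> carrier Z\<rbrakk> \<Longrightarrow>
      g (pure_u A (tensor_u A X Y) Z (pure_u A X Y x y) z) = h (pure_u A (tensor_u A X Y) Z (pure_u A X Y x y) z)"
    and t: "t \<in> carrier (tensor_u A (tensor_u A X Y) Z)"
  shows "g t = h t"
proof (rule tensor_u_eqI [OF _ _ H g h _ t])
  fix s z assume s: "s \<in> carrier (tensor_u A X Y)" and z [simp]: "z \<in> carrier Z"
  have p: "(\<lambda>s. pure_u A (tensor_u A X Y) Z s z) \<in> hom (tensor_u A X Y) (tensor_u A (tensor_u A X Y) Z)"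
    by (rule homI) simp_all
  show "g (pure_u A (tensor_u A X Y) Z s z) = h (pure_u A (tensor_u A X Y) Z s z)"
    by (rule tensor_u_eqI [OF _ _ H hom_compose' [OF p g] hom_compose' [OF p h] _ s])
      (simp_all add: eq)
qed simp_all

lemma assoc_right_eqI:
  fixes X Y Z :: "('a, 'a, 'u) bimod"
  assumes [simp]: "bimod_laws X" "bimod_laws Y" "bimod_laws Z" and H [simp]: "bimod_laws H"
    and g: "g \<in> hom (tensor_u A X (tensor_u A Y Z)) H" and h: "h \<in> hom (tensor_u A X (tensor_u A Y Z)) H"
    and eq: "\<And>x y z. \<lbrakk>x \<in> carrier X; y \<in> carrier Y; z \<in> carrier Z\<rbrakk> \<Longrightarrow>
      g (pure_u A X (tensor_u A Y Z) x (pure_u A Y Z y z)) = h (pure_u A X (tensor_u A Y Z) x (pure_u A Y Z y z))"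
    and t: "t \<in> carrier (tensor_u A X (tensor_u A Y Z))"
  shows "g t = h t"
proof (rule tensor_u_eqI [OF _ _ H g h _ t])
  fix x s assume x [simp]: "x \<in> carrier X" and s: "s \<in> carrier (tensor_u A Y Z)"
  have p: "(\<lambda>s. pure_u A X (tensor_u A Y Z) x s) \<in> hom (tensor_u A Y Z) (tensor_u A X (tensor_u A Y Z))"
    by (rule homI) simp_all
  show "g (pure_u A X (tensor_u A Y Z) x s) = h (pure_u A X (tensor_u A Y Z) x s)"
    by (rule tensor_u_eqI [OF _ _ H hom_compose' [OF p g] hom_compose' [OF p h] _ s])
      (simp_all add: eq)
qed simp_all

context
  fixes X Y Z :: "('a, 'a, 'u) bimod"
  assumes laws [simp]: "bimod_laws X" "bimod_laws Y" "bimod_laws Z"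
begin

abbreviation (input) "XY_Z \<equiv> tensor_u A (tensor_u A X Y) Z"
abbreviation (input) "X_YZ \<equiv> tensor_u A X (tensor_u A Y Z)"
abbreviation (input) "left_pure x y z \<equiv> pure_u A (tensor_u A X Y) Z (pure_u A X Y x y) z"
abbreviation (input) "right_pure x y z \<equiv> pure_u A X (tensor_u A Y Z) x (pure_u A Y Z y z)"

text \<open>The universal property is applied twice: for fixed \<open>z\<close> it yields
  \<open>a z\<close> on the product of \<open>X\<close> and \<open>Y\<close>, and the pairing
  \<open>(s, z) \<mapsto> a z s\<close> is again balanced, as one sees by letting \<open>s\<close>
  be a pure tensor.\<close>

lemma assoc_exists:
  "\<exists>h\<in>bimod_maps A XY_Z X_YZ. \<forall>x\<in>carrier X. \<forall>y\<in>carrier Y. \<forall>z\<in>carrier Z.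
    h (left_pure x y z) = right_pure x y z"
proof -
  define a where "a z = lift (tensor_u A X Y) X_YZ X Y (pure_u A X Y) (\<lambda>x y. right_pure x y z)" for z
  have b: "balanced (carrier A) X Y X_YZ (\<lambda>x y. right_pure x y z)" if [simp]: "z \<in> carrier Z" for z
    by (rule balancedI) (simp_all add: tensor_u_balance)
  have ah: "a z \<in> hom (tensor_u A X Y) X_YZ" if [simp]: "z \<in> carrier Z" for z
    unfolding a_def by (rule lift_hom [OF tensor_u_is_tensor _ b]) (simp_all add: bimod_laws_group)
  have ap: "a z (pure_u A X Y x y) = right_pure x y z"
    if [simp]: "x \<in> carrier X" "y \<in> carrier Y" "z \<in> carrier Z" for x y z
    unfolding a_def by (rule lift_pure [OF tensor_u_is_tensor _ b]) (simp_all add: bimod_laws_group)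
  have ab: "balanced (carrier A) (tensor_u A X Y) Z X_YZ (\<lambda>s z. a z s)"
  proof (rule balancedI)
    show "a (z \<otimes>\<^bsub>Z\<^esub> z') s = a z s \<otimes>\<^bsub>X_YZ\<^esub> a z' s"
      if [simp]: "z \<in> carrier Z" "z' \<in> carrier Z" and s: "s \<in> carrier (tensor_u A X Y)" for z z' s
      by (rule tensor_u_eqI [OF _ _ _ ah hom_mult_fun [OF _ ah ah] _ s])
        (simp_all add: ap bimod_laws_group)
    show "a z (ract (tensor_u A X Y) s m) = a (lact Z m z) s"
      if [simp]: "z \<in> carrier Z" "m \<in> carrier A" and s: "s \<in> carrier (tensor_u A X Y)" for z m s
      by (rule tensor_u_eqI [OF _ _ _ hom_compose' [OF ract_hom ah] ah _ s])
        (simp_all add: ap tensor_u_balance)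
  qed (simp_all add: hom_closed [OF ah] hom_mult [OF ah])
  have al: "a z (lact (tensor_u A X Y) m s) = lact X_YZ m (a z s)"
    if [simp]: "z \<in> carrier Z" "m \<in> carrier A" and s: "s \<in> carrier (tensor_u A X Y)" for z m s
    by (rule tensor_u_eqI [OF _ _ _ hom_compose' [OF lact_hom ah] hom_compose' [OF ah lact_hom] _ s])
      (simp_all add: ap)
  have ar: "a (ract Z z m) s = ract X_YZ (a z s) m"
    if [simp]: "z \<in> carrier Z" "m \<in> carrier A" and s: "s \<in> carrier (tensor_u A X Y)" for z m s
    by (rule tensor_u_eqI [OF _ _ _ ah hom_compose' [OF ah ract_hom] _ s])
      (simp_all add: ap)
  let ?h = "lift XY_Z X_YZ (tensor_u A X Y) Z (pure_u A (tensor_u A X Y) Z) (\<lambda>s z. a z s)"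
  have "?h \<in> bimod_maps A XY_Z X_YZ"
    by (rule lift_bimod_maps [OF tensor_u_is_tensor _ _ ab]) (simp_all add: al ar)
  moreover have "?h (left_pure x y z) = right_pure x y z"
    if [simp]: "x \<in> carrier X" "y \<in> carrier Y" "z \<in> carrier Z" for x y z
    by (subst lift_pure [OF tensor_u_is_tensor _ ab]) (simp_all add: ap bimod_laws_group)
  ultimately show ?thesis by blast
qed

lemma assoc_inv_exists:
  "\<exists>h\<in>bimod_maps A X_YZ XY_Z. \<forall>x\<in>carrier X. \<forall>y\<in>carrier Y. \<forall>z\<in>carrier Z.
    h (right_pure x y z) = left_pure x y z"
proof -
  define a where "a x = lift (tensor_u A Y Z) XY_Z Y Z (pure_u A Y Z) (\<lambda>y z. left_pure x y z)" for x
  have b: "balanced (carrier A) Y Z XY_Z (\<lambda>y z. left_pure x y z)" if [simp]: "x \<in> carrier X" for x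
    \<comment> \<open>The action on \<open>y\<close> must be recognized as one on
      \<open>x \<otimes> y\<close> before it can cross to \<open>z\<close>: \<open>(x \<otimes> y m)
      \<otimes> z = (x \<otimes> y) m \<otimes> z = (x \<otimes> y) \<otimes> m z\<close>.\<close>
    by (rule balancedI) (simp_all add: tensor_u_balance flip: tensor_u_pure(5))
  have ah: "a x \<in> hom (tensor_u A Y Z) XY_Z" if [simp]: "x \<in> carrier X" for x
    unfolding a_def by (rule lift_hom [OF tensor_u_is_tensor _ b]) (simp_all add: bimod_laws_group)
  have ap: "a x (pure_u A Y Z y z) = left_pure x y z"
    if [simp]: "x \<in> carrier X" "y \<in> carrier Y" "z \<in> carrier Z" for x y z
    unfolding a_def by (rule lift_pure [OF tensor_u_is_tensor _ b]) (simp_all add: bimod_laws_group)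
  have ab: "balanced (carrier A) X (tensor_u A Y Z) XY_Z a"
  proof (rule balancedI)
    show "a (x \<otimes>\<^bsub>X\<^esub> x') s = a x s \<otimes>\<^bsub>XY_Z\<^esub> a x' s"
      if [simp]: "x \<in> carrier X" "x' \<in> carrier X" and s: "s \<in> carrier (tensor_u A Y Z)" for x x' s
      by (rule tensor_u_eqI [OF _ _ _ ah hom_mult_fun [OF _ ah ah] _ s])
        (simp_all add: ap bimod_laws_group)
    show "a (ract X x m) s = a x (lact (tensor_u A Y Z) m s)"
      if [simp]: "x \<in> carrier X" "m \<in> carrier A" and s: "s \<in> carrier (tensor_u A Y Z)" for x m s
      by (rule tensor_u_eqI [OF _ _ _ ah hom_compose' [OF lact_hom ah] _ s])
        (simp_all add: ap tensor_u_balance)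
  qed (simp_all add: hom_closed [OF ah] hom_mult [OF ah])
  have al: "a (lact X m x) s = lact XY_Z m (a x s)"
    if [simp]: "x \<in> carrier X" "m \<in> carrier A" and s: "s \<in> carrier (tensor_u A Y Z)" for x m s
    by (rule tensor_u_eqI [OF _ _ _ ah hom_compose' [OF ah lact_hom] _ s])
      (simp_all add: ap)
  have ar: "a x (ract (tensor_u A Y Z) s m) = ract XY_Z (a x s) m"
    if [simp]: "x \<in> carrier X" "m \<in> carrier A" and s: "s \<in> carrier (tensor_u A Y Z)" for x m s
    by (rule tensor_u_eqI [OF _ _ _ hom_compose' [OF ract_hom ah] hom_compose' [OF ah ract_hom] _ s])
      (simp_all add: ap)
  let ?h = "lift X_YZ XY_Z X (tensor_u A Y Z) (pure_u A X (tensor_u A Y Z)) a"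
  have "?h \<in> bimod_maps A X_YZ XY_Z"
    by (rule lift_bimod_maps [OF tensor_u_is_tensor _ _ ab]) (simp_all add: al ar)
  moreover have "?h (right_pure x y z) = left_pure x y z"
    if [simp]: "x \<in> carrier X" "y \<in> carrier Y" "z \<in> carrier Z" for x y z
    by (subst lift_pure [OF tensor_u_is_tensor _ ab]) (simp_all add: ap bimod_laws_group)
  ultimately show ?thesis by blast
qed

lemma Assoc_spec:
  "Assoc \<C> X Y Z \<in> hom XY_Z X_YZ \<inter> extensional (carrier XY_Z) \<and>
   (\<forall>i\<in>carrier X \<times> carrier Y \<times> carrier Z.
     Assoc \<C> X Y Z (case i of (x, y, z) \<Rightarrow> left_pure x y z) = (case i of (x, y, z) \<Rightarrow> right_pure x y z))"
proof -
  obtain h where h: "h \<in> bimod_maps A XY_Z X_YZ"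
    "\<And>x y z. \<lbrakk>x \<in> carrier X; y \<in> carrier Y; z \<in> carrier Z\<rbrakk> \<Longrightarrow> h (left_pure x y z) = right_pure x y z"
    using assoc_exists by blast
  have "Assoc \<C> X Y Z = hom_ext XY_Z X_YZ (carrier X \<times> carrier Y \<times> carrier Z)
      (\<lambda>(x, y, z). left_pure x y z) (\<lambda>(x, y, z). right_pure x y z)"
    by (simp add: bimod_moncat_def)
  moreover have "hom_ext XY_Z X_YZ (carrier X \<times> carrier Y \<times> carrier Z)
      (\<lambda>(x, y, z). left_pure x y z) (\<lambda>(x, y, z). right_pure x y z) \<in> hom XY_Z X_YZ \<inter> extensional (carrier XY_Z) \<and>
   (\<forall>i\<in>carrier X \<times> carrier Y \<times> carrier Z. hom_ext XY_Z X_YZ (carrier X \<times> carrier Y \<times> carrier Z)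
      (\<lambda>(x, y, z). left_pure x y z) (\<lambda>(x, y, z). right_pure x y z)
       (case i of (x, y, z) \<Rightarrow> left_pure x y z) = (case i of (x, y, z) \<Rightarrow> right_pure x y z))"
  proof (rule hom_ext_spec [OF bimod_mapsD(1) [OF h(1)]])
    show "g t = g' t" if "g \<in> hom XY_Z X_YZ" "g' \<in> hom XY_Z X_YZ" "t \<in> carrier XY_Z"
      "\<And>i. i \<in> carrier X \<times> carrier Y \<times> carrier Z \<Longrightarrow>
        g (case i of (x, y, z) \<Rightarrow> left_pure x y z) = g' (case i of (x, y, z) \<Rightarrow> left_pure x y z)" for g g' t
    proof (rule assoc_left_eqI [OF _ _ _ _ that(1,2) _ that(3)])
      show "g (left_pure x y z) = g' (left_pure x y z)"
        if "x \<in> carrier X" "y \<in> carrier Y" "z \<in> carrier Z" for x y z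
        using \<open>\<And>i. i \<in> carrier X \<times> carrier Y \<times> carrier Z \<Longrightarrow> _ i\<close> [of "(x, y, z)"] that by simp
    qed simp_all
  qed (use h(2) in \<open>auto simp: bimod_laws_is_group group.is_monoid\<close>)
  ultimately show ?thesis by simp
qed

lemma Assoc_pure:
  "\<lbrakk>x \<in> carrier X; y \<in> carrier Y; z \<in> carrier Z\<rbrakk> \<Longrightarrow> Assoc \<C> X Y Z (left_pure x y z) = right_pure x y z"
  using conjunct2 [OF Assoc_spec] by auto

text \<open>\<open>hom_ext\<close> yields only an additive map; determined by its values on triple
  tensors, it coincides with the bimodule map of \<open>assoc_exists\<close> and so inherits
  linearity.\<close>

lemma Assoc_maps: "Assoc \<C> X Y Z \<in> bimod_maps A XY_Z X_YZ"
proof -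
  obtain h where h: "h \<in> bimod_maps A XY_Z X_YZ"
    "\<And>x y z. \<lbrakk>x \<in> carrier X; y \<in> carrier Y; z \<in> carrier Z\<rbrakk> \<Longrightarrow> h (left_pure x y z) = right_pure x y z"
    using assoc_exists by blast
  have "Assoc \<C> X Y Z = h"
  proof (rule extensionalityI)
    show "Assoc \<C> X Y Z t = h t" if "t \<in> carrier XY_Z" for t
      by (rule assoc_left_eqI [OF _ _ _ _ _ bimod_mapsD(1) [OF h(1)] _ that])
        (use Assoc_spec in \<open>simp_all add: Assoc_pure h(2)\<close>)
  qed (use Assoc_spec bimod_mapsD(2) [OF h(1)] in auto)
  then show ?thesis using h(1) by simp
qed

lemma Assoc_inverse:
  defines "g \<equiv> inv_mor \<C> XY_Z X_YZ (Assoc \<C> X Y Z)"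
  shows Assoc_inv_maps: "g \<in> bimod_maps A X_YZ XY_Z"
    and Assoc_inv_pure: "\<lbrakk>x \<in> carrier X; y \<in> carrier Y; z \<in> carrier Z\<rbrakk> \<Longrightarrow>
      g (right_pure x y z) = left_pure x y z"
proof -
  obtain h where h: "h \<in> bimod_maps A X_YZ XY_Z"
    and hp: "\<And>x y z. \<lbrakk>x \<in> carrier X; y \<in> carrier Y; z \<in> carrier Z\<rbrakk> \<Longrightarrow> h (right_pure x y z) = left_pure x y z"
    using assoc_inv_exists by blast
  have "g = h"
    unfolding g_def
  proof (rule inv_mor_eq [OF Assoc_maps h])
    show "h (Assoc \<C> X Y Z t) = t" if t: "t \<in> carrier XY_Z" for t
      by (rule assoc_left_eqI [OF _ _ _ _ hom_compose' [OF bimod_mapsD(1) [OF Assoc_maps] bimod_mapsD(1) [OF h]] _ _ t])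
        (simp_all add: hp Assoc_pure hom_def)
    show "Assoc \<C> X Y Z (h t) = t" if t: "t \<in> carrier X_YZ" for t
      by (rule assoc_right_eqI [OF _ _ _ _ hom_compose' [OF bimod_mapsD(1) [OF h] bimod_mapsD(1) [OF Assoc_maps]] _ _ t])
        (simp_all add: hp Assoc_pure hom_def)
  qed
  then show "g \<in> bimod_maps A X_YZ XY_Z"
    "\<lbrakk>x \<in> carrier X; y \<in> carrier Y; z \<in> carrier Z\<rbrakk> \<Longrightarrow> g (right_pure x y z) = left_pure x y z"
    using h hp by auto
qed

end

section \<open>The unit object and the unit constraints\<close>

lemma unit_u_simps:
  shows "carrier (unit_u A :: ('a, 'a, 'u) bimod) = emb A ` carrier A"
    and "\<lbrakk>a \<in> carrier A; b \<in> carrier A\<rbrakk> \<Longrightarrow> emb A a \<otimes>\<^bsub>unit_u A\<^esub> emb A b = (emb A (a \<oplus>\<^bsub>A\<^esub> b) :: 'u)"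
    and "\<lbrakk>a \<in> carrier A; b \<in> carrier A\<rbrakk> \<Longrightarrow> lact (unit_u A) a (emb A b) = (emb A (a \<otimes>\<^bsub>A\<^esub> b) :: 'u)"
    and "\<lbrakk>a \<in> carrier A; b \<in> carrier A\<rbrakk> \<Longrightarrow> ract (unit_u A) (emb A a) b = (emb A (a \<otimes>\<^bsub>A\<^esub> b) :: 'u)"
  using transport_simps [of "emb A" "regular_bimod A"] emb_inj by (simp_all add: unit_u_def)

context
  fixes X :: "('a, 'a, 'u) bimod"
  assumes X [simp]: "bimod_laws X"
begin

abbreviation (input) "dec \<equiv> inv_into (carrier A) (emb A :: 'a \<Rightarrow> 'u)"

lemma dec_emb [simp]: "a \<in> carrier A \<Longrightarrow> dec (emb A a) = a"
  using emb_inj by (rule inv_into_f_f)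

lemma Lunit_eq:
  "Lunit \<C> X \<in> bimod_maps A (tensor_u A (unit_u A) X) X"
  "\<lbrakk>a \<in> carrier A; x \<in> carrier X\<rbrakk> \<Longrightarrow> Lunit \<C> X (pure_u A (unit_u A) X (emb A a) x) = lact X a x"
proof -
  let ?T = "tensor_u A (unit_u A) X"
  let ?f = "\<lambda>u x. lact X (dec u) x"
  have b: "balanced (carrier A) (unit_u A) X X ?f"
    by (rule balancedI) (auto simp: unit_u_simps)
  let ?h = "lift ?T X (unit_u A) X (pure_u A (unit_u A) X) ?f"
  have hp: "?h (pure_u A (unit_u A) X (emb A a) x) = lact X a x" if "a \<in> carrier A" "x \<in> carrier X" for a x
    by (subst lift_pure [OF tensor_u_is_tensor _ b]) (use that in \<open>auto simp: unit_u_simps bimod_laws_group\<close>)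
  have hm: "?h \<in> bimod_maps A ?T X"
    by (rule lift_bimod_maps [OF tensor_u_is_tensor _ _ b]) (auto simp: unit_u_simps)
  have s: "Lunit \<C> X \<in> hom ?T X \<inter> extensional (carrier ?T) \<and>
    (\<forall>i\<in>carrier A \<times> carrier X. Lunit \<C> X (case i of (a, x) \<Rightarrow> pure_u A (unit_u A) X (emb A a) x)
      = (case i of (a, x) \<Rightarrow> lact X a x))"
    unfolding bimod_moncat_def moncat.select_convs
  proof (rule hom_ext_spec [OF bimod_mapsD(1) [OF hm]])
    show "g t = g' t" if "g \<in> hom ?T X" "g' \<in> hom ?T X" "t \<in> carrier ?T"
      "\<And>i. i \<in> carrier A \<times> carrier X \<Longrightarrow> g (case i of (a, x) \<Rightarrow> pure_u A (unit_u A) X (emb A a) x)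
        = g' (case i of (a, x) \<Rightarrow> pure_u A (unit_u A) X (emb A a) x)" for g g' t
      by (rule tensor_u_eqI [OF _ _ _ that(1,2) _ that(3)]) (use that(4) in \<open>auto simp: unit_u_simps\<close>)
  qed (use hp in \<open>auto simp: bimod_laws_is_group group.is_monoid unit_u_simps\<close>)
  then show p: "Lunit \<C> X (pure_u A (unit_u A) X (emb A a) x) = lact X a x"
    if "a \<in> carrier A" "x \<in> carrier X" for a x
    using that by auto
  have "Lunit \<C> X = ?h"
  proof (rule extensionalityI)
    show "Lunit \<C> X t = ?h t" if "t \<in> carrier ?T" for t
      by (rule tensor_u_eqI [OF _ _ _ _ bimod_mapsD(1) [OF hm] _ that])
        (use s hp p in \<open>auto simp: unit_u_simps\<close>)
  qed (use s bimod_mapsD(2) [OF hm] in auto)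
  then show "Lunit \<C> X \<in> bimod_maps A ?T X" using hm by simp
qed

lemma Runit_eq:
  "Runit \<C> X \<in> bimod_maps A (tensor_u A X (unit_u A)) X"
  "\<lbrakk>a \<in> carrier A; x \<in> carrier X\<rbrakk> \<Longrightarrow> Runit \<C> X (pure_u A X (unit_u A) x (emb A a)) = ract X x a"
proof -
  let ?T = "tensor_u A X (unit_u A)"
  let ?f = "\<lambda>x u. ract X x (dec u)"
  have b: "balanced (carrier A) X (unit_u A) X ?f"
    by (rule balancedI) (auto simp: unit_u_simps)
  let ?h = "lift ?T X X (unit_u A) (pure_u A X (unit_u A)) ?f"
  have hp: "?h (pure_u A X (unit_u A) x (emb A a)) = ract X x a" if "a \<in> carrier A" "x \<in> carrier X" for a x
    by (subst lift_pure [OF tensor_u_is_tensor _ b]) (use that in \<open>auto simp: unit_u_simps bimod_laws_group\<close>)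
  have hm: "?h \<in> bimod_maps A ?T X"
    by (rule lift_bimod_maps [OF tensor_u_is_tensor _ _ b]) (auto simp: unit_u_simps)
  have s: "Runit \<C> X \<in> hom ?T X \<inter> extensional (carrier ?T) \<and>
    (\<forall>i\<in>carrier X \<times> carrier A. Runit \<C> X (case i of (x, a) \<Rightarrow> pure_u A X (unit_u A) x (emb A a))
      = (case i of (x, a) \<Rightarrow> ract X x a))"
    unfolding bimod_moncat_def moncat.select_convs
  proof (rule hom_ext_spec [OF bimod_mapsD(1) [OF hm]])
    show "g t = g' t" if "g \<in> hom ?T X" "g' \<in> hom ?T X" "t \<in> carrier ?T"
      "\<And>i. i \<in> carrier X \<times> carrier A \<Longrightarrow> g (case i of (x, a) \<Rightarrow> pure_u A X (unit_u A) x (emb A a))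
        = g' (case i of (x, a) \<Rightarrow> pure_u A X (unit_u A) x (emb A a))" for g g' t
      by (rule tensor_u_eqI [OF _ _ _ that(1,2) _ that(3)]) (use that(4) in \<open>auto simp: unit_u_simps\<close>)
  qed (use hp in \<open>auto simp: bimod_laws_is_group group.is_monoid unit_u_simps\<close>)
  then show p: "Runit \<C> X (pure_u A X (unit_u A) x (emb A a)) = ract X x a"
    if "a \<in> carrier A" "x \<in> carrier X" for a x
    using that by auto
  have "Runit \<C> X = ?h"
  proof (rule extensionalityI)
    show "Runit \<C> X t = ?h t" if "t \<in> carrier ?T" for t
      by (rule tensor_u_eqI [OF _ _ _ _ bimod_mapsD(1) [OF hm] _ that])
        (use s hp p in \<open>auto simp: unit_u_simps\<close>)
  qed (use s bimod_mapsD(2) [OF hm] in auto)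
  then show "Runit \<C> X \<in> bimod_maps A ?T X" using hm by simp
qed

lemma Runit_inverse:
  defines "g \<equiv> inv_mor \<C> (tensor_u A X (unit_u A)) X (Runit \<C> X)"
  shows Runit_inv_maps: "g \<in> bimod_maps A X (tensor_u A X (unit_u A))"
    and Runit_inv_right: "x \<in> carrier X \<Longrightarrow> Runit \<C> X (g x) = x"
    and Runit_inv_left: "t \<in> carrier (tensor_u A X (unit_u A)) \<Longrightarrow> g (Runit \<C> X t) = t"
proof -
  let ?T = "tensor_u A X (unit_u A)"
  let ?h = "\<lambda>x\<in>carrier X. pure_u A X (unit_u A) x (emb A \<one>\<^bsub>A\<^esub>)"
  have [simp]: "(emb A \<one>\<^bsub>A\<^esub> :: 'u) \<in> carrier (unit_u A)" by (simp add: unit_u_simps)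
  \<comment> \<open>The identity \<open>x a \<otimes> 1 = x \<otimes> a\<close> shows both that
    \<open>x \<mapsto> x \<otimes> 1\<close> is right linear and that it inverts
    \<open>x \<otimes> a \<mapsto> x a\<close>.\<close>
  have b: "pure_u A X (unit_u A) (ract X x a) (emb A \<one>\<^bsub>A\<^esub>) = pure_u A X (unit_u A) x (emb A a)"
    if "x \<in> carrier X" "a \<in> carrier A" for x a
    using that by (simp add: tensor_u_balance unit_u_simps)
  have h: "?h \<in> bimod_maps A X ?T"
    unfolding bimod_maps_def by (auto simp: hom_def b unit_u_simps)
  have l: "?h (Runit \<C> X t) = t" if "t \<in> carrier ?T" for t
    by (rule tensor_u_eqI [OF _ _ _ hom_compose' [OF bimod_mapsD(1) [OF Runit_eq(1)] bimod_mapsD(1) [OF h]] _ _ that])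
      (auto simp: unit_u_simps Runit_eq(2) b hom_def)
  have r: "Runit \<C> X (?h x) = x" if "x \<in> carrier X" for x
    using that by (simp add: Runit_eq(2))
  have "g = ?h"
    unfolding g_def by (rule inv_mor_eq [OF Runit_eq(1) h l r])
  then show "g \<in> bimod_maps A X ?T" "x \<in> carrier X \<Longrightarrow> Runit \<C> X (g x) = x"
    "t \<in> carrier ?T \<Longrightarrow> g (Runit \<C> X t) = t"
    using h l r by auto
qed

end

end

text \<open>Both functors are the identity on morphisms, so it suffices to match objects and to see
  that hom sets, identities and composition agree. The category axioms for \<open>C\<close> are then
  those of \<open>D\<close> along \<open>F\<close>.\<close>

lemma isomorphic_categoriesI:
  assumes D: "category D"
    and F: "\<And>X. X \<in> Obj C \<Longrightarrow> F X \<in> Obj D" and G: "\<And>Y. Y \<in> Obj D \<Longrightarrow> G Y \<in> Obj C"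
    and GF: "\<And>X. X \<in> Obj C \<Longrightarrow> G (F X) = X" and FG: "\<And>Y. Y \<in> Obj D \<Longrightarrow> F (G Y) = Y"
    and Mor: "\<And>X Y. \<lbrakk>X \<in> Obj C; Y \<in> Obj C\<rbrakk> \<Longrightarrow> Mor C X Y = Mor D (F X) (F Y)"
    and Idn: "\<And>X. X \<in> Obj C \<Longrightarrow> Idn C X = Idn D (F X)"
    and Cmp: "\<And>X Y Z. \<lbrakk>X \<in> Obj C; Y \<in> Obj C; Z \<in> Obj C\<rbrakk> \<Longrightarrow> Cmp C X Y Z = Cmp D (F X) (F Y) (F Z)"
  shows "isomorphic_categories C D"
proof -
  have "category C"
    using D F unfolding category_def by (simp add: Mor Idn Cmp)
  moreover have "cat_functor C D F (\<lambda>_ _ f. f)"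
    unfolding cat_functor_def by (simp add: F Mor Idn Cmp)
  moreover have "cat_functor D C G (\<lambda>_ _ f. f)"
    unfolding cat_functor_def by (simp add: G FG Mor Idn Cmp)
  ultimately show ?thesis
    unfolding isomorphic_categories_def using D GF FG by blast
qed

section \<open>The category of Yetter-Drinfeld modules\<close>

context k_algebra
begin

text \<open>Together with \<open>mapA_compose\<close>, functoriality of
  \<open>V \<mapsto> V \<otimes>\<^sub>k A\<close>; it makes identities and composites compatible
  with coactions.\<close>

lemma mapA_id:
  assumes V [simp]: "bimod_laws V" and t: "t \<in> carrier (tenA k A V)"
  shows "mapA k A V V (\<lambda>x\<in>carrier V. x) (\<lambda>b. b) t = t"
proof -
  have kl: "kone_linear V V (\<lambda>x\<in>carrier V. x)"
    by (rule kone_linear_bimod_maps [OF bimod_maps_id [OF V]])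
  show ?thesis
    by (rule tenA_eq_mapI [OF V _ mapA_hom [OF V V kl] _ _ t])
      (simp_all add: mapA_pure [OF V V kl] kone_linear_id hom_def)
qed

lemma mapA_compose:
  assumes [simp]: "bimod_laws U" "bimod_laws V" "bimod_laws W"
    and f: "f \<in> bimod_maps A U V" and g: "g \<in> bimod_maps A V W"
    and t: "t \<in> carrier (tenA k A U)"
  shows "mapA k A U W (compose (carrier U) g f) (\<lambda>b. b) t
    = mapA k A V W g (\<lambda>b. b) (mapA k A U V f (\<lambda>b. b) t)"
  by (rule tenA_eq_mapI [OF _ _ mapA_hom hom_compose' [OF mapA_hom mapA_hom] _ t])
    (use bimod_maps_compose [OF _ f g] bimod_mapsD(3) [OF f] f g in
      \<open>simp_all add: mapA_pure kone_linear_id kone_linear_bimod_maps compose_eq\<close>)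

lemma yd_coactionD:
  assumes "yd_coaction k A V \<rho>" "v \<in> carrier V"
  shows "\<rho> v \<in> carrier (tenA k A V)"
  using assms by (auto simp: yd_coaction_def hom_def)

lemma category_yd_cat: "category (yd_cat k A :: (('c, 'c, 'u) bimod \<times> ('u \<Rightarrow> ('u \<times> 'c \<Rightarrow>\<^sub>0 int) set), 'u \<Rightarrow> 'u) cat)"
proof -
  have laws: "bimodule k A V \<Longrightarrow> bimod_laws V" for V
    by (simp add: bimodule_iff)
  have "compose (carrier V) f (\<lambda>x\<in>carrier V. x) = f" "compose (carrier V) (\<lambda>x\<in>carrier W. x) f = f"
    if f: "f \<in> bimod_maps A V W" for V W :: "('c, 'c, 'u) bimod" and f
    by (rule extensionalityI [OF _ bimod_mapsD(2) [OF f]], simp_all add: compose_eq bimod_mapsD(3) [OF f])+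
  moreover have "compose (carrier U) (compose (carrier V) h g) f = compose (carrier U) h (compose (carrier U) g f)"
    if "f \<in> bimod_maps A U V" for U V :: "('c, 'c, 'u) bimod" and f g and h :: "'u \<Rightarrow> 'u"
    by (rule compose_assoc [symmetric]) (auto simp: bimod_mapsD(3) [OF that])
  ultimately show ?thesis
    unfolding category_def yd_cat_def
    by (auto simp: laws bimod_maps_id mapA_id yd_coactionD bimod_maps_compose mapA_compose [symmetric]
        compose_eq bimod_mapsD(3))
qed

end

context bimod_universe
begin

subsection \<open>Half braidings on elements\<close>

abbreviation hexagon_rhs ::
  "('a, 'a, 'u) bimod \<Rightarrow> (('a, 'a, 'u) bimod \<Rightarrow> 'u \<Rightarrow> 'u) \<Rightarrow>
   ('a, 'a, 'u) bimod \<Rightarrow> ('a, 'a, 'u) bimod \<Rightarrow> 'u \<Rightarrow> 'u" where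
  "hexagon_rhs V c X Y t \<equiv>
    Assoc \<C> V X Y (TMor \<C> (tensor_u A X V) (tensor_u A V X) Y Y (c X) (\<lambda>x\<in>carrier Y. x)
      (inv_mor \<C> (tensor_u A (tensor_u A X V) Y) (tensor_u A X (tensor_u A V Y)) (Assoc \<C> X V Y)
        (TMor \<C> X X (tensor_u A Y V) (tensor_u A V Y) (\<lambda>x\<in>carrier X. x) (c Y)
          (Assoc \<C> X Y V t))))"

definition braiding_maps :: "('a, 'a, 'u) bimod \<Rightarrow> (('a, 'a, 'u) bimod \<Rightarrow> 'u \<Rightarrow> 'u) set" where
  "braiding_maps V = (\<Pi>\<^sub>E X\<in>{X. bimodule k A X}. bimod_maps A (tensor_u A X V) (tensor_u A V X))"

lemma braiding_mapsD:
  "c \<in> braiding_maps V \<Longrightarrow> bimodule k A X \<Longrightarrow> c X \<in> bimod_maps A (tensor_u A X V) (tensor_u A V X)"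
  by (auto simp: braiding_maps_def PiE_iff)

lemma hexagon_rhs_maps:
  assumes V: "bimodule k A V" and c: "c \<in> braiding_maps V" and X: "bimodule k A X" and Y: "bimodule k A Y"
  shows "(\<lambda>t\<in>carrier (tensor_u A (tensor_u A X Y) V). hexagon_rhs V c X Y t)
    \<in> bimod_maps A (tensor_u A (tensor_u A X Y) V) (tensor_u A V (tensor_u A X Y))"
proof -
  note [simp] = V [THEN bimodule_laws] X [THEN bimodule_laws] Y [THEN bimodule_laws]
  note [simp] = braiding_mapsD [OF c X] braiding_mapsD [OF c Y]
  have "compose (carrier (tensor_u A (tensor_u A X Y) V)) (Assoc \<C> V X Y)
    (compose (carrier (tensor_u A (tensor_u A X Y) V))
      (TMor \<C> (tensor_u A X V) (tensor_u A V X) Y Y (c X) (\<lambda>x\<in>carrier Y. x))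
      (compose (carrier (tensor_u A (tensor_u A X Y) V))
        (inv_mor \<C> (tensor_u A (tensor_u A X V) Y) (tensor_u A X (tensor_u A V Y)) (Assoc \<C> X V Y))
        (compose (carrier (tensor_u A (tensor_u A X Y) V))
          (TMor \<C> X X (tensor_u A Y V) (tensor_u A V Y) (\<lambda>x\<in>carrier X. x) (c Y)) (Assoc \<C> X Y V))))
    \<in> bimod_maps A (tensor_u A (tensor_u A X Y) V) (tensor_u A V (tensor_u A X Y))"
    by (intro bimod_maps_compose [where V = "tensor_u A (tensor_u A V X) Y"]
        bimod_maps_compose [where V = "tensor_u A (tensor_u A X V) Y"]
        bimod_maps_compose [where V = "tensor_u A X (tensor_u A V Y)"]
        bimod_maps_compose [where V = "tensor_u A X (tensor_u A Y V)"]
        Assoc_maps TMor_maps Assoc_inv_maps bimod_maps_id) simp_all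
  then show ?thesis
    by (simp add: compose_def cong: restrict_cong)
qed

text \<open>Morphisms out of a tensor product agree as soon as they agree on pure tensors, iterated
  ones in the case of the hexagon. Each condition thus becomes an equation between elements, without
  \<open>compose\<close> and its restrictions.\<close>

lemma half_braiding_iff:
  assumes V: "bimodule k A V"
  shows "half_braiding \<C> V c \<longleftrightarrow> c \<in> braiding_maps V \<and>
    (\<forall>X Y f x v. bimodule k A X \<longrightarrow> bimodule k A Y \<longrightarrow> f \<in> bimod_maps A X Y \<longrightarrow>
       x \<in> carrier X \<longrightarrow> v \<in> carrier V \<longrightarrow>
       c Y (pure_u A Y V (f x) v) = TMor \<C> V V X Y (\<lambda>x\<in>carrier V. x) f (c X (pure_u A X V x v))) \<and>
    (\<forall>a\<in>carrier A. \<forall>v\<in>carrier V.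
       Runit \<C> V (c (unit_u A) (pure_u A (unit_u A) V (emb A a) v)) = lact V a v) \<and>
    (\<forall>X Y x y v. bimodule k A X \<longrightarrow> bimodule k A Y \<longrightarrow> x \<in> carrier X \<longrightarrow> y \<in> carrier Y \<longrightarrow>
       v \<in> carrier V \<longrightarrow>
       c (tensor_u A X Y) (pure_u A (tensor_u A X Y) V (pure_u A X Y x y) v) =
       hexagon_rhs V c X Y (pure_u A (tensor_u A X Y) V (pure_u A X Y x y) v))"
proof (cases "c \<in> braiding_maps V")
  case c: True
  note [simp] = V [THEN bimodule_laws] bimodule_laws
  note cX = braiding_mapsD [OF c]
  have nat: "compose (carrier (tensor_u A X V)) (c Y) (TMor \<C> X Y V V f (\<lambda>x\<in>carrier V. x)) =
      compose (carrier (tensor_u A X V)) (TMor \<C> V V X Y (\<lambda>x\<in>carrier V. x) f) (c X) \<longleftrightarrow>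
      (\<forall>x\<in>carrier X. \<forall>v\<in>carrier V.
       c Y (pure_u A Y V (f x) v) = TMor \<C> V V X Y (\<lambda>x\<in>carrier V. x) f (c X (pure_u A X V x v)))"
    if X [simp]: "bimodule k A X" and Y [simp]: "bimodule k A Y" and f [simp]: "f \<in> bimod_maps A X Y" for X Y f
    by (subst tensor_u_maps_eq_iff [where H = "tensor_u A V Y"])
      (auto intro!: bimod_maps_compose [OF _ TMor_maps cX] bimod_maps_compose [OF _ cX TMor_maps] bimod_maps_id
        simp: compose_eq TMor_pure bimod_maps_id)
  have unit: "c (unit_u A) = compose (carrier (tensor_u A (unit_u A) V))
        (inv_mor \<C> (tensor_u A V (unit_u A)) V (Runit \<C> V)) (Lunit \<C> V) \<longleftrightarrow>
      (\<forall>a\<in>carrier A. \<forall>v\<in>carrier V.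
       Runit \<C> V (c (unit_u A) (pure_u A (unit_u A) V (emb A a) v)) = lact V a v)"
  proof -
    have "c (unit_u A) = compose (carrier (tensor_u A (unit_u A) V))
        (inv_mor \<C> (tensor_u A V (unit_u A)) V (Runit \<C> V)) (Lunit \<C> V) \<longleftrightarrow>
      (\<forall>u\<in>carrier (unit_u A). \<forall>v\<in>carrier V. c (unit_u A) (pure_u A (unit_u A) V u v) =
        inv_mor \<C> (tensor_u A V (unit_u A)) V (Runit \<C> V) (Lunit \<C> V (pure_u A (unit_u A) V u v)))"
      by (subst tensor_u_maps_eq_iff [where H = "tensor_u A V (unit_u A)"])
        (auto intro!: bimod_maps_compose [OF _ Lunit_eq(1) Runit_inv_maps] cX unit_u_bimodule simp: compose_eq)
    also have "\<dots> \<longleftrightarrow> (\<forall>a\<in>carrier A. \<forall>v\<in>carrier V. c (unit_u A) (pure_u A (unit_u A) V (emb A a) v) =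
        inv_mor \<C> (tensor_u A V (unit_u A)) V (Runit \<C> V) (lact V a v))"
      by (simp add: unit_u_simps Lunit_eq(2))
    \<comment> \<open>\<open>Runit\<close> is bijective, so its inverse can be moved to the other
      side of the equation.\<close>
    also have "\<dots> \<longleftrightarrow> (\<forall>a\<in>carrier A. \<forall>v\<in>carrier V.
       Runit \<C> V (c (unit_u A) (pure_u A (unit_u A) V (emb A a) v)) = lact V a v)"
    proof -
      have "c (unit_u A) (pure_u A (unit_u A) V (emb A a) v) \<in> carrier (tensor_u A V (unit_u A))"
        if "a \<in> carrier A" "v \<in> carrier V" for a v
        by (rule bimod_mapsD(3) [OF cX [OF unit_u_bimodule]]) (use that in \<open>simp add: unit_u_simps\<close>)
      then show ?thesis
        by (metis Runit_inv_left Runit_inv_right V bimod_laws_simps(1) bimodule_laws)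
    qed
    finally show ?thesis .
  qed
  have hex: "c (tensor_u A X Y) = compose (carrier (tensor_u A (tensor_u A X Y) V)) (Assoc \<C> V X Y)
    (compose (carrier (tensor_u A (tensor_u A X Y) V))
      (TMor \<C> (tensor_u A X V) (tensor_u A V X) Y Y (c X) (\<lambda>x\<in>carrier Y. x))
      (compose (carrier (tensor_u A (tensor_u A X Y) V))
        (inv_mor \<C> (tensor_u A (tensor_u A X V) Y) (tensor_u A X (tensor_u A V Y)) (Assoc \<C> X V Y))
        (compose (carrier (tensor_u A (tensor_u A X Y) V))
          (TMor \<C> X X (tensor_u A Y V) (tensor_u A V Y) (\<lambda>x\<in>carrier X. x) (c Y)) (Assoc \<C> X Y V)))) \<longleftrightarrow>
     (\<forall>x\<in>carrier X. \<forall>y\<in>carrier Y. \<forall>v\<in>carrier V.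
       c (tensor_u A X Y) (pure_u A (tensor_u A X Y) V (pure_u A X Y x y) v) =
       hexagon_rhs V c X Y (pure_u A (tensor_u A X Y) V (pure_u A X Y x y) v))"
    (is "?l = ?r \<longleftrightarrow> ?P")
    if X [simp]: "bimodule k A X" and Y [simp]: "bimodule k A Y" for X Y
  proof -
    let ?T = "tensor_u A (tensor_u A X Y) V"
    let ?h = "\<lambda>t\<in>carrier ?T. hexagon_rhs V c X Y t"
    have r: "?r = ?h"
      by (simp add: compose_def cong: restrict_cong)
    note l = cX [OF tensor_u_bimodule [OF X [THEN bimodule_laws] Y [THEN bimodule_laws]]]
    note h = hexagon_rhs_maps [OF V c X Y]
    have "?l = ?h" if ?P
    proof (rule bimod_maps_eqI [OF l h])
      show "?l t = ?h t" if "t \<in> carrier ?T" for t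
        by (rule assoc_left_eqI [OF _ _ _ _ bimod_mapsD(1) [OF l] bimod_mapsD(1) [OF h] _ that])
          (use \<open>?P\<close> in simp_all)
    qed
    moreover have ?P if "?l = ?h"
      unfolding that by simp
    ultimately show ?thesis unfolding r by blast
  qed
  have "(\<forall>X\<in>{X. bimodule k A X}. \<forall>Y\<in>{Y. bimodule k A Y}. \<forall>f\<in>bimod_maps A X Y.
      compose (carrier (tensor_u A X V)) (c Y) (TMor \<C> X Y V V f (\<lambda>x\<in>carrier V. x)) =
      compose (carrier (tensor_u A X V)) (TMor \<C> V V X Y (\<lambda>x\<in>carrier V. x) f) (c X)) \<longleftrightarrow>
    (\<forall>X Y f x v. bimodule k A X \<longrightarrow> bimodule k A Y \<longrightarrow> f \<in> bimod_maps A X Y \<longrightarrow>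
       x \<in> carrier X \<longrightarrow> v \<in> carrier V \<longrightarrow>
       c Y (pure_u A Y V (f x) v) = TMor \<C> V V X Y (\<lambda>x\<in>carrier V. x) f (c X (pure_u A X V x v)))"
    using nat by blast
  moreover have "(\<forall>X\<in>{X. bimodule k A X}. \<forall>Y\<in>{Y. bimodule k A Y}.
      c (tensor_u A X Y) = compose (carrier (tensor_u A (tensor_u A X Y) V)) (Assoc \<C> V X Y)
    (compose (carrier (tensor_u A (tensor_u A X Y) V))
      (TMor \<C> (tensor_u A X V) (tensor_u A V X) Y Y (c X) (\<lambda>x\<in>carrier Y. x))
      (compose (carrier (tensor_u A (tensor_u A X Y) V))
        (inv_mor \<C> (tensor_u A (tensor_u A X V) Y) (tensor_u A X (tensor_u A V Y)) (Assoc \<C> X V Y))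
        (compose (carrier (tensor_u A (tensor_u A X Y) V))
          (TMor \<C> X X (tensor_u A Y V) (tensor_u A V Y) (\<lambda>x\<in>carrier X. x) (c Y)) (Assoc \<C> X Y V))))) \<longleftrightarrow>
    (\<forall>X Y x y v. bimodule k A X \<longrightarrow> bimodule k A Y \<longrightarrow> x \<in> carrier X \<longrightarrow> y \<in> carrier Y \<longrightarrow>
       v \<in> carrier V \<longrightarrow>
       c (tensor_u A X Y) (pure_u A (tensor_u A X Y) V (pure_u A X Y x y) v) =
       hexagon_rhs V c X Y (pure_u A (tensor_u A X Y) V (pure_u A X Y x y) v))"
    using hex by blast
  ultimately show ?thesis
    using c unfolding half_braiding_def Let_def moncat_simps braiding_maps_def
    by (simp only: unit simp_thms)
qed (simp add: half_braiding_def braiding_maps_def)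

end

context bimod_universe
begin

subsection \<open>The correspondence between half braidings and coactions\<close>

text \<open>A relation rather than a function, so that the axioms can be compared for any such pair,
  whichever of the two was given. Neither the hexagon nor coassociativity is built in.\<close>

definition corresponds ::
  "('a, 'a, 'u) bimod \<Rightarrow> (('a, 'a, 'u) bimod \<Rightarrow> 'u \<Rightarrow> 'u) \<Rightarrow> ('u \<Rightarrow> ('u \<times> 'a \<Rightarrow>\<^sub>0 int) set) \<Rightarrow> bool" where
  "corresponds V c \<rho> \<longleftrightarrow> c \<in> braiding_maps V \<and> \<rho> \<in> hom V (tenA k A V) \<and> \<rho> \<in> extensional (carrier V) \<and>
    (\<forall>X x v. bimodule k A X \<longrightarrow> x \<in> carrier X \<longrightarrow> v \<in> carrier V \<longrightarrow>
      c X (pure_u A X V x v) = act V X x (\<rho> v))"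

lemma correspondsD:
  assumes "corresponds V c \<rho>"
  shows "c \<in> braiding_maps V" "\<rho> \<in> hom V (tenA k A V)" "\<rho> \<in> extensional (carrier V)"
    and "v \<in> carrier V \<Longrightarrow> \<rho> v \<in> carrier (tenA k A V)"
    and "bimodule k A X \<Longrightarrow> c X \<in> bimod_maps A (tensor_u A X V) (tensor_u A V X)"
    and "\<lbrakk>bimodule k A X; x \<in> carrier X; v \<in> carrier V\<rbrakk> \<Longrightarrow> c X (pure_u A X V x v) = act V X x (\<rho> v)"
proof -
  show *: "c \<in> braiding_maps V" "\<rho> \<in> hom V (tenA k A V)" "\<rho> \<in> extensional (carrier V)"
    using assms unfolding corresponds_def by blast+
  show "v \<in> carrier V \<Longrightarrow> \<rho> v \<in> carrier (tenA k A V)"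
    using *(2) by (rule hom_closed)
  show "bimodule k A X \<Longrightarrow> c X \<in> bimod_maps A (tensor_u A X V) (tensor_u A V X)"
    using *(1) by (rule braiding_mapsD)
  show "\<lbrakk>bimodule k A X; x \<in> carrier X; v \<in> carrier V\<rbrakk> \<Longrightarrow> c X (pure_u A X V x v) = act V X x (\<rho> v)"
    using assms unfolding corresponds_def by simp
qed

definition to_coaction :: "('a, 'a, 'u) bimod \<Rightarrow> (('a, 'a, 'u) bimod \<Rightarrow> 'u \<Rightarrow> 'u) \<Rightarrow> 'u \<Rightarrow> ('u \<times> 'a \<Rightarrow>\<^sub>0 int) set" where
  "to_coaction V c = (\<lambda>v\<in>carrier V. theta V (c free_bimod (pure_u A free_bimod V free_gen v)))"

definition to_braiding :: "('a, 'a, 'u) bimod \<Rightarrow> ('u \<Rightarrow> ('u \<times> 'a \<Rightarrow>\<^sub>0 int) set) \<Rightarrow> ('a, 'a, 'u) bimod \<Rightarrow> 'u \<Rightarrow> 'u" where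
  "to_braiding V \<rho> = (\<lambda>X\<in>{X. bimodule k A X}.
    lift (tensor_u A X V) (tensor_u A V X) X V (pure_u A X V) (\<lambda>x v. act V X x (\<rho> v)))"

lemma corresponds_unique:
  assumes V: "bimodule k A V" and c: "corresponds V c \<rho>"
  shows to_coaction_eq: "to_coaction V c = \<rho>" and to_braiding_eq: "to_braiding V \<rho> = c"
proof -
  note [simp] = bimodule_laws V free_bimodule
  have "\<rho> v \<in> carrier (tenA k A V)" if "v \<in> carrier V" for v
    using correspondsD(4) [OF c] that by simp
  then show "to_coaction V c = \<rho>"
    by (intro extensionalityI [of _ "carrier V"])
      (simp_all add: to_coaction_def theta_act correspondsD [OF c])
  show "to_braiding V \<rho> = c"
  proof (rule extensionalityI)
    show "to_braiding V \<rho> \<in> extensional {X. bimodule k A X}"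
      by (simp add: to_braiding_def)
    show "c \<in> extensional {X. bimodule k A X}"
      using correspondsD(1) [OF c] by (auto simp: braiding_maps_def PiE_def)
    fix X :: "('a, 'a, 'u) bimod" assume "X \<in> {X. bimodule k A X}"
    then have X [simp]: "bimodule k A X" by simp
    have cX: "c X \<in> bimod_maps A (tensor_u A X V) (tensor_u A V X)"
      by (rule correspondsD(5) [OF c X])
    have cp: "act V X x (\<rho> v) = c X (pure_u A X V x v)" if "x \<in> carrier X" "v \<in> carrier V" for x v
      using that by (simp add: correspondsD(6) [OF c])
    \<comment> \<open>Balancedness and linearity of these values are inherited from the bimodule map
      \<open>c X\<close>, which takes them on pure tensors.\<close>
    have b: "balanced (carrier A) X V (tensor_u A V X) (\<lambda>x v. act V X x (\<rho> v))"
      by (rule balancedI)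
        (simp_all add: cp bimod_mapsD [OF cX] tensor_u_balance)
    have l: "to_braiding V \<rho> X = lift (tensor_u A X V) (tensor_u A V X) X V (pure_u A X V) (\<lambda>x v. act V X x (\<rho> v))"
      by (simp add: to_braiding_def)
    have lm: "to_braiding V \<rho> X \<in> bimod_maps A (tensor_u A X V) (tensor_u A V X)"
      unfolding l by (rule lift_bimod_maps [OF tensor_u_is_tensor _ _ b])
        (simp_all add: cp bimod_mapsD [OF cX] flip: tensor_u_pure(4,5))
    show "to_braiding V \<rho> X = c X"
    proof (subst tensor_u_maps_eq_iff [OF _ _ _ lm cX]; (intro ballI)?)
      fix x v assume xv: "x \<in> carrier X" "v \<in> carrier V"
      then show "to_braiding V \<rho> X (pure_u A X V x v) = c X (pure_u A X V x v)"
        unfolding l by (subst lift_pure [OF tensor_u_is_tensor _ b]) (simp_all add: cp bimod_laws_group)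
    qed simp_all
  qed
qed

text \<open>The part of the coaction axioms that makes
  \<open>x \<otimes> v \<mapsto> act V X x (\<rho> v)\<close> a well-defined bimodule map.\<close>

definition coaction_rules :: "('a, 'a, 'u) bimod \<Rightarrow> ('u \<Rightarrow> ('u \<times> 'a \<Rightarrow>\<^sub>0 int) set) \<Rightarrow> bool" where
  "coaction_rules V \<rho> \<longleftrightarrow> (\<forall>v\<in>carrier V. \<forall>a\<in>carrier A.
    \<rho> (ract V v a) = ract (tenA k A V) (\<rho> v) a \<and>
    \<rho> (lact V a v) = mid_left V a (\<rho> v) \<and>
    lact (tenA k A V) a (\<rho> v) = mid_right V a (\<rho> v))"

text \<open>The rule for \<open>\<rho> (a v)\<close> gives balancedness and the one for
  \<open>\<rho> (v a)\<close> right linearity. Left linearity is \<open>v\<^sub>0 \<otimes> a x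
  v\<^sub>1 = v\<^sub>0 a \<otimes> x v\<^sub>1 = a v\<^sub>0 \<otimes> x v\<^sub>1\<close>.\<close>

lemma corresponds_to_braiding:
  assumes V: "bimodule k A V" and \<rho>: "\<rho> \<in> hom V (tenA k A V)" "\<rho> \<in> extensional (carrier V)"
    and r: "coaction_rules V \<rho>"
  shows "corresponds V (to_braiding V \<rho>) \<rho>"
proof -
  note [simp] = bimodule_laws V
  have rc [simp]: "\<rho> v \<in> carrier (tenA k A V)" if "v \<in> carrier V" for v
    using \<rho> that by (auto simp: hom_def)
  have r': "\<rho> (ract V v a) = ract (tenA k A V) (\<rho> v) a" "\<rho> (lact V a v) = mid_left V a (\<rho> v)"
    "lact (tenA k A V) a (\<rho> v) = mid_right V a (\<rho> v)" if "v \<in> carrier V" "a \<in> carrier A" for v a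
    using r that by (auto simp: coaction_rules_def)
  have b: "balanced (carrier A) X V (tensor_u A V X) (\<lambda>x v. act V X x (\<rho> v))"
    if [simp]: "bimodule k A X" for X
    by (rule balancedI)
      (simp_all add: act_closed act_add hom_mult [OF \<rho>(1)] hom_mult [OF act_hom] act_of_ract r'(2))
  let ?l = "\<lambda>X. lift (tensor_u A X V) (tensor_u A V X) X V (pure_u A X V) (\<lambda>x v. act V X x (\<rho> v))"
  have "?l X \<in> bimod_maps A (tensor_u A X V) (tensor_u A V X)" if [simp]: "bimodule k A X" for X
    by (rule lift_bimod_maps [OF tensor_u_is_tensor _ _ b])
      (simp_all add: act_of_lact r'(1) r'(3) [symmetric] act_lact act_ract)
  then have "to_braiding V \<rho> \<in> braiding_maps V"
    by (simp add: to_braiding_def braiding_maps_def)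
  moreover have "?l X (pure_u A X V x v) = act V X x (\<rho> v)"
    if [simp]: "bimodule k A X" "x \<in> carrier X" "v \<in> carrier V" for X x v
    by (subst lift_pure [OF tensor_u_is_tensor _ b]) (simp_all add: bimod_laws_group)
  ultimately show ?thesis
    using \<rho> by (simp add: corresponds_def to_braiding_def)
qed

section \<open>Maps out of the free bimodule, and the coaction of a half braiding\<close>

definition orbit_map :: "('a, 'a, 'u) bimod \<Rightarrow> 'u \<Rightarrow> 'u \<Rightarrow> 'u" where
  "orbit_map X x = lift free_bimod X (regular_bimod A) (regular_bimod A) free_pure
    (\<lambda>a b. lact X a (ract X x b))"

context
  fixes X :: "('a, 'a, 'u) bimod" and x :: 'u
  assumes X [simp]: "bimodule k A X" and x [simp]: "x \<in> carrier X"
begin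

text \<open>Here \<open>k\<close>-centrality of \<open>X\<close> enters:
  \<open>(a c) x b = a x (c b)\<close> for a scalar \<open>c\<close>, so every element of
  \<open>X\<close> can be the image of the generator.\<close>

lemma orbit_map_balanced:
  "balanced kone (regular_bimod A) (regular_bimod A) X (\<lambda>a b. lact X a (ract X x b))"
proof (rule balancedI)
  note [simp] = bimodule_laws
  show "lact X (ract (regular_bimod A) a c) (ract X x b) = lact X a (ract X x (lact (regular_bimod A) c b))"
    if "a \<in> carrier (regular_bimod A)" "b \<in> carrier (regular_bimod A)" and c: "c \<in> kone" for a b c
    using that bimod_laws_central [OF bimodule_laws [OF X] c x]
    by (simp add: kone_closed flip: bimod_laws_simps(9))
qed (simp_all add: bimodule_laws)

lemma orbit_map_maps: "orbit_map X x \<in> bimod_maps A free_bimod X"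
  unfolding orbit_map_def
  by (rule lift_bimod_maps [OF free_is_tensor _ _ orbit_map_balanced]) (simp_all add: bimodule_laws)

lemma orbit_map_pure:
  "\<lbrakk>a \<in> carrier A; b \<in> carrier A\<rbrakk> \<Longrightarrow> orbit_map X x (free_pure a b) = lact X a (ract X x b)"
  unfolding orbit_map_def
  by (rule lift_pure [OF free_is_tensor _ orbit_map_balanced]) (simp_all add: bimodule_laws bimod_laws_group)

text \<open>On \<open>v \<otimes> (a \<otimes> b)\<close> the left side is
  \<open>v \<otimes> a x b\<close> and the right side \<open>v a \<otimes> x b\<close>. Naturality
  along \<open>orbit_map X x\<close> therefore produces exactly the formula in
  \<open>corresponds\<close>.\<close>

lemma TMor_orbit_map:
  assumes V: "bimodule k A V" and s: "s \<in> carrier (tensor_u A V free_bimod)"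
  shows "TMor \<C> V V free_bimod X (\<lambda>x\<in>carrier V. x) (orbit_map X x) s = act V X x (theta V s)"
proof -
  note [simp] = bimodule_laws V
  note m = TMor_maps [OF _ _ _ _ bimod_maps_id orbit_map_maps]
    and p = TMor_pure [OF _ _ _ _ bimod_maps_id orbit_map_maps]
  show ?thesis
  proof (rule tensor_u_eqI [OF _ _ _ bimod_mapsD(1) [OF m]
        hom_compose' [OF bimod_mapsD(1) [OF theta_bimod_maps] act_hom] _ s])
    fix v e assume v [simp]: "v \<in> carrier V" and e: "e \<in> carrier free_bimod"
    have q: "pure_u A V X v \<in> hom X (tensor_u A V X)"
      by (rule homI) simp_all
    have "pure_u A V X v (orbit_map X x e) = act V X x (push V v e)"
      by (rule free_eqI [OF _ hom_compose' [OF bimod_mapsD(1) [OF orbit_map_maps] q]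
            hom_compose' [OF push_hom act_hom] _ e])
        (simp_all add: orbit_map_pure push_pure act_pure tensor_u_balance)
    then show "TMor \<C> V V free_bimod X (\<lambda>x\<in>carrier V. x) (orbit_map X x) (pure_u A V free_bimod v e)
        = act V X x (theta V (pure_u A V free_bimod v e))"
      using e by (simp add: p theta_pure)
  qed simp_all
qed

end

lemma corresponds_to_coaction:
  assumes V: "bimodule k A V" and c: "half_braiding \<C> V c"
  shows "corresponds V c (to_coaction V c)"
proof -
  note [simp] = bimodule_laws V free_bimodule
  note hb = c [unfolded half_braiding_iff [OF V]]
  have cm: "c \<in> braiding_maps V"
    using hb by (rule conjunct1)
  note nat = hb [THEN conjunct2, THEN conjunct1, rule_format]
  note cE = braiding_mapsD [OF cm free_bimodule]
  have p: "(\<lambda>v. pure_u A free_bimod V free_gen v) \<in> hom V (tensor_u A free_bimod V)"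
    by (rule homI) simp_all
  note h = hom_compose' [OF hom_compose' [OF p bimod_mapsD(1) [OF cE]] bimod_mapsD(1) [OF theta_bimod_maps]]
  have hom: "to_coaction V c \<in> hom V (tenA k A V)"
    using h by (simp add: to_coaction_def hom_def Pi_iff)
  have ext: "to_coaction V c \<in> extensional (carrier V)"
    by (simp add: to_coaction_def)
  have eq: "c X (pure_u A X V x v) = act V X x (to_coaction V c v)"
    if X [simp]: "bimodule k A X" and x [simp]: "x \<in> carrier X" and v [simp]: "v \<in> carrier V" for X x v
  proof -
    have o: "orbit_map X x free_gen = x"
      by (simp add: orbit_map_pure)
    have "c X (pure_u A X V (orbit_map X x free_gen) v) =
      TMor \<C> V V free_bimod X (\<lambda>x\<in>carrier V. x) (orbit_map X x) (c free_bimod (pure_u A free_bimod V free_gen v))"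
      by (rule nat [OF free_bimodule X orbit_map_maps]) simp_all
    then show ?thesis
      by (simp add: o TMor_orbit_map bimod_mapsD(3) [OF cE] to_coaction_def)
  qed
  show ?thesis
    unfolding corresponds_def by (intro conjI allI impI cm hom ext eq)
qed

section \<open>Comparison of the axioms for a corresponding pair\<close>

context
  fixes V :: "('a, 'a, 'u) bimod" and c \<rho>
  assumes V [simp]: "bimodule k A V" and corr: "corresponds V c \<rho>"
begin

private lemma laws [simp]: "bimodule k A X \<Longrightarrow> bimod_laws X"
  by (rule bimodule_laws)

private lemma c_maps: "bimodule k A X \<Longrightarrow> c X \<in> bimod_maps A (tensor_u A X V) (tensor_u A V X)"
  by (rule correspondsD(5) [OF corr])

private lemma c_pure:
  "\<lbrakk>bimodule k A X; x \<in> carrier X; v \<in> carrier V\<rbrakk> \<Longrightarrow> c X (pure_u A X V x v) = act V X x (\<rho> v)"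
  by (rule correspondsD(6) [OF corr])

private lemma rho_hom: "\<rho> \<in> hom V (tenA k A V)"
  by (rule correspondsD(2) [OF corr])

private lemma rho_closed [simp]: "v \<in> carrier V \<Longrightarrow> \<rho> v \<in> carrier (tenA k A V)"
  by (rule correspondsD(4) [OF corr])

text \<open>The three rules are tested at \<open>free_gen\<close>, where \<open>act\<close> is
  injective; they come from right linearity, balancedness and left linearity of
  \<open>c free_bimod\<close>.\<close>

lemma corresponds_rules: "coaction_rules V \<rho>"
proof -
  note [simp] = free_bimodule
  note cE = bimod_mapsD [OF c_maps [OF free_bimodule]]
  have act_inj: "s = t" if "act V free_bimod free_gen s = act V free_bimod free_gen t"
    "s \<in> carrier (tenA k A V)" "t \<in> carrier (tenA k A V)" for s t
    using arg_cong [OF that(1), of "theta V"] that(2,3) by (simp add: theta_act)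
  have m: "mid_left V a (\<rho> v) \<in> carrier (tenA k A V)" "mid_right V a (\<rho> v) \<in> carrier (tenA k A V)"
    if "v \<in> carrier V" "a \<in> carrier A" for a v
    using that by (auto intro!: hom_closed [OF mapA_hom] simp: kone_linear_id kone_linear_mult_left kone_linear_ract)
  show ?thesis
    unfolding coaction_rules_def
  proof (intro ballI conjI act_inj)
    fix v a assume [simp]: "v \<in> carrier V" "a \<in> carrier A"
    show "act V free_bimod free_gen (\<rho> (ract V v a)) = act V free_bimod free_gen (ract (tenA k A V) (\<rho> v) a)"
      using cE(6) [of a "pure_u A free_bimod V free_gen v"] by (simp add: act_ract c_pure)
    \<comment> \<open>Both evaluations concern the same element, as
      \<open>u a \<otimes> v = u \<otimes> a v\<close>. The product \<open>u a\<close> is kept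
      unevaluated for \<open>act_of_ract\<close> to apply.\<close>
    show "act V free_bimod free_gen (\<rho> (lact V a v)) = act V free_bimod free_gen (mid_left V a (\<rho> v))"
      using c_pure [of free_bimod "ract free_bimod free_gen a" v]
        c_pure [of free_bimod free_gen "lact V a v"] tensor_u_balance [of free_bimod V free_gen a v]
      by (simp add: act_of_ract del: free_pure_simps(5))
    show "act V free_bimod free_gen (lact (tenA k A V) a (\<rho> v)) = act V free_bimod free_gen (mid_right V a (\<rho> v))"
      using cE(5) [of a "pure_u A free_bimod V free_gen v"] c_pure [of free_bimod "lact free_bimod a free_gen" v]
      by (simp add: act_lact c_pure flip: act_of_lact)
  qed (simp_all add: m)
qed

private lemma rho_rules:
  "\<lbrakk>v \<in> carrier V; a \<in> carrier A\<rbrakk> \<Longrightarrow> \<rho> (ract V v a) = ract (tenA k A V) (\<rho> v) a"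
  "\<lbrakk>v \<in> carrier V; a \<in> carrier A\<rbrakk> \<Longrightarrow> \<rho> (lact V a v) = mid_left V a (\<rho> v)"
  using corresponds_rules by (auto simp: coaction_rules_def)

private lemma rho_linear: "kone_linear V (tenA k A V) \<rho>"
  using rho_hom by (simp add: kone_linear_def rho_rules kone_closed)

text \<open>A scalar crosses the tensor sign:
  \<open>v c \<otimes> 1 = v \<otimes> c = (v \<otimes> 1) c\<close>.\<close>

private lemma one_linear: "kone_linear V (tenA k A V) (\<lambda>x. pureA k A V x \<one>\<^bsub>A\<^esub>)"
proof -
  have "pureA k A V (ract V v c) \<one>\<^bsub>A\<^esub> = pureA k A V v c" if "c \<in> kone" "v \<in> carrier V" for c v
    using that tenA_balance [of V v c "\<one>\<^bsub>A\<^esub>"] by (simp add: kone_closed)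
  then show ?thesis
    by (simp add: kone_linear_def kone_closed hom_def)
qed

text \<open>Naturality amounts to right linearity of \<open>f\<close>: \<open>v\<^sub>0 \<otimes> f
  x v\<^sub>1 = v\<^sub>0 \<otimes> f (x v\<^sub>1)\<close>.\<close>

lemma corresponds_natural:
  assumes X: "bimodule k A X" and Y: "bimodule k A Y" and f: "f \<in> bimod_maps A X Y"
    and x: "x \<in> carrier X" and v: "v \<in> carrier V"
  shows "c Y (pure_u A Y V (f x) v) = TMor \<C> V V X Y (\<lambda>x\<in>carrier V. x) f (c X (pure_u A X V x v))"
proof -
  note [simp] = X Y x v bimod_mapsD [OF f]
  note m = TMor_maps [OF _ _ _ _ bimod_maps_id f]
    and p = TMor_pure [OF _ _ _ _ bimod_maps_id f]
  have "act V Y (f x) (\<rho> v) = TMor \<C> V V X Y (\<lambda>x\<in>carrier V. x) f (act V X x (\<rho> v))"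
    by (rule tenA_eq_mapI [OF _ _ act_hom hom_compose' [OF act_hom bimod_mapsD(1) [OF m]] _ rho_closed [OF v]])
      (simp_all add: act_pure p)
  then show ?thesis
    by (simp add: c_pure)
qed

text \<open>The braiding gives \<open>v\<^sub>0 \<otimes> a v\<^sub>1\<close>, which
  \<open>Runit\<close> sends to \<open>v\<^sub>0 (a v\<^sub>1)\<close>; by the rule for
  \<open>\<rho> (a v)\<close> this is the counit expression at \<open>a v\<close>.\<close>

lemma corresponds_unit:
  assumes v: "v \<in> carrier V" and a: "a \<in> carrier A"
  shows "Runit \<C> V (c (unit_u A) (pure_u A (unit_u A) V (emb A a) v)) = counit V (\<rho> (lact V a v))"
proof -
  note [simp] = v a unit_u_bimodule
  have e [simp]: "(emb A b :: 'u) \<in> carrier (unit_u A)" if "b \<in> carrier A" for b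
    using that by (simp add: unit_u_simps)
  have "Runit \<C> V (act V (unit_u A) (emb A a) (\<rho> v)) = counit V (mid_left V a (\<rho> v))"
    by (rule tenA_eq_mapI [OF _ _ hom_compose' [OF act_hom bimod_mapsD(1) [OF Runit_eq(1)]]
          hom_compose' [OF mapA_hom counit_hom] _ rho_closed [OF v]])
      (simp_all add: act_pure counit_pure mapA_pure kone_linear_id kone_linear_mult_left
        unit_u_simps Runit_eq(2))
  then show ?thesis
    by (simp add: c_pure rho_rules)
qed

text \<open>The map \<open>(v \<otimes> b) \<otimes> d \<mapsto> v \<otimes> (x b \<otimes> y
  d)\<close>, through which both sides of the hexagon factor.\<close>

definition hex_map ::
  "('a, 'a, 'u) bimod \<Rightarrow> ('a, 'a, 'u) bimod \<Rightarrow> 'u \<Rightarrow> 'u \<Rightarrow> (('u \<times> 'a \<Rightarrow>\<^sub>0 int) set \<times> 'a \<Rightarrow>\<^sub>0 int) set \<Rightarrow> 'u"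
  where
  "hex_map X Y x y = lift (tenA k A (tenA k A V)) (tensor_u A V (tensor_u A X Y)) (tenA k A V) (regular_bimod A)
    (pureA k A (tenA k A V))
    (\<lambda>t b. Assoc \<C> V X Y (pure_u A (tensor_u A V X) Y (act V X x t) (ract Y y b)))"

context
  fixes X Y :: "('a, 'a, 'u) bimod" and x y :: 'u
  assumes X [simp]: "bimodule k A X" and Y [simp]: "bimodule k A Y"
    and x [simp]: "x \<in> carrier X" and y [simp]: "y \<in> carrier Y"
begin

private lemma hex_map_balanced:
  "balanced kone (tenA k A V) (regular_bimod A) (tensor_u A V (tensor_u A X Y))
    (\<lambda>t b. Assoc \<C> V X Y (pure_u A (tensor_u A V X) Y (act V X x t) (ract Y y b)))"
proof (rule balancedI)
  show "Assoc \<C> V X Y (pure_u A (tensor_u A V X) Y (act V X x (ract (tenA k A V) t c)) (ract Y y b))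
      = Assoc \<C> V X Y (pure_u A (tensor_u A V X) Y (act V X x t) (ract Y y (lact (regular_bimod A) c b)))"
    if t: "t \<in> carrier (tenA k A V)" and b: "b \<in> carrier (regular_bimod A)" and c: "c \<in> kone" for t c b
    using t b bimod_laws_central [OF _ c y] kone_closed [OF c]
    by (simp add: act_ract act_closed tensor_u_balance flip: bimod_laws_simps(9))
qed (simp_all add: bimod_mapsD [OF Assoc_maps] act_closed hom_mult [OF act_hom])

private lemma hex_map_hom: "hex_map X Y x y \<in> hom (tenA k A (tenA k A V)) (tensor_u A V (tensor_u A X Y))"
  unfolding hex_map_def
  by (rule lift_hom [OF tenA_is_tensor _ hex_map_balanced]) (simp_all add: bimod_laws_group)

private lemma hex_map_pure:
  "\<lbrakk>t \<in> carrier (tenA k A V); b \<in> carrier A\<rbrakk> \<Longrightarrow> hex_map X Y x y (pureA k A (tenA k A V) t b) =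
    Assoc \<C> V X Y (pure_u A (tensor_u A V X) Y (act V X x t) (ract Y y b))"
  unfolding hex_map_def
  by (rule lift_pure [OF tenA_is_tensor _ hex_map_balanced]) (simp_all add: bimod_laws_group)

text \<open>Braiding \<open>v\<close> past \<open>y\<close> gives
  \<open>x \<otimes> (v\<^sub>0 \<otimes> y v\<^sub>1)\<close>; braiding \<open>v\<^sub>0\<close>
  past \<open>x\<close> replaces \<open>v\<^sub>0\<close> by \<open>\<rho> v\<^sub>0\<close>. The
  result is \<open>hex_map\<close> at \<open>\<rho> v\<^sub>0 \<otimes> v\<^sub>1\<close>.\<close>

private lemma hexagon_rhs_eq:
  assumes v [simp]: "v \<in> carrier V"
  shows "hexagon_rhs V c X Y (pure_u A (tensor_u A X Y) V (pure_u A X Y x y) v) =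
    hex_map X Y x y (mapA k A V (tenA k A V) \<rho> (\<lambda>b. b) (\<rho> v))"
proof -
  let ?inv = "inv_mor \<C> (tensor_u A (tensor_u A X V) Y) (tensor_u A X (tensor_u A V Y)) (Assoc \<C> X V Y)"
  let ?cX = "TMor \<C> (tensor_u A X V) (tensor_u A V X) Y Y (c X) (\<lambda>x\<in>carrier Y. x)"
  note [simp] = bimod_mapsD(3) [OF c_maps] act_closed
  have pr: "pure_u A X (tensor_u A V Y) x \<in> hom (tensor_u A V Y) (tensor_u A X (tensor_u A V Y))"
    by (rule homI) simp_all
  have cXm: "?cX \<in> bimod_maps A (tensor_u A (tensor_u A X V) Y) (tensor_u A (tensor_u A V X) Y)"
    by (rule TMor_maps) (simp_all add: c_maps bimod_maps_id)
  note h = hom_compose' [OF hom_compose' [OF hom_compose' [OF hom_compose' [OF act_hom pr]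
     bimod_mapsD(1) [OF Assoc_inv_maps]] bimod_mapsD(1) [OF cXm]] bimod_mapsD(1) [OF Assoc_maps]]
  \<comment> \<open>The tensor \<open>\<rho> v\<close> is replaced by a variable one; as both sides
    are additive in it, a pure tensor suffices, and \<open>c_pure\<close> then applies to its left
    factor.\<close>
  have "Assoc \<C> V X Y (?cX (?inv (pure_u A X (tensor_u A V Y) x (act V Y y (\<rho> v))))) =
    hex_map X Y x y (mapA k A V (tenA k A V) \<rho> (\<lambda>b. b) (\<rho> v))"
    by (rule tenA_eq_mapI [OF _ _ h hom_compose' [OF mapA_hom hex_map_hom] _ rho_closed [OF v]])
      (simp_all add: act_pure Assoc_inv_pure TMor_pure c_maps bimod_maps_id c_pure mapA_pure
        rho_linear kone_linear_id hex_map_pure)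
  then show ?thesis
    by (simp add: Assoc_pure TMor_pure c_maps bimod_maps_id c_pure)
qed

text \<open>Braiding past \<open>x \<otimes> y\<close> at once gives
  \<open>v\<^sub>0 \<otimes> (x \<otimes> y v\<^sub>1)\<close>, so nothing acts on \<open>x\<close>;
  this is \<open>hex_map\<close> at
  \<open>v\<^sub>0 \<otimes> 1 \<otimes> v\<^sub>1\<close>.\<close>

private lemma hexagon_lhs_eq:
  assumes v [simp]: "v \<in> carrier V"
  shows "c (tensor_u A X Y) (pure_u A (tensor_u A X Y) V (pure_u A X Y x y) v) =
    hex_map X Y x y (mapA k A V (tenA k A V) (\<lambda>x. pureA k A V x \<one>\<^bsub>A\<^esub>) (\<lambda>b. b) (\<rho> v))"
proof -
  have "act V (tensor_u A X Y) (pure_u A X Y x y) (\<rho> v) =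
    hex_map X Y x y (mapA k A V (tenA k A V) (\<lambda>x. pureA k A V x \<one>\<^bsub>A\<^esub>) (\<lambda>b. b) (\<rho> v))"
    by (rule tenA_eq_mapI [OF _ _ act_hom hom_compose' [OF mapA_hom hex_map_hom] _ rho_closed [OF v]])
      (simp_all add: act_pure mapA_pure one_linear kone_linear_id hex_map_pure Assoc_pure)
  then show ?thesis
    by (simp add: c_pure tensor_u_bimodule)
qed

lemmas hexagon_eqs = hexagon_lhs_eq hexagon_rhs_eq hex_map_hom hex_map_pure

end

text \<open>At the free generator \<open>hex_map\<close> has the left inverse
  \<open>v \<otimes> ((a \<otimes> b) \<otimes> (c \<otimes> d)) \<mapsto> (v a \<otimes> b c) \<otimes> d\<close>.\<close>

lemma hex_map_inj:
  assumes s: "s \<in> carrier (tenA k A (tenA k A V))" and t: "t \<in> carrier (tenA k A (tenA k A V))"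
    and eq: "hex_map free_bimod free_bimod free_gen free_gen s = hex_map free_bimod free_bimod free_gen free_gen t"
  shows "s = t"
proof -
  let ?E = "free_bimod"
  note [simp] = free_bimodule act_closed
  let ?i = "inv_mor \<C> (tensor_u A (tensor_u A V ?E) ?E) (tensor_u A V (tensor_u A ?E ?E)) (Assoc \<C> V ?E ?E)"
  note th = bimod_mapsD [OF theta_bimod_maps]
  \<comment> \<open>\<open>theta\<close> absorbs the first factor \<open>E\<close>, and
    \<open>push\<close> at the bimodule \<open>tenA k A V\<close> absorbs the second.\<close>
  have b: "balanced (carrier A) (tensor_u A V ?E) ?E (tenA k A (tenA k A V)) (\<lambda>t e. push (tenA k A V) (theta V t) e)"
    using balancedD [OF push_balanced [of "tenA k A V"]]
    by (intro balancedI) (simp_all add: th)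
  let ?h = "lift (tensor_u A (tensor_u A V ?E) ?E) (tenA k A (tenA k A V)) (tensor_u A V ?E) ?E
    (pure_u A (tensor_u A V ?E) ?E) (\<lambda>t e. push (tenA k A V) (theta V t) e)"
  have hh: "?h \<in> hom (tensor_u A (tensor_u A V ?E) ?E) (tenA k A (tenA k A V))"
    by (rule lift_hom [OF tensor_u_is_tensor _ b]) (simp_all add: bimod_laws_group)
  have hp: "?h (pure_u A (tensor_u A V ?E) ?E t e) = push (tenA k A V) (theta V t) e"
    if "t \<in> carrier (tensor_u A V ?E)" "e \<in> carrier ?E" for t e
    by (rule lift_pure [OF tensor_u_is_tensor _ b]) (use that in \<open>simp_all add: bimod_laws_group\<close>)
  have ia: "?i (Assoc \<C> V ?E ?E z) = z" if z: "z \<in> carrier (tensor_u A (tensor_u A V ?E) ?E)" for z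
    by (rule assoc_left_eqI [OF _ _ _ _ hom_compose' [OF bimod_mapsD(1) [OF Assoc_maps] bimod_mapsD(1) [OF Assoc_inv_maps]] _ _ z])
      (simp_all add: Assoc_pure Assoc_inv_pure hom_def)
  have inv: "?h (?i (hex_map ?E ?E free_gen free_gen u)) = u" if u: "u \<in> carrier (tenA k A (tenA k A V))" for u
    by (rule tenA_eq_mapI [OF _ _ hom_compose' [OF hom_compose' [OF hexagon_eqs(3) bimod_mapsD(1) [OF Assoc_inv_maps]] hh] _ _ u])
      (simp_all add: hexagon_eqs(4) ia hp theta_act push_pure hom_def)
  show ?thesis
    using inv [OF s] unfolding eq inv [OF t] by (rule sym)
qed

text \<open>Naturality and the rules for the actions hold for any corresponding pair, so two
  equivalences remain. The unit condition is the counit condition at the elements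
  \<open>a v\<close>, which for \<open>a = 1\<close> are all of \<open>V\<close>. Coassociativity
  implies the hexagon by applying \<open>hex_map\<close>; conversely \<open>hex_map\<close> is
  cancelled at the generator.\<close>

lemma corresponds_iff: "half_braiding \<C> V c \<longleftrightarrow> yd_coaction k A V \<rho>"
proof -
  let ?co = "\<lambda>v. mapA k A V (tenA k A V) \<rho> (\<lambda>b. b) (\<rho> v) =
       mapA k A V (tenA k A V) (\<lambda>x. pureA k A V x \<one>\<^bsub>A\<^esub>) (\<lambda>b. b) (\<rho> v)"
  have co: "(\<forall>X Y x y v. bimodule k A X \<longrightarrow> bimodule k A Y \<longrightarrow> x \<in> carrier X \<longrightarrow> y \<in> carrier Y \<longrightarrow>
       v \<in> carrier V \<longrightarrow>
       c (tensor_u A X Y) (pure_u A (tensor_u A X Y) V (pure_u A X Y x y) v) =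
       hexagon_rhs V c X Y (pure_u A (tensor_u A X Y) V (pure_u A X Y x y) v)) \<longleftrightarrow>
      (\<forall>v\<in>carrier V. ?co v)" (is "?hex \<longleftrightarrow> _")
  proof
    assume ?hex
    show "\<forall>v\<in>carrier V. ?co v"
    proof (intro ballI hex_map_inj)
      fix v assume v: "v \<in> carrier V"
      have g: "free_gen \<in> carrier free_bimod" by simp
      show "hex_map free_bimod free_bimod free_gen free_gen (mapA k A V (tenA k A V) \<rho> (\<lambda>b. b) (\<rho> v)) =
        hex_map free_bimod free_bimod free_gen free_gen
          (mapA k A V (tenA k A V) (\<lambda>x. pureA k A V x \<one>\<^bsub>A\<^esub>) (\<lambda>b. b) (\<rho> v))"
        using \<open>?hex\<close> [rule_format, OF free_bimodule free_bimodule g g v]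
        unfolding hexagon_eqs(1,2) [OF free_bimodule free_bimodule g g v] by (rule sym)
    qed (auto intro!: hom_closed [OF mapA_hom] simp: rho_linear one_linear kone_linear_id)
  next
    assume "\<forall>v\<in>carrier V. ?co v"
    then show ?hex
      by (simp add: hexagon_eqs(1,2))
  qed
  have un: "(\<forall>a\<in>carrier A. \<forall>v\<in>carrier V.
       Runit \<C> V (c (unit_u A) (pure_u A (unit_u A) V (emb A a) v)) = lact V a v) \<longleftrightarrow>
      (\<forall>v\<in>carrier V. counit V (\<rho> v) = v)" (is "?un \<longleftrightarrow> _")
  proof
    assume u: ?un
    show "\<forall>v\<in>carrier V. counit V (\<rho> v) = v"
    proof
      fix v assume "v \<in> carrier V"
      then show "counit V (\<rho> v) = v"
        using u [rule_format, of "\<one>\<^bsub>A\<^esub>" v] by (simp add: corresponds_unit)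
    qed
  qed (simp add: corresponds_unit)
  have nat: "\<forall>X Y f x v. bimodule k A X \<longrightarrow> bimodule k A Y \<longrightarrow> f \<in> bimod_maps A X Y \<longrightarrow>
       x \<in> carrier X \<longrightarrow> v \<in> carrier V \<longrightarrow>
       c Y (pure_u A Y V (f x) v) = TMor \<C> V V X Y (\<lambda>x\<in>carrier V. x) f (c X (pure_u A X V x v))"
    by (intro allI impI corresponds_natural)
  have "c \<in> braiding_maps V" "\<rho> \<in> hom V (tenA k A V)" "\<rho> \<in> extensional (carrier V)"
    by (rule correspondsD [OF corr])+
  moreover have "(\<forall>v\<in>carrier V. \<forall>a\<in>carrier A. \<rho> (ract V v a) = ract (tenA k A V) (\<rho> v) a)"
    "(\<forall>v\<in>carrier V. \<forall>a\<in>carrier A. \<rho> (lact V a v) = mid_left V a (\<rho> v))"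
    "(\<forall>v\<in>carrier V. \<forall>a\<in>carrier A. lact (tenA k A V) a (\<rho> v) = mid_right V a (\<rho> v))"
    using corresponds_rules by (auto simp: coaction_rules_def)
  ultimately show ?thesis
    unfolding half_braiding_iff [OF V] yd_coaction_iff [OF laws [OF V]] co un
    using nat by - (intro iffI conjI; elim conjE; assumption)
qed

end

text \<open>The two composites send \<open>x \<otimes> v\<close> to
  \<open>f v\<^sub>0 \<otimes> x v\<^sub>1\<close> and to \<open>act V' X x (\<rho>' (f v))\<close>.
  Both are values of \<open>act V' X x\<close>, at the two sides of the coaction condition, and
  \<open>theta\<close> cancels it at the generator.\<close>

lemma corresponds_morphism:
  assumes V: "bimodule k A V" and V': "bimodule k A V'" and c: "corresponds V c \<rho>" and c': "corresponds V' c' \<rho>'"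
    and f: "f \<in> bimod_maps A V V'"
  shows "(\<forall>X\<in>{X. bimodule k A X}.
      compose (carrier (tensor_u A X V)) (TMor \<C> V V' X X f (\<lambda>x\<in>carrier X. x)) (c X) =
      compose (carrier (tensor_u A X V)) (c' X) (TMor \<C> X X V V' (\<lambda>x\<in>carrier X. x) f)) \<longleftrightarrow>
    (\<forall>v\<in>carrier V. \<rho>' (f v) = mapA k A V V' f (\<lambda>b. b) (\<rho> v))" (is "?l \<longleftrightarrow> ?r")
proof -
  note [simp] = bimodule_laws V V' bimod_mapsD(3) [OF f]
  have rc [simp]: "v \<in> carrier V \<Longrightarrow> \<rho> v \<in> carrier (tenA k A V)" "v \<in> carrier V' \<Longrightarrow> \<rho>' v \<in> carrier (tenA k A V')" for v
    by (simp_all add: correspondsD(4) [OF c] correspondsD(4) [OF c'])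
  have cm: "c X \<in> bimod_maps A (tensor_u A X V) (tensor_u A V X)"
    "c' X \<in> bimod_maps A (tensor_u A X V') (tensor_u A V' X)" if "bimodule k A X" for X
    using that by (simp_all add: correspondsD(5) [OF c] correspondsD(5) [OF c'])
  have cp: "\<lbrakk>x \<in> carrier X; v \<in> carrier V\<rbrakk> \<Longrightarrow> c X (pure_u A X V x v) = act V X x (\<rho> v)"
    "\<lbrakk>x \<in> carrier X; v' \<in> carrier V'\<rbrakk> \<Longrightarrow> c' X (pure_u A X V' x v') = act V' X x (\<rho>' v')"
    if "bimodule k A X" for X x v v'
    using that by (simp_all add: correspondsD(6) [OF c] correspondsD(6) [OF c'])
  have ac: "TMor \<C> V V' X X f (\<lambda>x\<in>carrier X. x) (act V X x t) = act V' X x (mapA k A V V' f (\<lambda>b. b) t)"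
    if X [simp]: "bimodule k A X" and x [simp]: "x \<in> carrier X" and t: "t \<in> carrier (tenA k A V)" for X x t
    by (rule tenA_eq_mapI [OF _ _ hom_compose' [OF act_hom bimod_mapsD(1) [OF TMor_maps [OF _ _ _ _ f bimod_maps_id]]]
          hom_compose' [OF mapA_hom act_hom] _ t])
      (simp_all add: act_pure TMor_pure [OF _ _ _ _ f bimod_maps_id] mapA_pure kone_linear_id kone_linear_bimod_maps [OF f])
  have mc: "mapA k A V V' f (\<lambda>b. b) (\<rho> v) \<in> carrier (tenA k A V')" if "v \<in> carrier V" for v
    by (rule hom_closed [OF mapA_hom]) (use that in \<open>simp_all add: kone_linear_id kone_linear_bimod_maps [OF f]\<close>)
  have "?l \<longleftrightarrow> (\<forall>X\<in>{X. bimodule k A X}. \<forall>x\<in>carrier X. \<forall>v\<in>carrier V.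
      act V' X x (mapA k A V V' f (\<lambda>b. b) (\<rho> v)) = act V' X x (\<rho>' (f v)))"
  proof (rule ball_cong [OF refl])
    fix X :: "('a, 'a, 'u) bimod" assume "X \<in> {X. bimodule k A X}"
    then have X [simp]: "bimodule k A X" by simp
    show "compose (carrier (tensor_u A X V)) (TMor \<C> V V' X X f (\<lambda>x\<in>carrier X. x)) (c X) =
      compose (carrier (tensor_u A X V)) (c' X) (TMor \<C> X X V V' (\<lambda>x\<in>carrier X. x) f) \<longleftrightarrow>
      (\<forall>x\<in>carrier X. \<forall>v\<in>carrier V.
      act V' X x (mapA k A V V' f (\<lambda>b. b) (\<rho> v)) = act V' X x (\<rho>' (f v)))"
      by (subst tensor_u_maps_eq_iff [where H = "tensor_u A V' X"])
        (auto intro!: bimod_maps_compose [OF _ cm(1) TMor_maps [OF _ _ _ _ f bimod_maps_id]]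
          bimod_maps_compose [OF _ TMor_maps [OF _ _ _ _ bimod_maps_id f] cm(2)]
          simp: compose_eq TMor_pure [OF _ _ _ _ bimod_maps_id f] cp ac)
  qed
  also have "\<dots> \<longleftrightarrow> ?r"
  proof
    assume l: "\<forall>X\<in>{X. bimodule k A X}. \<forall>x\<in>carrier X. \<forall>v\<in>carrier V.
      act V' X x (mapA k A V V' f (\<lambda>b. b) (\<rho> v)) = act V' X x (\<rho>' (f v))"
    show ?r
    proof
      fix v assume v: "v \<in> carrier V"
      have "act V' free_bimod free_gen (mapA k A V V' f (\<lambda>b. b) (\<rho> v)) = act V' free_bimod free_gen (\<rho>' (f v))"
        using l v free_bimodule by simp
      from arg_cong [OF this, of "theta V'"] show "\<rho>' (f v) = mapA k A V V' f (\<lambda>b. b) (\<rho> v)"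
        using v by (simp add: theta_act mc)
    qed
  qed simp
  finally show ?thesis .
qed

text \<open>The functors keep the underlying bimodule and the underlying map and exchange only the
  extra datum; on objects they are mutually inverse because each partner in a corresponding pair
  determines the other.\<close>

theorem weak_right_center_isomorphic_yd:
  "isomorphic_categories (weak_right_center \<C>)
    (yd_cat k A :: (('a, 'a, 'u) bimod \<times> ('u \<Rightarrow> ('u \<times> 'a \<Rightarrow>\<^sub>0 int) set), 'u \<Rightarrow> 'u) cat)"
proof -
  let ?F = "\<lambda>(V, c). (V, to_coaction V c)" and ?G = "\<lambda>(V, \<rho>). (V, to_braiding V \<rho>)"
  have yd: "corresponds V (to_braiding V \<rho>) \<rho>" if "bimodule k A V" "yd_coaction k A V \<rho>" for V \<rho>
    using that yd_coaction_iff [OF bimodule_laws]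
    by (intro corresponds_to_braiding) (auto simp: coaction_rules_def)
  show ?thesis
  proof (rule isomorphic_categoriesI [where F = ?F and G = ?G])
    show "category (yd_cat k A :: (('a, 'a, 'u) bimod \<times> ('u \<Rightarrow> ('u \<times> 'a \<Rightarrow>\<^sub>0 int) set), 'u \<Rightarrow> 'u) cat)"
      by (rule category_yd_cat)
  next
    fix P assume "P \<in> Obj (weak_right_center \<C>)"
    then obtain V c where P: "P = (V, c)" "bimodule k A V" "half_braiding \<C> V c"
      by (auto simp: weak_right_center_def)
    note co = corresponds_to_coaction [OF P(2,3)]
    show "?F P \<in> Obj (yd_cat k A)"
      using corresponds_iff [OF P(2) co] P by (simp add: yd_cat_def)
    show "?G (?F P) = P"
      using to_braiding_eq [OF P(2) co] P by simp
    show "Idn (weak_right_center \<C>) P = Idn (yd_cat k A) (?F P)"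
      by (simp add: weak_right_center_def yd_cat_def P)
  next
    fix P assume "P \<in> Obj (yd_cat k A :: (('a, 'a, 'u) bimod \<times> ('u \<Rightarrow> ('u \<times> 'a \<Rightarrow>\<^sub>0 int) set), 'u \<Rightarrow> 'u) cat)"
    then obtain V \<rho> where P: "P = (V, \<rho>)" "bimodule k A V" "yd_coaction k A V \<rho>"
      by (auto simp: yd_cat_def)
    note co = yd [OF P(2,3)]
    show "?G P \<in> Obj (weak_right_center \<C>)"
      using corresponds_iff [OF P(2) co] P by (simp add: weak_right_center_def)
    show "?F (?G P) = P"
      using to_coaction_eq [OF P(2) co] P by simp
  next
    fix P Q assume "P \<in> Obj (weak_right_center \<C>)" "Q \<in> Obj (weak_right_center \<C>)"
    then obtain V c V' c' where P: "P = (V, c)" "bimodule k A V" "half_braiding \<C> V c"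
      and Q: "Q = (V', c')" "bimodule k A V'" "half_braiding \<C> V' c'"
      by (auto simp: weak_right_center_def)
    note m = corresponds_morphism [OF P(2) Q(2) corresponds_to_coaction [OF P(2,3)] corresponds_to_coaction [OF Q(2,3)]]
    show "Mor (weak_right_center \<C>) P Q = Mor (yd_cat k A) (?F P) (?F Q)"
      unfolding P Q
      by (simp add: weak_right_center_def yd_cat_def m [unfolded Ball_def mem_Collect_eq] Ball_def cong: conj_cong)
  next
    fix P Q R
    show "Cmp (weak_right_center \<C>) P Q R = Cmp (yd_cat k A) (?F P) (?F Q) (?F R)"
      by (auto simp: weak_right_center_def yd_cat_def fun_eq_iff split: prod.splits)
  qed
qed

end

theorem proposition2p3:
  fixes k :: "'k ring" and A :: "('k, 'a) module" and \<iota> :: "'a \<Rightarrow> 'u"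
  assumes "k_algebra k A"
    and "infinite (UNIV :: 'u set)" and "inj_on \<iota> (carrier A)"
  shows "isomorphic_categories
    (weak_right_center (bimod_moncat k A :: (('a, 'a, 'u) bimod, 'u \<Rightarrow> 'u) moncat))
    (yd_cat k A :: (('a, 'a, 'u) bimod \<times> ('u \<Rightarrow> ('u \<times> 'a \<Rightarrow>\<^sub>0 int) set), 'u \<Rightarrow> 'u) cat)"
proof -
  interpret bimod_universe k A \<iota>
    using assms by (simp add: bimod_universe_def bimod_universe_axioms_def)
  show ?thesis by (rule weak_right_center_isomorphic_yd)
qed

end
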